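(* Let $n\ge3$, $2<p\le2^*=\frac{2n}{n-2}$ and $\theta\in(0,2)$. Define $R>1$ and $\alpha_{n,\theta}<1$ by $$R^\theta=1+\frac{1}{\sqrt{n-2}},\qquad -\ln\alpha_{n,\theta}=R^{2\theta}-1+\int_0^1\frac{s^{\theta-1}(2R^\theta-s^\theta)}{(R^\theta-s^\theta)^2}ds.$$ Then for all $0<\alpha\le\alpha_{n,\theta}$ and all $u\in C_c^\infty(B_1)$ there holds $$\int_{B_1}|\nabla u|^2dx-\Big(\frac{n-2}{2}\Big)^2\int_{B_1}\frac{u^2}{|x|^2}dx-\theta^2\int_{B_1}\frac{u^2}{|x|^{2-\theta}(R^\theta-|x|^\theta)}dx\ \ge\ (n-2)^{-\frac{p+2}{p}}S_{n,p}\bigg(\int_{B_1}|x|^{\frac{p(n-2)}{2}-n}X^{\frac{p+2}{2}}(\alpha|x|)|u|^pdx\bigg)^{2/p}.$$ Moreover the constant $(n-2)^{-\frac{p+2}{p}}S_{n,p}$ is sharp.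
   Context: $B_1$ is the open unit ball of $\mathbb{R}^n$ centered at $0$. $X(t)=\frac{1}{1-\ln t}$ for $t\in(0,1)$, and $X^q(t)=(X(t))^q$. Functions are real-valued. $S_{n,p}$ denotes the best (largest) constant in the inequality $\int_{\mathbb{R}^n}|\nabla u|^2dx\ge S_{n,p}\big(\int_{\mathbb{R}^n}|x|^{\frac{p(n-2)}{2}-n}|u|^pdx\big)^{2/p}$ for all $u\in C_c^\infty(\mathbb{R}^n)$. "Sharp" means that the constant cannot be replaced by a larger one. *)

theory Defs
  imports "HOL-Analysis.Analysis"
begin

definition partial_deriv :: "'n \<Rightarrow> (real^'n \<Rightarrow> real) \<Rightarrow> real^'n \<Rightarrow> real" where
  "partial_deriv i u x = frechet_derivative u (at x) (axis i 1)"

definition grad :: "(real^'n \<Rightarrow> real) \<Rightarrow> real^'n \<Rightarrow> real^'n" where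
  "grad u x = (\<chi> i. partial_deriv i u x)"

(* The derivative operator above is total, so differentiability is required explicitly at each level. *)
primrec C_k :: "nat \<Rightarrow> (real^'n \<Rightarrow> real) \<Rightarrow> bool" where
  "C_k 0 u \<longleftrightarrow> continuous_on UNIV u"
| "C_k (Suc k) u \<longleftrightarrow> u differentiable_on UNIV \<and> (\<forall>i. C_k k (partial_deriv i u))"

(* Elements of C_c^infinity(U), U open, are represented by their extensions by zero to the whole space. *)
definition test_functions :: "(real^'n) set \<Rightarrow> (real^'n \<Rightarrow> real) set" where
  "test_functions U =
    {u. (\<forall>k. C_k k u) \<and> compact (closure {x. u x \<noteq> 0}) \<and> closure {x. u x \<noteq> 0} \<subseteq> U}"

(* S_{n,p} with n = CARD('n): the best constant on the whole space. *)
definition S_const :: "'n::finite itself \<Rightarrow> real \<Rightarrow> real" where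
  "S_const _ p = Sup {S. \<forall>u \<in> test_functions (UNIV :: (real^'n) set).
     (LINT x|lborel. (norm (grad u x))\<^sup>2)
       \<ge> S * (LINT x|lborel.
                norm x powr (p * (real CARD('n) - 2) / 2 - real CARD('n)) * \<bar>u x\<bar> powr p) powr (2 / p)}"

definition X :: "real \<Rightarrow> real" where
  "X t = 1 / (1 - ln t)"

definition hardy_deficit :: "real \<Rightarrow> real \<Rightarrow> (real^'n \<Rightarrow> real) \<Rightarrow> real" where
  "hardy_deficit \<theta> R u =
     (LINT x:ball 0 1|lborel. (norm (grad u x))\<^sup>2)
     - ((real CARD('n) - 2) / 2)\<^sup>2 * (LINT x:ball 0 1|lborel. (u x)\<^sup>2 / (norm x)\<^sup>2)
     - \<theta>\<^sup>2 * (LINT x:ball 0 1|lborel.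
               (u x)\<^sup>2 / (norm x powr (2 - \<theta>) * (R powr \<theta> - norm x powr \<theta>)))"

definition weighted_term :: "real \<Rightarrow> real \<Rightarrow> (real^'n \<Rightarrow> real) \<Rightarrow> real" where
  "weighted_term p \<alpha> u =
     (LINT x:ball 0 1|lborel.
        norm x powr (p * (real CARD('n) - 2) / 2 - real CARD('n))
        * X (\<alpha> * norm x) powr ((p + 2) / 2) * \<bar>u x\<bar> powr p) powr (2 / p)"

end

theory Submission
  imports Defs "HOL-Complex_Analysis.Great_Picard"
begin

text \<open>
  Write \<open>N = n - 2\<close> and \<open>A = R powr \<theta>\<close>. The radial function \<open>\<phi>(r) = r powr (-N/2) * (A - r powr \<theta>)\<close> is a
  positive solution of the Euler equation of the Hardy deficit, so that the deficit of \<open>u = \<phi> v\<close> is the integral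
  of \<open>\<phi>\<^sup>2 |\<nabla> v|\<^sup>2\<close>. The radial change of variables \<open>\<rho>\<close> with \<open>\<rho>' = \<rho> powr (N + 1) / (r * g\<^sup>2)\<close>, \<open>g = A - r powr \<theta>\<close>, turns
  this integral into the Dirichlet integral of \<open>w\<close>, where \<open>v = w \<circ> \<Phi>\<close> and \<open>\<Phi>(x) = \<rho>(|x|) x / |x|\<close>, up to a nonnegative tangential
  term; the choice of \<open>R\<close> is exactly the condition for its sign at \<open>r = 1\<close>. The choice of \<open>\<alpha>\<^sub>0\<close>
  compares the transformed weight with the weight in the definition of \<open>S_const\<close>, with
  asymptotic equality at the origin.

  For the sharpness one concentrates \<open>w\<close> at the origin. The tangential term then blows up, so \<open>w\<close> has
  to be radial, and one needs that \<open>S_const\<close> is already determined by radial functions. This follows from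
  polarization: among the nonnegative Lipschitz functions with a common support, Lipschitz constant,
  bound on the difference quotients and lower bound on the weighted norm, one that minimises the
  second moment exists by Arzela-Ascoli, and it is radially decreasing, because polarization at a hyperplane
  preserves the class and decreases the moment strictly otherwise.
\<close>

text \<open>The ground state enters through \<open>\<kappa>\<close> = \<phi>' / (r \<phi>), which
  solves a Riccati equation; completing the square with it leaves only a divergence. Separating
  variables in the equation for \<rho> gives \<rho>^(-N) = N H with one free constant. It is fixed
  by H 1 = 1, since N (A - 1)^2 = 1 then makes the radial and the tangential stretching equal at r =
  1. The exponent (p + 2) / 2 arises because the two weights differ by the factor X N H g^2 to
  exactly this power.

  The substitution is singular at the origin, so it acts on C1 functions supported in an annulus.
  Other functions are reached by cutoffs with gradients of order 1 / |x|, whose squares are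
  integrable in dimension at least 3.

  Polarized functions and minimisers are only Lipschitz. In place of weak gradients, squared
  differences over pairs at distance less than t are compared for every t: this energy does not grow
  under polarization, convolution with a probability density or, by Fatou, pointwise limits, and for
  C1 functions its rescaling recovers the Dirichlet integral as t tends to 0. Radial mollification
  then returns to C1 without loss.\<close>

text \<open>
  The library has the change of variables theorem only for well-ordered index types. It is transferred to an
  arbitrary finite index type by a permutation of the coordinates.
\<close>
typedef ('n::finite) ordered_index = "{..<CARD('n)}"
  using zero_less_card_finite by blast

instance ordered_index :: (finite) finite
proof
  have "inj (Rep_ordered_index :: 'a ordered_index \<Rightarrow> nat)"
    by (meson Rep_ordered_index_inject injI)
  moreover have "finite (range (Rep_ordered_index :: 'a ordered_index \<Rightarrow> nat))"
    by (metis Rep_ordered_index finite_lessThan finite_subset image_subset_iff)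
  ultimately show "finite (UNIV :: 'a ordered_index set)"
    using finite_imageD by blast
qed

instantiation ordered_index :: (finite) linorder
begin
definition "x \<le> y \<longleftrightarrow> Rep_ordered_index x \<le> Rep_ordered_index y"
definition "x < y \<longleftrightarrow> Rep_ordered_index x < Rep_ordered_index y"
instance
  by standard (auto simp: less_eq_ordered_index_def less_ordered_index_def Rep_ordered_index_inject)
end

instance ordered_index :: (finite) wellorder
proof
  fix P :: "'a ordered_index \<Rightarrow> bool" and a
  assume step: "\<And>x. (\<And>y. y < x \<Longrightarrow> P y) \<Longrightarrow> P x"
  show "P a"
    by (induction a rule: measure_induct_rule[where f = Rep_ordered_index])
      (use step in \<open>auto simp: less_ordered_index_def\<close>)
qed

lemma card_ordered_index: "CARD('n::finite ordered_index) = CARD('n)"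
  using type_definition.card[OF type_definition_ordered_index] by simp

section \<open>Invariance of Lebesgue measure under coordinate permutations and orthogonal
  maps\<close>

lemma box_measure_preserving:
  fixes P :: "'a::euclidean_space \<Rightarrow> 'b::euclidean_space"
  assumes "P \<in> borel_measurable borel"
    and "\<And>l u. P -` box l u = box (Q l) (Q u)"
    and "\<And>l u. (\<And>b. b \<in> Basis \<Longrightarrow> l \<bullet> b \<le> u \<bullet> b) \<Longrightarrow>
            emeasure lborel (box (Q l) (Q u)) = (\<Prod>b\<in>Basis. (u - l) \<bullet> b)"
  shows "distr lborel lborel P = lborel"
proof (rule lborel_eqI[symmetric])
  fix l u :: 'b assume "\<And>b. b \<in> Basis \<Longrightarrow> l \<bullet> b \<le> u \<bullet> b"
  then show "emeasure (distr lborel lborel P) (box l u) = ennreal (\<Prod>b\<in>Basis. (u - l) \<bullet> b)"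
    using assms by (subst emeasure_distr) auto
qed simp

definition reindex :: "('m \<Rightarrow> 'n) \<Rightarrow> real^'n \<Rightarrow> real^'m" where
  "reindex \<pi> x = (\<chi> j. x $ \<pi> j)"

lemma reindex_inverse: "bij \<pi> \<Longrightarrow> reindex (inv \<pi>) (reindex \<pi> x) = x"
  "bij \<pi> \<Longrightarrow> reindex \<pi> (reindex (inv \<pi>) y) = y"
  by (simp_all add: reindex_def vec_eq_iff bij_is_surj bij_is_inj surj_f_inv_f)

lemma linear_reindex: "linear (reindex \<pi>)"
  by (auto simp: reindex_def vec_eq_iff intro!: linearI)

lemma inner_reindex:
  fixes \<pi> :: "'m::finite \<Rightarrow> 'n::finite"
  assumes "bij \<pi>"
  shows "reindex \<pi> x \<bullet> reindex \<pi> y = x \<bullet> y"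
  unfolding inner_vec_def reindex_def
  using sum.reindex_bij_betw[OF assms, of "\<lambda>i. x $ i \<bullet> y $ i"] by simp

lemma norm_reindex:
  fixes \<pi> :: "'m::finite \<Rightarrow> 'n::finite"
  assumes "bij \<pi>"
  shows "norm (reindex \<pi> x) = norm x"
  by (simp add: norm_eq_sqrt_inner inner_reindex assms)

lemma measurable_reindex[measurable]:
  fixes \<pi> :: "'m::finite \<Rightarrow> 'n::finite"
  shows "reindex \<pi> \<in> borel_measurable borel"
  by (intro borel_measurable_continuous_onI linear_continuous_on linear_conv_bounded_linear[THEN iffD1] linear_reindex)

lemma prod_Basis_vec: "(\<Prod>b\<in>(Basis :: (real^'n::finite) set). f b) = (\<Prod>i\<in>UNIV. f (axis i 1))"
  by (simp add: Basis_vec_def axis_eq_axis prod.UNION_disjoint)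

lemma distr_reindex:
  fixes \<pi> :: "'m::finite \<Rightarrow> 'n::finite"
  assumes "bij \<pi>"
  shows "distr lborel lborel (reindex \<pi>) = lborel"
proof (rule box_measure_preserving)
  show "reindex \<pi> -` box l u = box (reindex (inv \<pi>) l) (reindex (inv \<pi>) u)" for l u
  proof -
    have "(\<forall>i. l $ i < x $ \<pi> i \<and> x $ \<pi> i < u $ i) \<longleftrightarrow> (\<forall>i. l $ (inv \<pi> i) < x $ i \<and> x $ i < u $ (inv \<pi> i))" for x
      using assms by (metis bij_inv_eq_iff)
    then show ?thesis by (auto simp: mem_box_cart reindex_def)
  qed
  fix l u :: "real^'m" assume "\<And>b. b \<in> Basis \<Longrightarrow> l \<bullet> b \<le> u \<bullet> b"
  then have le: "l $ i \<le> u $ i" for i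
    by (metis axis_in_Basis_iff inner_axis' Basis_real_def insertI1 inner_commute inner_real_def mult.right_neutral)
  have "emeasure lborel (box (reindex (inv \<pi>) l) (reindex (inv \<pi>) u)) =
      (\<Prod>b\<in>Basis. (reindex (inv \<pi>) u - reindex (inv \<pi>) l) \<bullet> b)"
    by (subst emeasure_lborel_box_eq)
      (use le in \<open>auto simp: Basis_vec_def reindex_def inner_axis\<close>)
  also have "(\<Prod>b\<in>Basis. (reindex (inv \<pi>) u - reindex (inv \<pi>) l) \<bullet> b) = (\<Prod>i\<in>UNIV. u $ inv \<pi> i - l $ inv \<pi> i)"
    by (simp add: prod_Basis_vec reindex_def inner_axis)
  also have "\<dots> = (\<Prod>i\<in>UNIV. u $ i - l $ i)"
    using prod.reindex_bij_betw[OF bij_imp_bij_inv[OF assms], of "\<lambda>i. u $ i - l $ i"] by simp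
  also have "\<dots> = (\<Prod>b\<in>Basis. (u - l) \<bullet> b)"
    by (simp add: prod_Basis_vec inner_axis)
  finally show "emeasure lborel (box (reindex (inv \<pi>) l) (reindex (inv \<pi>) u)) = (\<Prod>b\<in>Basis. (u - l) \<bullet> b)" .
qed simp

text \<open>The available facts concern images and the completed measure, so the preimage of a box
  is written as its image under the inverse map, and the value is carried back to
  \<open>lborel\<close> because the set is Borel.\<close>

lemma distr_orthogonal_wellorder:
  fixes T :: "real^'n::{finite,wellorder} \<Rightarrow> real^'n::_"
  assumes "orthogonal_transformation T"
  shows "distr lborel lborel T = lborel"
proof (rule lborel_eqI[symmetric])
  have T: "T \<in> borel_measurable borel"
    using assms orthogonal_transformation_linear
    by (intro borel_measurable_continuous_onI linear_continuous_on linear_conv_bounded_linear[THEN iffD1]) auto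
  fix l u :: "real^'n::_" assume le: "\<And>b. b \<in> Basis \<Longrightarrow> l \<bullet> b \<le> u \<bullet> b"
  have inv: "orthogonal_transformation (inv T)"
    using assms orthogonal_transformation_inv by blast
  have "T -` box l u = inv T ` box l u"
    using orthogonal_transformation_bij[OF assms] by (simp add: bij_vimage_eq_inv_image)
  moreover have "box l u \<in> lmeasurable" by simp
  ultimately have "T -` box l u \<in> lmeasurable" "measure lebesgue (T -` box l u) = measure lebesgue (box l u)"
    using measurable_orthogonal_image[OF inv] measure_orthogonal_image[OF inv] by auto
  moreover have "T -` box l u \<in> sets borel"
    using measurable_sets[OF T, of "box l u"] by simp
  ultimately have "emeasure lborel (T -` box l u) = emeasure lborel (box l u)"
    using emeasure_eq_measure2[of "T -` box l u" lebesgue] emeasure_eq_measure2[of "box l u" lebesgue]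
    by (simp add: emeasure_completion main_part)
  then show "emeasure (distr lborel lborel T) (box l u) = ennreal (\<Prod>b\<in>Basis. (u - l) \<bullet> b)"
    using le T by (subst emeasure_distr) (auto simp: emeasure_lborel_box_eq)
qed simp


section \<open>Radial maps: derivative, Jacobian and change of variables\<close>

lemma det_radial_linear:
  fixes e :: "real^'n::finite"
  assumes "norm e = 1"
  shows "det (matrix (\<lambda>h. a *\<^sub>R h + (b * (e \<bullet> h)) *\<^sub>R e)) = a ^ (CARD('n) - 1) * (a + b)"
proof -
  fix k :: 'n
  obtain f where f: "orthogonal_transformation f" "f (axis k (1::real)) = e"
    using orthogonal_transformation_exists[of "axis k (1::real)" e] assms by auto
  define g where "g = inv f"
  have "bij f" using f(1) orthogonal_transformation_bij by blast
  then have g: "orthogonal_transformation g" "\<And>x. f (g x) = x" "\<And>x. g (f x) = x"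
    unfolding g_def using f(1) orthogonal_transformation_inv
    by (auto simp: bij_is_surj bij_is_inj surj_f_inv_f)
  \<comment> \<open>A rotation that takes a coordinate axis to e conjugates the map to
    \<open>D\<close>, whose matrix is diagonal with one entry a + b and all others a.\<close>
  define D where "D = (\<lambda>h::real^'n. a *\<^sub>R h + (b * (axis k 1 \<bullet> h)) *\<^sub>R axis k 1)"
  have lin: "linear f" "linear g"
    using f(1) g(1) orthogonal_transformation_linear by auto
  have lin_D: "linear D"
    by (auto simp: D_def inner_right_distrib algebra_simps intro!: linearI)
  have "(\<lambda>h. a *\<^sub>R h + (b * (e \<bullet> h)) *\<^sub>R e) = f \<circ> D \<circ> g"
  proof
    fix h
    have "e \<bullet> h = axis k 1 \<bullet> g h"
      using f g by (metis orthogonal_transformation_def)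
    then show "a *\<^sub>R h + (b * (e \<bullet> h)) *\<^sub>R e = (f \<circ> D \<circ> g) h"
      using lin(1) f(2) g(2) by (simp add: D_def linear_add linear_scale)
  qed
  then have "det (matrix (\<lambda>h. a *\<^sub>R h + (b * (e \<bullet> h)) *\<^sub>R e)) = det (matrix f) * det (matrix D) * det (matrix g)"
    using lin lin_D by (simp add: matrix_compose linear_compose det_mul)
  also have "det (matrix f) * det (matrix g) = 1"
    by (metis det_I det_mul f(1) g comp_def eq_id_iff lin(1,2) matrix_compose matrix_id_mat_1 id_apply ext)
  then have "det (matrix f) * det (matrix D) * det (matrix g) = det (matrix D)"
    by (simp add: ac_simps)
  also have "\<dots> = (\<Prod>i\<in>UNIV. if i = k then a + b else a)"
  proof -
    have "matrix D $ i $ j = (if i = j then a else 0) + (if i = k \<and> j = k then b else 0)" for i j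
    proof -
      have "axis k (1::real) \<bullet> axis j 1 = (if j = k then 1 else 0)"
        by (simp add: inner_axis_axis)
      then show ?thesis
        by (simp add: matrix_def D_def) (auto simp: axis_def)
    qed
    then show ?thesis by (subst det_diagonal) (auto intro!: prod.cong)
  qed
  also have "\<dots> = a ^ (CARD('n) - 1) * (a + b)"
    by (simp add: prod.If_cases Compl_eq_Diff_UNIV[symmetric] card_Diff_singleton Int_def flip: Compl_eq_Diff_UNIV)
      (simp add: Compl_eq_Diff_UNIV card_Diff_singleton Collect_neg_eq mult.commute)
  finally show ?thesis .
qed

definition radial_map :: "(real \<Rightarrow> real) \<Rightarrow> 'a::real_inner \<Rightarrow> 'a" where
  "radial_map f x = (f (norm x) / norm x) *\<^sub>R x"

lemma norm_radial_map: "x \<noteq> 0 \<Longrightarrow> 0 < f (norm x) \<Longrightarrow> norm (radial_map f x) = f (norm x)"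
  by (simp add: radial_map_def)

text \<open>Tangential directions are stretched by f(|x|) / |x| and the direction e by f'. The sum
  of a multiple of the identity and a rank-one map is the form evaluated in
  \<open>det_radial_linear\<close>.\<close>

lemma has_derivative_radial_map:
  fixes x :: "'a::real_inner"
  assumes "x \<noteq> 0" "(f has_real_derivative f') (at (norm x))"
  defines "e \<equiv> x /\<^sub>R norm x"
  shows "(radial_map f has_derivative
     (\<lambda>h. (f (norm x) / norm x) *\<^sub>R h + ((f' - f (norm x) / norm x) * (e \<bullet> h)) *\<^sub>R e)) (at x)"
proof -
  have n: "(norm has_derivative (\<lambda>h. e \<bullet> h)) (at x)"
    using has_derivative_norm[OF assms(1)] by (simp add: sgn_div_norm e_def inner_commute)
  have f: "((\<lambda>x. f (norm x)) has_derivative (\<lambda>h. f' * (e \<bullet> h))) (at x)"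
    using has_derivative_compose[OF n, of f "\<lambda>h. f' * h"] assms(2)
    by (simp add: has_field_derivative_def)
  have "((\<lambda>x. (f (norm x) / norm x) *\<^sub>R x) has_derivative
     (\<lambda>h. (f (norm x) / norm x) *\<^sub>R h +
        (- f (norm x) * (inverse (norm x) * (e \<bullet> h) * inverse (norm x)) + (f' * (e \<bullet> h)) / norm x) *\<^sub>R x)) (at x)"
    by (rule has_derivative_scaleR has_derivative_divide f n has_derivative_ident | use assms(1) in simp)+
  moreover have "- f (norm x) * (inverse (norm x) * t * inverse (norm x)) + (f' * t) / norm x
      = ((f' - f (norm x) / norm x) * t) * inverse (norm x)" for t
    using assms(1) by (simp add: field_simps)
  ultimately show ?thesis
    unfolding radial_map_def e_def by simp
qed

text \<open>Strict monotonicity of f makes the map injective, and its Jacobian is f' (f / r)^(n -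
  1). The hypothesis \<open>meas\<close> brings the transformed integrand back from Lebesgue to
  Borel measurability.\<close>

lemma radial_change_of_variables_wellorder:
  fixes G :: "real^'n::{finite,wellorder} \<Rightarrow> real"
  assumes der: "\<And>r. 0 < r \<Longrightarrow> r < b \<Longrightarrow> (f has_real_derivative f' r) (at r)"
    and pos: "\<And>r. 0 < r \<Longrightarrow> r < b \<Longrightarrow> 0 < f r" "\<And>r. 0 < r \<Longrightarrow> r < b \<Longrightarrow> 0 < f' r"
  defines "B \<equiv> {x::real^'n::_. 0 < norm x \<and> norm x < b}"
  assumes G: "integrable lborel G" and zero: "\<And>y. y \<notin> radial_map f ` B \<Longrightarrow> G y = 0"
    and meas: "(\<lambda>x. indicator B x * (f' (norm x) * (f (norm x) / norm x) ^ (CARD('n) - 1) * G (radial_map f x)))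
       \<in> borel_measurable borel"
  shows "integrable lborel (\<lambda>x. indicator B x * (f' (norm x) * (f (norm x) / norm x) ^ (CARD('n) - 1) * G (radial_map f x)))"
    and "(LINT x|lborel. indicator B x * (f' (norm x) * (f (norm x) / norm x) ^ (CARD('n) - 1) * G (radial_map f x)))
       = (LINT y|lborel. G y)"
proof -
  define F where "F = (radial_map f :: real^'n::_ \<Rightarrow> _)"
  define J where "J = (\<lambda>x::real^'n::_. f' (norm x) * (f (norm x) / norm x) ^ (CARD('n) - 1))"
  define e where "e = (\<lambda>x::real^'n::_. x /\<^sub>R norm x)"
  define F' where "F' = (\<lambda>x h. (f (norm x) / norm x) *\<^sub>R h + ((f' (norm x) - f (norm x) / norm x) * (e x \<bullet> h)) *\<^sub>R e x)"
  have open_B: "open B"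
    unfolding B_def by (intro open_Collect_conj open_Collect_less continuous_intros)
  have dF: "(F has_derivative F' x) (at x within B)" if "x \<in> B" for x
    using has_derivative_radial_map[of x f "f' (norm x)"] der[of "norm x"] that
    by (simp add: B_def F_def F'_def e_def has_derivative_at_withinI)
  have mono: "f r < f s" if "0 < r" "r < s" "s < b" for r s
  proof (rule DERIV_pos_imp_increasing[OF that(2)])
    fix t assume "r \<le> t" "t \<le> s"
    then have "0 < t" "t < b" using that by auto
    then show "\<exists>y. DERIV f t :> y \<and> 0 < y" using der pos by blast
  qed
  have inj: "inj_on F B"
  proof (rule inj_onI)
    fix x y assume xy: "x \<in> B" "y \<in> B" "F x = F y"
    then have "f (norm x) = f (norm y)"
      using norm_radial_map[of x f] norm_radial_map[of y f] pos by (auto simp: F_def B_def)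
    then have n: "norm x = norm y"
      using mono[of "norm x" "norm y"] mono[of "norm y" "norm x"] xy by (force simp: B_def)
    then show "x = y"
      using xy pos(1)[of "norm x"] by (auto simp: F_def radial_map_def B_def)
  qed
  have det: "\<bar>det (matrix (F' x))\<bar> = J x" if "x \<in> B" for x
  proof -
    have "norm (e x) = 1" using that by (auto simp: e_def B_def)
    from det_radial_linear[OF this, of "f (norm x) / norm x" "f' (norm x) - f (norm x) / norm x"]
    show ?thesis
      using that pos[of "norm x"] by (simp add: F'_def J_def B_def abs_mult power_abs)
  qed
  \<comment> \<open>The general change of variables theorem takes vector-valued integrands, so the
    scalar G passes through \<open>real^1\<close>.\<close>
  let ?v = "\<lambda>c. (\<chi> _. c) :: real^1"
  have bl: "bounded_linear ?v" "bounded_linear (\<lambda>v::real^1. v $ 1)"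
    by (auto simp: vec_eq_iff linear_conv_bounded_linear[symmetric] intro!: linearI bounded_linear_vec_nth)
  have GL: "G absolutely_integrable_on UNIV" "integral UNIV G = (LINT y|lborel. G y)"
  proof -
    show *: "G absolutely_integrable_on UNIV"
      using G integrable_completion[of G lborel]
      by (simp add: set_integrable_def borel_measurable_integrable)
    show "integral UNIV G = (LINT y|lborel. G y)"
      using set_borel_integral_eq_integral(2)[of UNIV G] G
      by (simp add: set_integrable_def set_lebesgue_integral_def)
  qed
  have GF: "G absolutely_integrable_on F ` B" "integral (F ` B) G = integral UNIV G"
  proof -
    have eq: "(\<lambda>y. indicator (F ` B) y *\<^sub>R G y) = G"
      using zero by (auto simp: F_def indicator_def fun_eq_iff)
    then show "G absolutely_integrable_on F ` B"
      using GL(1) by (simp add: set_integrable_def)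
    have "(\<lambda>y. if y \<in> F ` B then G y else 0) = G"
      using zero by (auto simp: F_def fun_eq_iff)
    then show "integral (F ` B) G = integral UNIV G"
      using integral_restrict_UNIV[of "F ` B" G] by simp
  qed
  have "(\<lambda>y. ?v (G y)) absolutely_integrable_on F ` B"
    using absolutely_integrable_linear[OF GF(1) bl(1)] by (simp add: o_def)
  moreover have "integral (F ` B) (\<lambda>y. ?v (G y)) = ?v (integral (F ` B) G)"
    using integral_linear[OF _ bl(1), of G "F ` B"] GF(1)[unfolded absolutely_integrable_on_def]
    by (simp add: o_def)
  ultimately have cov: "(\<lambda>x. \<bar>det (matrix (F' x))\<bar> *\<^sub>R ?v (G (F x))) absolutely_integrable_on B"
      "integral B (\<lambda>x. \<bar>det (matrix (F' x))\<bar> *\<^sub>R ?v (G (F x))) = ?v (integral (F ` B) G)"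
    using has_absolute_integral_change_of_variables[OF _ dF inj, of "\<lambda>y. ?v (G y)" "?v (integral (F ` B) G)"] open_B
    by auto
  have abs: "(\<lambda>x. J x * G (F x)) absolutely_integrable_on B"
    using absolutely_integrable_linear[OF cov(1) bl(2)]
    by (subst set_integrable_cong[OF refl]) (auto simp: o_def det)
  have eq: "(\<lambda>x. indicator B x * (f' (norm x) * (f (norm x) / norm x) ^ (CARD('n) - 1) * G (radial_map f x))) =
      (\<lambda>x. indicator B x *\<^sub>R (J x * G (F x)))"
    by (auto simp: J_def F_def)
  show int: "integrable lborel (\<lambda>x. indicator B x * (f' (norm x) * (f (norm x) / norm x) ^ (CARD('n) - 1) * G (radial_map f x)))"
    using abs meas integrable_completion[of "\<lambda>x. indicator B x *\<^sub>R (J x * G (F x))" lborel]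
    unfolding eq set_integrable_def by simp
  have "(LINT x|lborel. indicator B x *\<^sub>R (J x * G (F x))) = integral B (\<lambda>x. J x * G (F x))"
    using set_borel_integral_eq_integral(2)[of B "\<lambda>x. J x * G (F x)"] int[unfolded eq]
    by (simp add: set_integrable_def set_lebesgue_integral_def)
  also have "\<dots> = integral B (\<lambda>x. (\<bar>det (matrix (F' x))\<bar> *\<^sub>R ?v (G (F x))) $ 1)"
    by (intro integral_cong) (simp add: det)
  also have "\<dots> = integral B (\<lambda>x. \<bar>det (matrix (F' x))\<bar> *\<^sub>R ?v (G (F x))) $ 1"
    using integral_linear[OF _ bl(2), of "\<lambda>x. \<bar>det (matrix (F' x))\<bar> *\<^sub>R ?v (G (F x))" B]
      cov(1)[unfolded absolutely_integrable_on_def] by (auto simp: o_def)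
  finally show "(LINT x|lborel. indicator B x * (f' (norm x) * (f (norm x) / norm x) ^ (CARD('n) - 1) * G (radial_map f x)))
       = (LINT y|lborel. G y)"
    using cov(2) GF(2) GL(2) unfolding eq by simp
qed

section \<open>Transfer to arbitrary finite index types\<close>

lemma obtain_ordered_reindex:
  obtains \<pi> :: "'n::finite ordered_index \<Rightarrow> 'n" where "bij \<pi>"
  using finite_same_card_bij[of "UNIV :: 'n ordered_index set" "UNIV :: 'n set"]
  by (auto simp: card_ordered_index bij_betw_def)

lemma integral_reindex:
  fixes \<pi> :: "'m::finite \<Rightarrow> 'n::finite" and H :: "real^'m \<Rightarrow> real"
  assumes "bij \<pi>" and [measurable]: "H \<in> borel_measurable borel"
  shows "(LINT x|lborel. H (reindex \<pi> x)) = (LINT y|lborel. H y)"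
    and "integrable lborel (\<lambda>x. H (reindex \<pi> x)) \<longleftrightarrow> integrable lborel H"
proof -
  have m: "reindex \<pi> \<in> measurable lborel lborel" using measurable_reindex by simp
  have H: "H \<in> borel_measurable lborel" by simp
  show "(LINT x|lborel. H (reindex \<pi> x)) = (LINT y|lborel. H y)"
    using integral_distr[OF m H] distr_reindex[OF assms(1)] by simp
  show "integrable lborel (\<lambda>x. H (reindex \<pi> x)) \<longleftrightarrow> integrable lborel H"
    using integrable_distr_eq[OF m H] distr_reindex[OF assms(1)] by simp
qed

text \<open>A coordinate permutation is a linear isometry: it commutes with radial maps, maps the
  punctured ball to the punctured ball and preserves the measure.\<close>

lemma radial_change_of_variables:
  fixes G :: "real^'n::finite \<Rightarrow> real"
  assumes der: "\<And>r. 0 < r \<Longrightarrow> r < b \<Longrightarrow> (f has_real_derivative f' r) (at r)"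
    and pos: "\<And>r. 0 < r \<Longrightarrow> r < b \<Longrightarrow> 0 < f r" "\<And>r. 0 < r \<Longrightarrow> r < b \<Longrightarrow> 0 < f' r"
  defines "B \<equiv> {x::real^'n. 0 < norm x \<and> norm x < b}"
  defines "H \<equiv> \<lambda>x. indicator B x * (f' (norm x) * (f (norm x) / norm x) ^ (CARD('n) - 1) * G (radial_map f x))"
  assumes G: "integrable lborel G" and zero: "\<And>y. y \<notin> radial_map f ` B \<Longrightarrow> G y = 0"
    and meas: "H \<in> borel_measurable borel"
  shows "integrable lborel H" and "(LINT x|lborel. H x) = (LINT y|lborel. G y)"
proof -
  obtain \<pi> :: "'n ordered_index \<Rightarrow> 'n" where \<pi>: "bij \<pi>" by (rule obtain_ordered_reindex)
  have \<pi>': "bij (inv \<pi>)" using \<pi> bij_imp_bij_inv by blast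
  let ?P = "reindex (inv \<pi>) :: real^'n ordered_index \<Rightarrow> real^'n"
  let ?Q = "reindex \<pi> :: real^'n \<Rightarrow> real^'n ordered_index"
  define B' where "B' = {x::real^'n ordered_index. 0 < norm x \<and> norm x < b}"
  define G' where "G' = (\<lambda>y. G (?P y))"
  have [measurable]: "G \<in> borel_measurable borel" using G borel_measurable_integrable by auto
  have F: "?P (radial_map f x) = radial_map f (?P x)" for x
    by (simp add: radial_map_def norm_reindex[OF \<pi>'] linear_scale[OF linear_reindex])
  have B: "?P x \<in> B \<longleftrightarrow> x \<in> B'" for x
    by (simp add: B_def B'_def norm_reindex[OF \<pi>'] del: zero_less_norm_iff)
  have H: "(\<lambda>x. indicator B' x * (f' (norm x) * (f (norm x) / norm x) ^ (CARD('n ordered_index) - 1) * G' (radial_map f x)))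
     = (\<lambda>x. H (?P x))"
    by (simp add: H_def G'_def F card_ordered_index norm_reindex[OF \<pi>'] indicator_def B)
  have G': "integrable lborel G'" "(LINT y|lborel. G' y) = (LINT y|lborel. G y)"
    using integral_reindex[OF \<pi>', of G] G by (simp_all add: G'_def)
  have zero': "G' y = 0" if "y \<notin> radial_map f ` B'" for y
  proof -
    have "?P y \<notin> radial_map f ` B"
    proof
      assume "?P y \<in> radial_map f ` B"
      then obtain x where x: "x \<in> B" "?P y = radial_map f x" by blast
      have "?P (?Q x) = x" "?Q (?P y) = y" using reindex_inverse \<pi> by auto
      moreover have "?P y = ?P (radial_map f (?Q x))"
        using x by (simp add: F \<open>?P (?Q x) = x\<close>)
      ultimately have "y = radial_map f (?Q x)" "?Q x \<in> B'"
        using reindex_inverse(2)[OF \<pi>, of y] reindex_inverse(2)[OF \<pi>, of "radial_map f (?Q x)"] x B[of "?Q x"] by auto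
      then show False using that by blast
    qed
    then show ?thesis by (simp add: G'_def zero)
  qed
  have meas': "(\<lambda>x. H (?P x)) \<in> borel_measurable borel"
    using measurable_compose[OF measurable_reindex meas] .
  have cov: "integrable lborel (\<lambda>x. H (?P x))" "(LINT x|lborel. H (?P x)) = (LINT y|lborel. G' y)"
    using radial_change_of_variables_wellorder[of b f f' G', folded B'_def, unfolded H] der pos G'(1) zero' meas'
    by blast+
  show "integrable lborel H"
    using cov(1) integral_reindex(2)[OF \<pi>' meas] by blast
  show "(LINT x|lborel. H x) = (LINT y|lborel. G y)"
    using cov(2) integral_reindex(1)[OF \<pi>' meas] G'(2) by simp
qed

lemma distr_orthogonal:
  fixes T :: "real^'n::finite \<Rightarrow> real^'n"
  assumes "orthogonal_transformation T"
  shows "distr lborel lborel T = lborel"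
proof -
  obtain \<pi> :: "'n ordered_index \<Rightarrow> 'n" where \<pi>: "bij \<pi>" by (rule obtain_ordered_reindex)
  have \<pi>': "bij (inv \<pi>)" using \<pi> bij_imp_bij_inv by blast
  let ?P = "reindex (inv \<pi>) :: real^'n ordered_index \<Rightarrow> real^'n"
  let ?Q = "reindex \<pi> :: real^'n \<Rightarrow> real^'n ordered_index"
  have T[measurable]: "T \<in> borel_measurable borel"
    using assms orthogonal_transformation_linear
    by (intro borel_measurable_continuous_onI linear_continuous_on linear_conv_bounded_linear[THEN iffD1]) auto
  have lin: "linear T" using assms orthogonal_transformation_linear by blast
  have "orthogonal_transformation (?Q \<circ> T \<circ> ?P)"
    using assms unfolding orthogonal_transformation
    by (auto simp: norm_reindex \<pi> \<pi>' intro!: linear_compose lin linear_reindex)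
  then have 1: "distr lborel lborel (?Q \<circ> T \<circ> ?P) = lborel"
    by (rule distr_orthogonal_wellorder)
  have m: "?Q \<in> measurable lborel lborel" "?P \<in> measurable lborel lborel" "T \<in> measurable lborel lborel"
    using measurable_reindex T by simp_all
  have "T = ?P \<circ> (?Q \<circ> T \<circ> ?P) \<circ> ?Q"
    by (simp add: fun_eq_iff reindex_inverse \<pi>)
  then have "distr lborel lborel T = distr (distr (distr lborel lborel ?Q) lborel (?Q \<circ> T \<circ> ?P)) lborel ?P"
    using m by (simp add: distr_distr measurable_comp comp_assoc)
  also have "\<dots> = lborel"
    using 1 by (simp add: distr_reindex \<pi> \<pi>')
  finally show ?thesis .
qed

subsection \<open>A smooth bump on the line\<close>

text \<open>With s = 1 / (1 - t^2), the functions p(t) s^k exp (- s) on (-1, 1), extended by zero,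
  form a class closed under differentiation that contains the standard bump (p = 1, k = 0).\<close>

definition bump_term :: "real poly \<Rightarrow> nat \<Rightarrow> real \<Rightarrow> real" where
  "bump_term p k t =
    (if \<bar>t\<bar> < 1 then poly p t * (1 / (1 - t\<^sup>2)) ^ k * exp (- (1 / (1 - t\<^sup>2))) else 0)"

lemma power_le_fact_exp: "0 \<le> s \<Longrightarrow> s ^ m \<le> fact m * exp (s::real)"
proof -
  assume "0 \<le> s"
  then have "(\<Sum>n\<in>{m}. s ^ n /\<^sub>R fact n) \<le> exp s"
    unfolding exp_def by (intro sum_le_suminf summable_exp_generic) auto
  then show ?thesis by (simp add: field_simps)
qed

text \<open>Quadratic decay at |t| = 1 makes the difference quotient there tend to 0; this settles
  differentiability at the two endpoints for all p and k at once.\<close>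

lemma bump_term_bound:
  obtains C where "\<And>t. \<bar>bump_term p k t\<bar> \<le> C * (1 - \<bar>t\<bar>)\<^sup>2" "0 \<le> C"
proof -
  have "compact (poly p ` {-1..1})"
    by (intro compact_continuous_image continuous_intros) auto
  then obtain M where "\<forall>y\<in>poly p ` {-1..1}. norm y \<le> M"
    using compact_imp_bounded bounded_iff by blast
  then have M: "\<bar>poly p t\<bar> \<le> M" if "\<bar>t\<bar> < 1" for t
    using that by (simp add: abs_less_iff)
  then have M0: "0 \<le> M" using M[of 0, simplified] abs_ge_zero[of "poly p 0"] by linarith
  define C where "C = M * fact (k + 2) * 4"
  have C0: "0 \<le> C" using M0 by (simp add: C_def)
  have "\<bar>bump_term p k t\<bar> \<le> C * (1 - \<bar>t\<bar>)\<^sup>2" for t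
  proof (cases "\<bar>t\<bar> < 1")
    case True
    define s where "s = 1 / (1 - t\<^sup>2)"
    have t2: "t\<^sup>2 < 1" using True by (simp add: abs_square_less_1)
    have s: "0 < s" using t2 by (simp add: s_def)
    \<comment> \<open>The two surplus powers of s are traded for the factor (1 - t^2)^2.\<close>
    have "s ^ (k + 2) \<le> fact (k + 2) * exp s"
      using power_le_fact_exp less_imp_le[OF s] by blast
    then have "s ^ (k + 2) * exp (- s) \<le> fact (k + 2)"
      by (simp add: exp_minus field_simps)
    moreover have "s ^ k * exp (- s) = (s ^ (k + 2) * exp (- s)) * (1 - t\<^sup>2)\<^sup>2"
    proof -
      have "s\<^sup>2 * (1 - t\<^sup>2)\<^sup>2 = 1" using t2 by (simp add: s_def power_divide)
      moreover have "(s ^ (k + 2) * exp (- s)) * (1 - t\<^sup>2)\<^sup>2 = s ^ k * exp (- s) * (s\<^sup>2 * (1 - t\<^sup>2)\<^sup>2)"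
        by (simp only: power_add mult_ac)
      ultimately show ?thesis by simp
    qed
    ultimately have "s ^ k * exp (- s) \<le> fact (k + 2) * (1 - t\<^sup>2)\<^sup>2"
      by (metis mult_right_mono zero_le_power2)
    moreover have "(1 - t\<^sup>2)\<^sup>2 \<le> 4 * (1 - \<bar>t\<bar>)\<^sup>2"
    proof -
      have "1 - t\<^sup>2 = (1 - \<bar>t\<bar>) * (1 + \<bar>t\<bar>)" by (simp add: algebra_simps power2_eq_square flip: abs_mult)
      then have "(1 - t\<^sup>2)\<^sup>2 = (1 + \<bar>t\<bar>)\<^sup>2 * (1 - \<bar>t\<bar>)\<^sup>2" by (simp add: power_mult_distrib)
      also have "(1 + \<bar>t\<bar>)\<^sup>2 \<le> 2\<^sup>2" using True by (intro power_mono) auto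
      finally show ?thesis by (simp add: mult_right_mono)
    qed
    ultimately have *: "s ^ k * exp (- s) \<le> fact (k + 2) * (4 * (1 - \<bar>t\<bar>)\<^sup>2)"
      by (smt (verit) fact_ge_zero mult_left_mono)
    then have "\<bar>poly p t\<bar> * (s ^ k * exp (- s)) \<le> M * (fact (k + 2) * (4 * (1 - \<bar>t\<bar>)\<^sup>2))"
      using M0 s by (intro mult_mono[OF M[OF True] *]) auto
    then show ?thesis
      using True s by (simp add: bump_term_def s_def[symmetric] abs_mult C_def mult.assoc)
  qed (use C0 in \<open>simp add: bump_term_def\<close>)
  then show ?thesis using C0 that by blast
qed

text \<open>Since s' = 2 t s^2, every term of the derivative becomes a multiple of s^(k + 2) after
  using (1 - t^2) s = 1; q collects the coefficients, and \<open>[:1, 0, -1:]\<close> is the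
  polynomial 1 - t^2.\<close>

lemma DERIV_bump_term:
  fixes p :: "real poly" and k :: nat
  defines "q \<equiv> pderiv p * [:1, 0, -1:]\<^sup>2 + [:0, 2 * of_nat k:] * [:1, 0, -1:] * p - [:0, 2:] * p"
  shows "(bump_term p k has_real_derivative bump_term q (k + 2) t) (at t)"
proof -
  consider "\<bar>t\<bar> < 1" | "\<bar>t\<bar> = 1" | "\<bar>t\<bar> > 1" by linarith
  then show ?thesis
  proof cases
    case 1
    define f where "f = (\<lambda>t. poly p t * (1 / (1 - t\<^sup>2)) ^ k * exp (- (1 / (1 - t\<^sup>2))))"
    have t2: "1 - t\<^sup>2 \<noteq> 0" using 1 abs_square_less_1[of t] by simp
    define s where "s = 1 / (1 - t\<^sup>2)"
    have s: "s * (1 - t\<^sup>2) = 1" using t2 by (simp add: s_def)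
    have ds: "((\<lambda>t. 1 / (1 - t\<^sup>2)) has_real_derivative 2 * t * s\<^sup>2) (at t)"
      using t2 by (auto intro!: derivative_eq_intros simp: s_def power2_eq_square divide_simps)
    have dk: "((\<lambda>t. (1 / (1 - t\<^sup>2)) ^ k) has_real_derivative of_nat k * (s ^ (k - 1) * (2 * t * s\<^sup>2))) (at t)"
      using DERIV_power[OF ds, of k] by (simp add: s_def mult_ac)
    have dp: "(poly p has_real_derivative poly (pderiv p) t) (at t)" by (rule poly_DERIV)
    have de: "((\<lambda>t. exp (- (1 / (1 - t\<^sup>2)))) has_real_derivative exp (- s) * - (2 * t * s\<^sup>2)) (at t)"
      using DERIV_fun_exp[OF DERIV_minus[OF ds]] by (simp add: s_def)
    have "(f has_real_derivative (poly (pderiv p) t * s ^ k + of_nat k * (s ^ (k - 1) * (2 * t * s\<^sup>2)) * poly p t) * exp (- s)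
       + exp (- s) * - (2 * t * s\<^sup>2) * (poly p t * s ^ k)) (at t)"
      unfolding f_def using DERIV_mult[OF DERIV_mult[OF dp dk] de] by (simp add: s_def algebra_simps)
    moreover have "(poly (pderiv p) t * s ^ k + of_nat k * (s ^ (k - 1) * (2 * t * s\<^sup>2)) * poly p t) * exp (- s)
       + exp (- s) * - (2 * t * s\<^sup>2) * (poly p t * s ^ k) = bump_term q (k + 2) t"
    proof -
      define u S where "u = 1 - t\<^sup>2" and "S = s ^ (k + 2)"
      have su: "s * u = 1" using s by (simp add: u_def)
      then have S1: "s ^ (k + 1) = u * S"
        by (simp add: S_def mult.assoc[symmetric] mult.commute)
      have "s ^ k = (s * u) * s ^ k" by (simp add: su)
      also have "\<dots> = u * s ^ (k + 1)" by (simp add: mult_ac)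
      finally have "s ^ k = u * s ^ (k + 1)" .
      then have S0: "s ^ k = u\<^sup>2 * S" unfolding S1 by (simp only: power2_eq_square mult.assoc)
      have S2: "s\<^sup>2 * s ^ k = S" by (simp only: S_def power_add mult.commute)
      have "of_nat k * (s ^ (k - 1) * (2 * t * s\<^sup>2)) = of_nat k * (2 * t * s ^ (k + 1))"
        by (cases k) (auto simp: power2_eq_square)
      then have Sk: "of_nat k * (s ^ (k - 1) * (2 * t * s\<^sup>2)) = of_nat k * (2 * t * (u * S))"
        by (simp only: S1)
      have q: "poly q t = poly (pderiv p) t * u\<^sup>2 + 2 * of_nat k * t * u * poly p t - 2 * t * poly p t"
        by (simp add: q_def u_def power2_eq_square algebra_simps)
      have "exp (- s) * - (2 * t * s\<^sup>2) * (poly p t * s ^ k) = - (exp (- s) * (2 * t * poly p t)) * (s\<^sup>2 * s ^ k)"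
        by (simp only: mult_ac mult_minus_left mult_minus_right)
      then have "(poly (pderiv p) t * s ^ k + of_nat k * (s ^ (k - 1) * (2 * t * s\<^sup>2)) * poly p t) * exp (- s)
          + exp (- s) * - (2 * t * s\<^sup>2) * (poly p t * s ^ k) = poly q t * S * exp (- s)"
        unfolding Sk S2 q unfolding S0 by (simp add: algebra_simps)
      then show ?thesis
        using 1 by (simp add: bump_term_def s_def[symmetric] S_def)
    qed
    ultimately have "(f has_real_derivative bump_term q (k + 2) t) (at t)" by simp
    then show ?thesis
      by (rule has_field_derivative_transform_within_open[of _ _ _ "{-1<..<1}"])
        (use 1 in \<open>auto simp: f_def bump_term_def abs_less_iff\<close>)
  next
    case 2
    obtain C where C: "\<And>t. \<bar>bump_term p k t\<bar> \<le> C * (1 - \<bar>t\<bar>)\<^sup>2" "0 \<le> C"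
      using bump_term_bound by blast
    have "((\<lambda>y. (bump_term p k y - bump_term p k t) / (y - t)) \<longlongrightarrow> 0) (at t)"
    proof (rule Lim_null_comparison)
      have "\<bar>(bump_term p k y - bump_term p k t) / (y - t)\<bar> \<le> C * \<bar>y - t\<bar>" if "y \<noteq> t" for y
      proof -
        have "(1 - \<bar>y\<bar>)\<^sup>2 \<le> \<bar>y - t\<bar>\<^sup>2"
          using 2 by (intro power2_le_iff_abs_le[THEN iffD2]) auto
        then have "\<bar>bump_term p k y\<bar> \<le> C * \<bar>y - t\<bar>\<^sup>2"
          using C by (meson mult_left_mono order_trans)
        moreover have "bump_term p k t = 0" using 2 by (simp add: bump_term_def)
        ultimately show ?thesis
          using that by (simp add: abs_divide divide_le_eq power2_eq_square mult.assoc)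
      qed
      then show "eventually (\<lambda>y. norm ((bump_term p k y - bump_term p k t) / (y - t)) \<le> C * \<bar>y - t\<bar>) (at t)"
        by (simp add: eventually_at_filter)
      show "((\<lambda>y. C * \<bar>y - t\<bar>) \<longlongrightarrow> 0) (at t)"
        by (auto intro!: tendsto_eq_intros)
    qed
    then show ?thesis
      using 2 by (simp add: has_field_derivative_iff bump_term_def)
  next
    case 3
    have "((\<lambda>_. 0) has_real_derivative bump_term q (k + 2) t) (at t)"
      using 3 by (simp add: bump_term_def)
    then show ?thesis
    proof (rule has_field_derivative_transform_within_open)
      show "open {t::real. 1 < \<bar>t\<bar>}" by (intro open_Collect_less continuous_intros)
    qed (use 3 in \<open>auto simp: bump_term_def\<close>)
  qed
qed

text \<open>A smooth compactly supported function on the line, given together with all its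
  derivatives: \<open>\<beta> j\<close> is the j-th one, and a single bound c serves for every
  support.\<close>

definition derivative_family :: "(nat \<Rightarrow> real \<Rightarrow> real) \<Rightarrow> bool" where
  "derivative_family \<beta> \<longleftrightarrow> (\<forall>j t. (\<beta> j has_real_derivative \<beta> (Suc j) t) (at t)) \<and> (\<exists>c. \<forall>j t. c \<le> \<bar>t\<bar> \<longrightarrow> \<beta> j t = 0)"

lemma derivative_family_scale:
  assumes "derivative_family \<beta>" "0 < c"
  shows "derivative_family (\<lambda>j t. c ^ j * \<beta> j (c * t))"
proof -
  obtain d where d: "\<And>j t. d \<le> \<bar>t\<bar> \<Longrightarrow> \<beta> j t = 0"
    using assms(1) by (auto simp: derivative_family_def)
  have \<beta>: "(\<beta> j has_real_derivative \<beta> (Suc j) t) (at t)" for j t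
    using assms(1) by (auto simp: derivative_family_def)
  have "((\<lambda>t. c ^ j * \<beta> j (c * t)) has_real_derivative c ^ Suc j * \<beta> (Suc j) (c * t)) (at t)" for j t
    using DERIV_cmult[OF DERIV_chain2[OF \<beta> DERIV_cmult_Id[of c t]], of "c ^ j" j] by (simp add: mult_ac)
  moreover have "\<forall>j t. d / c \<le> \<bar>t\<bar> \<longrightarrow> c ^ j * \<beta> j (c * t) = 0"
    using d assms(2) by (auto simp: abs_mult divide_le_eq mult.commute)
  ultimately show ?thesis by (auto simp: derivative_family_def)
qed

text \<open>Iterating the derivative rule on the pair (polynomial, exponent), starting from (1, 0),
  produces all derivatives of exp (- 1 / (1 - t^2)).\<close>

lemma bump_family_exists:
  obtains \<beta> where "derivative_family \<beta>" "\<And>j t. 1 \<le> \<bar>t\<bar> \<Longrightarrow> \<beta> j t = 0" "\<And>t. 0 \<le> \<beta> 0 t" "0 < \<beta> 0 0"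
proof -
  define step where "step = (\<lambda>(p :: real poly, k).
     (pderiv p * [:1, 0, -1:]\<^sup>2 + [:0, 2 * of_nat k:] * [:1, 0, -1:] * p - [:0, 2:] * p, k + 2 :: nat))"
  define \<beta> where "\<beta> = (\<lambda>j. case_prod bump_term ((step ^^ j) (1, 0)))"
  have "(\<beta> j has_real_derivative \<beta> (Suc j) t) (at t)" for j t
    using DERIV_bump_term by (auto simp: \<beta>_def step_def split: prod.split)
  moreover have z: "\<beta> j t = 0" if "1 \<le> \<bar>t\<bar>" for j t
    using that by (auto simp: \<beta>_def bump_term_def split: prod.split)
  ultimately have "derivative_family \<beta>"
    unfolding derivative_family_def by blast
  moreover have "0 \<le> \<beta> 0 t" for t
    using abs_square_less_1[of t] by (simp add: \<beta>_def bump_term_def)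
  moreover have "0 < \<beta> 0 0" by (simp add: \<beta>_def bump_term_def)
  ultimately show ?thesis using z that by blast
qed


subsection \<open>Compactly supported functions of class C1\<close>

lemma has_derivative_grad:
  fixes u :: "real^'n::finite \<Rightarrow> real"
  assumes "u differentiable (at x)"
  shows "(u has_derivative (\<lambda>h. grad u x \<bullet> h)) (at x)"
proof -
  let ?D = "frechet_derivative u (at x)"
  have D: "(u has_derivative ?D) (at x)" using assms frechet_derivative_works by blast
  then have lin: "linear ?D" using has_derivative_linear by blast
  have "?D = (\<lambda>h. grad u x \<bullet> h)"
  proof
    fix h :: "real^'n"
    have "h = (\<Sum>i\<in>UNIV. h $ i *\<^sub>R axis i 1)"
      using basis_expansion[of h] by (simp add: scalar_mult_eq_scaleR)
    then have "?D h = ?D (\<Sum>i\<in>UNIV. h $ i *\<^sub>R axis i 1)" by (rule arg_cong)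
    also have "\<dots> = (\<Sum>i\<in>UNIV. h $ i *\<^sub>R ?D (axis i 1))"
      by (simp add: linear_sum[OF lin] linear_scale[OF lin])
    finally show "?D h = grad u x \<bullet> h" by (simp add: grad_def partial_deriv_def inner_vec_def mult.commute)
  qed
  then show ?thesis using D by simp
qed

lemma grad_eqI:
  fixes u :: "real^'n::finite \<Rightarrow> real"
  assumes "(u has_derivative (\<lambda>h. g \<bullet> h)) (at x)"
  shows "grad u x = g"
proof -
  have "frechet_derivative u (at x) = (\<lambda>h. g \<bullet> h)"
    using assms frechet_derivative_at by metis
  then show ?thesis by (simp add: grad_def partial_deriv_def vec_eq_iff inner_axis)
qed

definition C1 :: "(real^'n::finite \<Rightarrow> real) \<Rightarrow> bool" where
  "C1 u \<longleftrightarrow> (\<forall>x. u differentiable (at x)) \<and> continuous_on UNIV (grad u)"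

lemma C1D: "C1 u \<Longrightarrow> (u has_derivative (\<lambda>h. grad u x \<bullet> h)) (at x)" "C1 u \<Longrightarrow> continuous_on UNIV (grad u)"
  by (simp_all add: C1_def has_derivative_grad)

lemma C1_continuous: "C1 u \<Longrightarrow> continuous_on UNIV u"
  by (intro continuous_at_imp_continuous_on ballI has_derivative_continuous[OF C1D(1)])

lemma C1I:
  assumes "\<And>x. (u has_derivative (\<lambda>h. g x \<bullet> h)) (at x)" "continuous_on UNIV g"
  shows "C1 u" "grad u = g"
proof -
  show "grad u = g" using assms(1) grad_eqI by blast
  then show "C1 u" using assms by (auto simp: C1_def differentiable_def)
qed

definition C1_ball :: "real \<Rightarrow> (real^'n::finite \<Rightarrow> real) set" where
  "C1_ball b = {u. C1 u \<and> (\<exists>c\<ge>0. c < b \<and> (\<forall>x. c \<le> norm x \<longrightarrow> u x = 0))}"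

text \<open>Vanishing near the origin as well lets singular radial factors and radial substitutions
  act on this class without loss of regularity.\<close>

definition C1_annulus :: "real \<Rightarrow> (real^'n::finite \<Rightarrow> real) set" where
  "C1_annulus b = {u \<in> C1_ball b. \<exists>a>0. \<forall>x. norm x \<le> a \<longrightarrow> u x = 0}"

lemma C1_ball_mono: "b \<le> b' \<Longrightarrow> C1_ball b \<subseteq> C1_ball b'"
  by (force simp: C1_ball_def)

lemma grad_eq_0:
  assumes "open S" "x \<in> S" "\<And>y. y \<in> S \<Longrightarrow> u y = 0"
  shows "grad u x = 0"
proof (rule grad_eqI)
  have "((\<lambda>_. 0) has_derivative (\<lambda>h. 0 \<bullet> h)) (at x)" by simp
  then show "(u has_derivative (\<lambda>h. 0 \<bullet> h)) (at x)"
    by (rule has_derivative_transform_within_open[OF _ assms(1,2)]) (simp add: assms(3))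
qed

lemma grad_eq_0_outside:
  assumes "\<And>x. c \<le> norm x \<Longrightarrow> u x = 0" "c < norm x"
  shows "grad u x = 0"
  by (rule grad_eq_0[of "{x. c < norm x}"]) (use assms in \<open>auto intro!: open_Collect_less continuous_intros\<close>)

lemma integrable_continuous_compact_support:
  fixes f :: "'a::euclidean_space \<Rightarrow> 'b::euclidean_space"
  assumes "continuous_on UNIV f" "\<And>x. c \<le> norm x \<Longrightarrow> f x = 0"
  shows "integrable lborel f"
proof -
  have "integrable lborel (\<lambda>x. indicator (cball 0 c) x *\<^sub>R f x)"
    using assms(1) by (intro borel_integrable_compact) (auto intro: continuous_on_subset)
  moreover have "(\<lambda>x. indicator (cball 0 c) x *\<^sub>R f x) = f"
    using assms(2) by (auto simp: indicator_def fun_eq_iff)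
  ultimately show ?thesis by simp
qed

lemma uniformly_continuous_compact_support:
  fixes f :: "'a::euclidean_space \<Rightarrow> 'b::real_normed_vector"
  assumes "continuous_on UNIV f" "\<And>x. c \<le> norm x \<Longrightarrow> f x = 0"
  shows "uniformly_continuous_on UNIV f"
  unfolding uniformly_continuous_on_def
proof (intro allI impI)
  fix e :: real assume "0 < e"
  have "uniformly_continuous_on (cball 0 (c + 1)) f"
    by (intro compact_uniformly_continuous continuous_on_subset[OF assms(1)]) auto
  then obtain d where d: "d > 0" "\<And>x y. x \<in> cball 0 (c + 1) \<Longrightarrow> y \<in> cball 0 (c + 1) \<Longrightarrow> dist y x < d \<Longrightarrow> dist (f y) (f x) < e"
    using \<open>0 < e\<close> unfolding uniformly_continuous_on_def by metis
  have "dist (f y) (f x) < e" if "dist y x < min d 1" for x y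
  proof -
    have n: "\<bar>norm x - norm y\<bar> < 1" using that norm_triangle_ineq3[of x y] by (simp add: dist_norm norm_minus_commute)
    show ?thesis
    proof (cases "norm x \<le> c + 1 \<and> norm y \<le> c + 1")
      case True then show ?thesis using d that by auto
    next
      case False
      then have "c \<le> norm x" "c \<le> norm y" using n by auto
      then show ?thesis using assms(2) \<open>0 < e\<close> by simp
    qed
  qed
  then show "\<exists>d>0. \<forall>x\<in>UNIV. \<forall>x'\<in>UNIV. dist x' x < d \<longrightarrow> dist (f x') (f x) < e"
    using d(1) by (intro exI[of _ "min d 1"]) auto
qed

lemma bounded_compact_support:
  fixes f :: "'a::euclidean_space \<Rightarrow> 'b::real_normed_vector"
  assumes "continuous_on UNIV f" "\<And>x. c \<le> norm x \<Longrightarrow> f x = 0"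
  obtains M where "M \<ge> 0" "\<And>x. norm (f x) \<le> M"
proof -
  have "compact (f ` cball 0 c)"
    by (intro compact_continuous_image continuous_on_subset[OF assms(1)]) auto
  then have "bounded (f ` cball 0 c)" by (rule compact_imp_bounded)
  then obtain M where "\<forall>y\<in>f ` cball 0 c. norm y \<le> M" unfolding bounded_iff ..
  then have M: "norm (f x) \<le> M" if "x \<in> cball 0 c" for x using that by simp
  have "norm (f x) \<le> max M 0" for x
    using M[of x] assms(2)[of x] by (cases "c \<le> norm x") auto
  then show ?thesis using that[of "max M 0"] by auto
qed

lemma C1_ballD:
  assumes "u \<in> C1_ball b"
  obtains c M where "0 \<le> c" "c < b" "\<And>x. c \<le> norm x \<Longrightarrow> u x = 0" "\<And>x. c \<le> norm x \<Longrightarrow> grad u x = 0"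
    "0 \<le> M" "\<And>x. \<bar>u x\<bar> \<le> M" "\<And>x. norm (grad u x) \<le> M"
proof -
  obtain c where u: "C1 u" and c: "0 \<le> c" "c < b" "\<And>x. c \<le> norm x \<Longrightarrow> u x = 0"
    using assms by (auto simp: C1_ball_def)
  define d where "d = (c + b) / 2"
  have d: "0 \<le> d" "d < b" "c < d" using c by (auto simp: d_def)
  have g: "grad u x = 0" if "d \<le> norm x" for x
    using grad_eq_0_outside[of c u x] c(3) d that by simp
  obtain M1 where M1: "\<And>x. norm (u x) \<le> M1" "M1 \<ge> 0"
    using bounded_compact_support[OF C1_continuous[OF u] c(3)] by blast
  obtain M2 where M2: "\<And>x. norm (grad u x) \<le> M2"
    using bounded_compact_support[OF C1D(2)[OF u] g] by blast
  show ?thesis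
    by (rule that[of d "max M1 M2"]) (use d c g M1 M2 in \<open>auto simp: le_max_iff_disj\<close>)
qed

text \<open>The gradient has compact support, hence is uniformly continuous, so the first-order
  remainder is small uniformly in x. Both differentiation of convolutions and the divergence theorem
  below rest on this.\<close>

lemma C1_uniformly_differentiable:
  assumes "u \<in> C1_ball b" "0 < e"
  obtains d where "0 < d" "\<And>x h. norm h < d \<Longrightarrow> \<bar>u (x + h) - u x - grad u x \<bullet> h\<bar> \<le> e * norm h"
proof -
  obtain c where c: "\<And>x. c \<le> norm x \<Longrightarrow> grad u x = 0" using C1_ballD[OF assms(1)] by metis
  have u: "C1 u" using assms(1) by (simp add: C1_ball_def)
  have "uniformly_continuous_on UNIV (grad u)"
    using uniformly_continuous_compact_support[OF C1D(2)[OF u] c] .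
  then obtain d where d: "d > 0" "\<And>x y. dist y x < d \<Longrightarrow> dist (grad u y) (grad u x) < e"
    using assms(2) unfolding uniformly_continuous_on_def by (metis UNIV_I)
  have "\<bar>u (x + h) - u x - grad u x \<bullet> h\<bar> \<le> e * norm h" if "norm h < d" for x h
  proof -
    have "norm (u (x + h) - u x - grad u x \<bullet> (x + h - x)) \<le> norm (x + h - x) * e"
    proof (rule differentiable_bound_linearization[where S = "ball x d" and f' = "\<lambda>y h. grad u y \<bullet> h"])
      show "x + t *\<^sub>R (x + h - x) \<in> ball x d" if "t \<in> {0..1}" for t
        using \<open>norm h < d\<close> that d(1) mult_left_le_one_le[of "norm h" t] by (auto simp: dist_norm)
      show "(u has_derivative (\<lambda>h. grad u y \<bullet> h)) (at y within ball x d)" for y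
        using C1D(1)[OF u] has_derivative_at_withinI by blast
      show "onorm ((\<lambda>a. grad u y \<bullet> a) - (\<lambda>a. grad u x \<bullet> a)) \<le> e" if "y \<in> ball x d" for y
        unfolding fun_diff_def
      proof (rule onorm_le)
        fix a
        have "norm (grad u y - grad u x) \<le> e"
          using d(2)[of y x] that by (simp add: dist_norm norm_minus_commute)
        then show "norm (grad u y \<bullet> a - grad u x \<bullet> a) \<le> e * norm a"
          using Cauchy_Schwarz_ineq2[of "grad u y - grad u x" a] mult_right_mono[of "norm (grad u y - grad u x)" e "norm a"]
          by (simp add: inner_diff_left)
      qed
      show "x \<in> ball x d" using d(1) by simp
    qed
    then show ?thesis by (simp add: mult.commute)
  qed
  then show ?thesis using that d(1) by blast
qed

lemma C1_ball_lipschitz: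
  assumes "u \<in> C1_ball b"
  obtains L where "0 \<le> L" "\<And>x y. \<bar>u x - u y\<bar> \<le> L * norm (x - y)"
proof -
  obtain M where M: "0 \<le> M" "\<And>x. norm (grad u x) \<le> M" using C1_ballD[OF assms] by metis
  have u: "C1 u" using assms(1) by (simp add: C1_ball_def)
  have "norm (u x - u y) \<le> M * norm (x - y)" for x y
  proof (rule differentiable_bound[of UNIV u "\<lambda>y h. grad u y \<bullet> h"])
    show "(u has_derivative (\<lambda>h. grad u y \<bullet> h)) (at y within UNIV)" for y
      using C1D(1)[OF u] by simp
    show "onorm ((\<bullet>) (grad u x)) \<le> M" for x
    proof (rule onorm_le)
      fix h
      have "norm (grad u x \<bullet> h) \<le> norm (grad u x) * norm h" by (simp add: Cauchy_Schwarz_ineq2)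
      also have "\<dots> \<le> M * norm h" using M(2) by (intro mult_right_mono) auto
      finally show "norm (grad u x \<bullet> h) \<le> M * norm h" .
    qed
  qed auto
  then show ?thesis using that M(1) by auto
qed

subsection \<open>Convolution\<close>

lemma distr_reflect: "distr lborel lborel (\<lambda>y. x - y) = (lborel :: ('a::euclidean_space) measure)"
  using lborel_affine[of "-1" x] by (simp add: density_1 cong: distr_cong)

lemma distr_translate: "distr lborel lborel (\<lambda>y. y + x) = (lborel :: ('a::euclidean_space) measure)"
  using lborel_affine[of 1 x] by (simp add: density_1 add.commute cong: distr_cong)

lemma integral_reflect:
  fixes F :: "'a::euclidean_space \<Rightarrow> 'b::{banach, second_countable_topology}"
  assumes "F \<in> borel_measurable borel"
  shows "(LINT y|lborel. F (x - y)) = (LINT y|lborel. F y)"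
    "integrable lborel (\<lambda>y. F (x - y)) \<longleftrightarrow> integrable lborel F"
  using integral_distr[of "\<lambda>y. x - y" lborel lborel F] integrable_distr_eq[of "\<lambda>y. x - y" lborel lborel F] assms
  by (simp_all add: distr_reflect)

lemma integral_translate:
  fixes F :: "'a::euclidean_space \<Rightarrow> 'b::{banach, second_countable_topology}"
  assumes "F \<in> borel_measurable borel"
  shows "(LINT y|lborel. F (y + x)) = (LINT y|lborel. F y)"
    "integrable lborel (\<lambda>y. F (y + x)) \<longleftrightarrow> integrable lborel F"
  using integral_distr[of "\<lambda>y. y + x" lborel lborel F] integrable_distr_eq[of "\<lambda>y. y + x" lborel lborel F] assms
  by (simp_all add: distr_translate)

text \<open>The value type of the second factor is left open so that the same operation applies to a
  function and to its gradient.\<close>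

definition conv :: "(real^'n::finite \<Rightarrow> real) \<Rightarrow> (real^'n \<Rightarrow> 'b::euclidean_space) \<Rightarrow> real^'n \<Rightarrow> 'b" where
  "conv f F x = (LINT y|lborel. f y *\<^sub>R F (x - y))"

context
  fixes f :: "real^'n::finite \<Rightarrow> real" and c
  assumes f: "continuous_on UNIV f" "\<And>x. c \<le> norm x \<Longrightarrow> f x = 0"
begin

lemma conv_integrable:
  fixes F :: "real^'n \<Rightarrow> 'b::euclidean_space"
  assumes "continuous_on UNIV F"
  shows "integrable lborel (\<lambda>y. f y *\<^sub>R F (x - y))"
proof (rule integrable_continuous_compact_support)
  show "continuous_on UNIV (\<lambda>y. f y *\<^sub>R F (x - y))"
    by (intro continuous_intros f(1) continuous_on_compose2[OF assms]) auto
  show "f y *\<^sub>R F (x - y) = 0" if "c \<le> norm y" for y using f(2)[OF that] by simp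
qed

lemma conv_continuous:
  fixes F :: "real^'n \<Rightarrow> 'b::euclidean_space"
  assumes "uniformly_continuous_on UNIV F"
  shows "continuous_on UNIV (conv f F)"
proof -
  \<comment> \<open>Adding 1 keeps the divisor positive when f vanishes identically.\<close>
  let ?M = "(LINT y|lborel. \<bar>f y\<bar>) + 1"
  have M: "?M > 0" by (rule add_nonneg_pos) (auto intro: integral_nonneg_AE)
  have F: "continuous_on UNIV F" using assms uniformly_continuous_imp_continuous by blast
  have fi: "integrable lborel f" using integrable_continuous_compact_support f by blast
  have "\<exists>d>0. \<forall>y. dist y x < d \<longrightarrow> dist (conv f F y) (conv f F x) < e" if "e > 0" for x e
  proof -
    obtain d where d: "d > 0" "\<And>x y. dist y x < d \<Longrightarrow> dist (F y) (F x) < e / ?M"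
      using assms \<open>e > 0\<close> M unfolding uniformly_continuous_on_def by (metis UNIV_I divide_pos_pos)
    have "dist (conv f F y) (conv f F x) < e" if "dist y x < d" for y
    proof -
      have "dist (conv f F y) (conv f F x) = norm (LINT z|lborel. f z *\<^sub>R F (y - z) - f z *\<^sub>R F (x - z))"
        by (simp add: conv_def dist_norm conv_integrable[OF F])
      also have "\<dots> \<le> (LINT z|lborel. norm (f z *\<^sub>R F (y - z) - f z *\<^sub>R F (x - z)))"
        by (rule integral_norm_bound)
      also have "\<dots> \<le> (LINT z|lborel. \<bar>f z\<bar> * (e / ?M))"
      proof (rule integral_mono)
        show "norm (f z *\<^sub>R F (y - z) - f z *\<^sub>R F (x - z)) \<le> \<bar>f z\<bar> * (e / ?M)" for z
          using d(2)[of "y - z" "x - z"] that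
            mult_left_mono[of "norm (F (y - z) - F (x - z))" "e / ?M" "\<bar>f z\<bar>"]
          by (simp add: dist_norm scaleR_diff_right[symmetric])
      qed (auto intro!: integrable_norm Bochner_Integration.integrable_diff conv_integrable F integrable_mult_left integrable_abs fi)
      also have "\<dots> = (LINT z|lborel. \<bar>f z\<bar>) * (e / ?M)" by simp
      also have "\<dots> < e" using M \<open>e > 0\<close> by (simp add: field_simps)
      finally show ?thesis .
    qed
    then show ?thesis using d(1) by blast
  qed
  then show ?thesis by (simp add: continuous_on_iff)
qed

text \<open>The derivative falls on u; the uniform remainder estimate for u, integrated against |f|,
  gives the remainder estimate for the convolution.\<close>

lemma conv_C1:
  assumes "u \<in> C1_ball b"
  shows "C1 (conv f u)" "grad (conv f u) = conv f (grad u)"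
proof -
  have u: "C1 u" using assms by (simp add: C1_ball_def)
  obtain c' where c': "\<And>x. c' \<le> norm x \<Longrightarrow> grad u x = 0" using C1_ballD[OF assms] by metis
  let ?M = "(LINT y|lborel. \<bar>f y\<bar>) + 1"
  have M: "?M > 0" by (rule add_nonneg_pos) (auto intro: integral_nonneg_AE)
  have fi: "integrable lborel f" using integrable_continuous_compact_support f by blast
  note i1 = conv_integrable[OF C1_continuous[OF u], simplified]
  note i2 = conv_integrable[OF C1D(2)[OF u]]
  have i3: "integrable lborel (\<lambda>z. f z * (grad u (x - z) \<bullet> h))" for x h
    using integrable_inner_left[of h lborel "\<lambda>z. f z *\<^sub>R grad u (x - z)"] i2 by simp
  have "(conv f u has_derivative (\<lambda>h. conv f (grad u) x \<bullet> h)) (at x)" for x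
    unfolding has_derivative_at_alt
  proof (intro conjI allI impI)
    show "bounded_linear ((\<bullet>) (conv f (grad u) x))" by (rule bounded_linear_inner_right)
    fix e :: real assume "0 < e"
    obtain d where d: "0 < d" "\<And>x h. norm h < d \<Longrightarrow> \<bar>u (x + h) - u x - grad u x \<bullet> h\<bar> \<le> e / ?M * norm h"
      using C1_uniformly_differentiable[OF assms, of "e / ?M"] \<open>0 < e\<close> M by (metis divide_pos_pos)
    have "norm (conv f u y - conv f u x - conv f (grad u) x \<bullet> (y - x)) \<le> e * norm (y - x)" if "norm (y - x) < d" for y
    proof -
      have "conv f (grad u) x \<bullet> (y - x) = (LINT z|lborel. f z * (grad u (x - z) \<bullet> (y - x)))"
        unfolding conv_def using integral_inner_left[of "y - x" lborel "\<lambda>z. f z *\<^sub>R grad u (x - z)"] i2 by simp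
      then have "norm (conv f u y - conv f u x - conv f (grad u) x \<bullet> (y - x)) =
          norm (LINT z|lborel. f z * u (y - z) - f z * u (x - z) - f z * (grad u (x - z) \<bullet> (y - x)))"
        by (simp add: conv_def i1 i3)
      also have "\<dots> \<le> (LINT z|lborel. norm (f z * u (y - z) - f z * u (x - z) - f z * (grad u (x - z) \<bullet> (y - x))))"
        by (rule integral_norm_bound)
      also have "\<dots> \<le> (LINT z|lborel. \<bar>f z\<bar> * (e / ?M * norm (y - x)))"
      proof (rule integral_mono)
        fix z
        have "norm (f z * u (y - z) - f z * u (x - z) - f z * (grad u (x - z) \<bullet> (y - x))) =
            \<bar>f z\<bar> * \<bar>u ((x - z) + (y - x)) - u (x - z) - grad u (x - z) \<bullet> (y - x)\<bar>"
          by (simp add: right_diff_distrib[symmetric] abs_mult)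
        also have "\<dots> \<le> \<bar>f z\<bar> * (e / ?M * norm (y - x))"
          by (intro mult_left_mono d(2) that) simp
        finally show "norm (f z * u (y - z) - f z * u (x - z) - f z * (grad u (x - z) \<bullet> (y - x))) \<le>
            \<bar>f z\<bar> * (e / ?M * norm (y - x))" .
      qed (intro integrable_norm Bochner_Integration.integrable_diff i1 i3 integrable_mult_left integrable_abs fi)+
      also have "\<dots> = (LINT z|lborel. \<bar>f z\<bar>) * (e / ?M * norm (y - x))" by simp
      also have "\<dots> = ((LINT z|lborel. \<bar>f z\<bar>) / ?M) * (e * norm (y - x))" by simp
      also have "\<dots> \<le> 1 * (e * norm (y - x))"
        using M \<open>0 < e\<close> by (intro mult_right_mono) auto
      finally show ?thesis by simp
    qed
    then show "\<exists>d>0. \<forall>y. norm (y - x) < d \<longrightarrow> norm (conv f u y - conv f u x - conv f (grad u) x \<bullet> (y - x)) \<le> e * norm (y - x)"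
      using d(1) by blast
  qed
  moreover have "continuous_on UNIV (conv f (grad u))"
    using conv_continuous uniformly_continuous_compact_support[OF C1D(2)[OF u] c'] by blast
  ultimately show "C1 (conv f u)" "grad (conv f u) = conv f (grad u)"
    using C1I by blast+
qed

end

lemma conv_commute:
  assumes "continuous_on UNIV f" "continuous_on UNIV g"
  shows "conv f g x = conv g f x"
proof -
  have "(\<lambda>y. f y * g (x - y)) \<in> borel_measurable borel"
    by (intro borel_measurable_continuous_onI continuous_intros assms continuous_on_compose2[OF assms(2)]) auto
  from integral_reflect(1)[OF this, of x] show ?thesis
    by (simp add: conv_def mult.commute)
qed

subsection \<open>Mollification\<close>

lemma integral_pos_continuous:
  fixes f :: "'a::euclidean_space \<Rightarrow> real"
  assumes "integrable lborel f" "\<And>x. 0 \<le> f x" "isCont f x0" "0 < f x0"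
  shows "0 < (LINT x|lborel. f x)"
proof -
  obtain d where d: "d > 0" "\<And>x. dist x x0 < d \<Longrightarrow> dist (f x) (f x0) < f x0 / 2"
    using assms(3,4) unfolding continuous_at_eps_delta by (metis half_gt_zero)
  have "0 < f x0 / 2 * measure lborel (ball x0 d)"
    using d(1) assms(4) content_ball_pos[of d x0] by simp
  also have "\<dots> = (LINT x|lborel. f x0 / 2 * indicator (ball x0 d) x)" by simp
  also have "\<dots> \<le> (LINT x|lborel. f x)"
  proof (rule integral_mono)
    show "integrable lborel (\<lambda>x. f x0 / 2 * indicator (ball x0 d) x)"
      using emeasure_lborel_ball_finite[of x0 d] by (intro integrable_mult_right) simp
    show "f x0 / 2 * indicator (ball x0 d) x \<le> f x" for x
    proof (cases "x \<in> ball x0 d")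
      case True
      then have "dist (f x) (f x0) < f x0 / 2" using d(2)[of x] by (simp add: dist_commute)
      then have "f x0 / 2 \<le> f x" unfolding dist_real_def by linarith
      then show ?thesis using True by simp
    qed (use assms(2)[of x] in simp)
  qed (rule assms(1))
  finally show ?thesis .
qed

text \<open>A probability density on the ball of radius \<delta>. Regularity is supplied separately,
  because two kinds of kernel occur: smooth ones of product form and radial ones of class
  C1.\<close>

definition mollifier :: "real \<Rightarrow> (real^'n::finite \<Rightarrow> real) \<Rightarrow> bool" where
  "mollifier \<delta> \<zeta> \<longleftrightarrow> continuous_on UNIV \<zeta> \<and> (\<forall>x. 0 \<le> \<zeta> x) \<and> (\<forall>x. \<delta> \<le> norm x \<longrightarrow> \<zeta> x = 0)
     \<and> (LINT x|lborel. \<zeta> x) = 1"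

text \<open>The convolution at x is an average of values of F at points within \<delta> of x, and
  balls are convex. The bound, the support and the convergence of mollifications are all instances
  of this.\<close>

lemma conv_mollifier_close:
  fixes F :: "real^'n::finite \<Rightarrow> 'b::euclidean_space"
  assumes \<zeta>: "mollifier \<delta> \<zeta>" and F: "continuous_on UNIV F"
    and e: "\<And>y. norm (y - x) \<le> \<delta> \<Longrightarrow> norm (F y - a) \<le> e"
  shows "norm (conv \<zeta> F x - a) \<le> e"
proof -
  have i: "integrable lborel \<zeta>"
    using \<zeta> unfolding mollifier_def by (metis integrable_continuous_compact_support)
  have j: "integrable lborel (\<lambda>y. \<zeta> y *\<^sub>R F (x - y))"
    using \<zeta> F conv_integrable[of \<zeta> \<delta> F x] by (auto simp: mollifier_def)
  have 1: "(LINT y|lborel. \<zeta> y) = 1" using \<zeta> by (simp add: mollifier_def)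
  have "conv \<zeta> F x - a = (LINT y|lborel. \<zeta> y *\<^sub>R F (x - y)) - (LINT y|lborel. \<zeta> y *\<^sub>R a)"
    by (simp add: conv_def 1 i)
  also have "\<dots> = (LINT y|lborel. \<zeta> y *\<^sub>R F (x - y) - \<zeta> y *\<^sub>R a)"
    using i j by (simp add: Bochner_Integration.integral_diff)
  finally have "norm (conv \<zeta> F x - a) = norm (LINT y|lborel. \<zeta> y *\<^sub>R F (x - y) - \<zeta> y *\<^sub>R a)" by simp
  also have "\<dots> \<le> (LINT y|lborel. norm (\<zeta> y *\<^sub>R F (x - y) - \<zeta> y *\<^sub>R a))" by (rule integral_norm_bound)
  also have "\<dots> \<le> (LINT y|lborel. \<zeta> y * e)"
  proof (rule integral_mono)
    show "norm (\<zeta> y *\<^sub>R F (x - y) - \<zeta> y *\<^sub>R a) \<le> \<zeta> y * e" for y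
    proof (cases "\<delta> \<le> norm y")
      case True then show ?thesis using \<zeta> by (simp add: mollifier_def)
    next
      case False
      then have "norm (F (x - y) - a) \<le> e" using e[of "x - y"] by simp
      moreover have "0 \<le> \<zeta> y" using \<zeta> by (simp add: mollifier_def)
      ultimately show ?thesis by (simp add: scaleR_diff_right[symmetric] mult_left_mono)
    qed
  qed (intro integrable_norm Bochner_Integration.integrable_diff j integrable_scaleR_left integrable_mult_left i)+
  also have "\<dots> = e" by (simp add: 1)
  finally show ?thesis .
qed

lemma conv_mollifier_bound:
  fixes F :: "real^'n::finite \<Rightarrow> 'b::euclidean_space"
  assumes "mollifier \<delta> \<zeta>" "continuous_on UNIV F" "\<And>y. norm (F y) \<le> M"
  shows "norm (conv \<zeta> F x) \<le> M"
  using conv_mollifier_close[OF assms(1,2), of x 0 M] assms(3) by simp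

lemma conv_mollifier_support:
  fixes F :: "real^'n::finite \<Rightarrow> 'b::euclidean_space"
  assumes "mollifier \<delta> \<zeta>" "continuous_on UNIV F" "\<And>y. c \<le> norm y \<Longrightarrow> F y = 0" "c + \<delta> \<le> norm x"
  shows "conv \<zeta> F x = 0"
proof -
  have "norm (conv \<zeta> F x - 0) \<le> 0"
  proof (rule conv_mollifier_close[OF assms(1,2)])
    fix y assume "norm (y - x) \<le> \<delta>"
    then have "c \<le> norm y" using assms(4) norm_triangle_ineq2[of x y] by (simp add: norm_minus_commute)
    then show "norm (F y - 0) \<le> 0" using assms(3) by simp
  qed
  then show ?thesis by simp
qed

lemma conv_mollifier_tendsto:
  fixes F :: "real^'n::finite \<Rightarrow> 'b::euclidean_space"
  assumes "\<And>k. mollifier (\<delta> k) (\<zeta> k)" "continuous_on UNIV F" "\<delta> \<longlonglongrightarrow> 0"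
  shows "(\<lambda>k. conv (\<zeta> k) F x) \<longlonglongrightarrow> F x"
proof (rule LIMSEQ_I)
  fix e :: real assume "0 < e"
  have "isCont F x" using assms(2) continuous_on_eq_continuous_at by blast
  then obtain d where d: "d > 0" "\<And>y. dist y x < d \<Longrightarrow> dist (F y) (F x) < e / 2"
    using \<open>0 < e\<close> unfolding continuous_at_eps_delta by (metis half_gt_zero)
  obtain n where n: "\<And>k. k \<ge> n \<Longrightarrow> norm (\<delta> k - 0) < d" using LIMSEQ_D[OF assms(3) d(1)] by blast
  have "norm (conv (\<zeta> k) F x - F x) < e" if "k \<ge> n" for k
  proof -
    have "norm (conv (\<zeta> k) F x - F x) \<le> e / 2"
    proof (rule conv_mollifier_close[OF assms(1,2)])
      fix y assume "norm (y - x) \<le> \<delta> k"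
      then have "norm (y - x) < d" using n[OF that] by simp
      then show "norm (F y - F x) \<le> e / 2"
        using d(2)[of y] by (simp add: dist_norm less_imp_le)
    qed
    then show ?thesis using \<open>0 < e\<close> by simp
  qed
  then show "\<exists>n. \<forall>k\<ge>n. norm (conv (\<zeta> k) F x - F x) < e" by blast
qed

text \<open>The multi-index m records the order of differentiation in each coordinate, so partial
  derivatives stay inside this family.\<close>

definition family_prod :: "(nat \<Rightarrow> real \<Rightarrow> real) \<Rightarrow> ('n::finite \<Rightarrow> nat) \<Rightarrow> real^'n \<Rightarrow> real" where
  "family_prod \<beta> m x = (\<Prod>i\<in>UNIV. \<beta> (m i) (x $ i))"

lemma family_prod_support:
  fixes x :: "real^'n::finite"
  assumes "\<And>j t. c \<le> \<bar>t\<bar> \<Longrightarrow> \<beta> j t = 0" "real CARD('n) * c \<le> norm x"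
  shows "family_prod \<beta> m x = 0"
proof -
  have "\<exists>i. c \<le> \<bar>x $ i\<bar>"
  proof (rule ccontr)
    assume "\<not> (\<exists>i. c \<le> \<bar>x $ i\<bar>)"
    then have "(\<Sum>i\<in>UNIV. \<bar>x $ i\<bar>) < (\<Sum>i\<in>(UNIV::'n set). c)"
      by (intro sum_strict_mono) (auto simp: not_le)
    then show False using norm_le_l1_cart[of x] assms(2) by simp
  qed
  then show ?thesis using assms(1) by (auto simp: family_prod_def)
qed

context
  fixes \<beta> assumes \<beta>: "derivative_family \<beta>"
begin

lemma family_continuous: "continuous_on UNIV (\<beta> j)"
proof -
  have "isCont (\<beta> j) t" for t using \<beta> DERIV_isCont unfolding derivative_family_def by blast
  then show ?thesis by (simp add: continuous_at_imp_continuous_on)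
qed

lemma family_prod_continuous: "continuous_on UNIV (family_prod \<beta> m)"
  unfolding family_prod_def
  by (intro continuous_intros continuous_on_compose2[OF family_continuous]) auto

lemma family_prod_has_derivative:
  "(family_prod \<beta> m has_derivative (\<lambda>h. (\<chi> i. family_prod \<beta> (m(i := Suc (m i))) x) \<bullet> h)) (at x)"
proof -
  have d: "((\<lambda>x. \<beta> (m i) (x $ i)) has_derivative (\<lambda>h. \<beta> (Suc (m i)) (x $ i) * h $ i)) (at x)" for i
  proof -
    have c: "((\<lambda>x. x $ i) has_derivative (\<lambda>h. h $ i)) (at x)"
      by (simp add: bounded_linear_imp_has_derivative bounded_linear_vec_nth)
    have "(\<beta> (m i) has_derivative (\<lambda>h. \<beta> (Suc (m i)) (x $ i) * h)) (at (x $ i))"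
      using \<beta> unfolding derivative_family_def has_field_derivative_def by blast
    from has_derivative_compose[OF c this] show ?thesis .
  qed
  have "(family_prod \<beta> m has_derivative
      (\<lambda>h. \<Sum>i\<in>UNIV. \<beta> (Suc (m i)) (x $ i) * h $ i * (\<Prod>j\<in>UNIV - {i}. \<beta> (m j) (x $ j)))) (at x)"
    unfolding family_prod_def by (rule has_derivative_prod) (rule d)
  moreover have "(\<Sum>i\<in>UNIV. \<beta> (Suc (m i)) (x $ i) * h $ i * (\<Prod>j\<in>UNIV - {i}. \<beta> (m j) (x $ j))) =
      (\<chi> i. family_prod \<beta> (m(i := Suc (m i))) x) \<bullet> h" for h
  proof -
    have "family_prod \<beta> (m(i := Suc (m i))) x = \<beta> (Suc (m i)) (x $ i) * (\<Prod>j\<in>UNIV - {i}. \<beta> (m j) (x $ j))" for i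
      unfolding family_prod_def by (subst prod.remove[of _ i]) (auto intro!: prod.cong)
    then show ?thesis by (simp add: inner_vec_def mult_ac)
  qed
  ultimately show ?thesis by simp
qed

lemma family_prod_C1_ball: "\<exists>b. family_prod \<beta> m \<in> C1_ball b"
proof -
  obtain c where c: "\<And>j t. c \<le> \<bar>t\<bar> \<Longrightarrow> \<beta> j t = 0"
    using \<beta> unfolding derivative_family_def by blast
  have "C1 (family_prod \<beta> m)"
    using family_prod_has_derivative
    by (rule C1I) (intro continuous_intros family_prod_continuous)
  moreover have "family_prod \<beta> m x = 0" if "max 0 (real CARD('a) * c) \<le> norm x" for x :: "real^'a"
    using family_prod_support[of c \<beta> x m] c that by auto
  ultimately have "family_prod \<beta> m \<in> C1_ball (max 0 (real CARD('a) * c) + 1)"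
    unfolding C1_ball_def by (intro CollectI conjI exI[of _ "max 0 (real CARD('a) * c)"]) auto
  then show ?thesis ..
qed

text \<open>A partial derivative of the convolution is the convolution of u with the product whose
  multi-index is raised in one coordinate. The induction therefore has to keep m arbitrary.\<close>

lemma C_k_conv_family_prod:
  assumes u: "continuous_on UNIV u" "\<And>x. c \<le> norm x \<Longrightarrow> u x = 0"
  shows "C_k k (conv u (family_prod \<beta> m))"
proof (induction k arbitrary: m)
  case 0
  obtain b where "family_prod \<beta> m \<in> C1_ball b" using family_prod_C1_ball by blast
  from C1_continuous[OF conv_C1(1)[OF u this]] show ?case by simp
next
  case (Suc k)
  obtain b where b: "family_prod \<beta> m \<in> C1_ball b" using family_prod_C1_ball by blast
  note c1 = conv_C1[OF u b]
  have "partial_deriv i (conv u (family_prod \<beta> m)) = conv u (family_prod \<beta> (m(i := Suc (m i))))" for i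
  proof
    fix x
    have "partial_deriv i (conv u (family_prod \<beta> m)) x = conv u (grad (family_prod \<beta> m)) x $ i"
      using c1(2) by (metis grad_def vec_lambda_beta)
    also have "\<dots> = (LINT y|lborel. u y *\<^sub>R grad (family_prod \<beta> m) (x - y)) \<bullet> axis i 1"
      by (simp add: conv_def cart_eq_inner_axis)
    also have "\<dots> = (LINT y|lborel. (u y *\<^sub>R grad (family_prod \<beta> m) (x - y)) \<bullet> axis i 1)"
    proof (rule integral_inner_left[symmetric])
      show "integrable lborel (\<lambda>y. u y *\<^sub>R grad (family_prod \<beta> m) (x - y))"
        using b by (intro conv_integrable[OF u] C1D(2)) (auto simp: C1_ball_def)
    qed
    also have "\<dots> = conv u (family_prod \<beta> (m(i := Suc (m i)))) x"
    proof -
      have "grad (family_prod \<beta> m) z \<bullet> axis i 1 = family_prod \<beta> (m(i := Suc (m i))) z" for z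
        by (subst grad_eqI[OF family_prod_has_derivative]) (simp flip: cart_eq_inner_axis)
      then show ?thesis by (simp add: conv_def)
    qed
    finally show "partial_deriv i (conv u (family_prod \<beta> m)) x = conv u (family_prod \<beta> (m(i := Suc (m i)))) x" .
  qed
  then have "C_k k (partial_deriv i (conv u (family_prod \<beta> m)))" for i using Suc by simp
  moreover have "conv u (family_prod \<beta> m) differentiable_on UNIV"
    using c1(1) by (simp add: C1_def differentiable_on_def)
  ultimately show ?case by simp
qed

end

lemma smooth_mollifier_exists:
  assumes "0 < \<delta>"
  obtains \<zeta> :: "real^'n::finite \<Rightarrow> real" where "mollifier \<delta> \<zeta>"
    "\<And>u c k. continuous_on UNIV u \<Longrightarrow> (\<And>x. c \<le> norm x \<Longrightarrow> u x = 0) \<Longrightarrow> C_k k (conv u \<zeta>)"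
proof -
  obtain \<beta>0 where \<beta>0: "derivative_family \<beta>0" "\<And>j t. 1 \<le> \<bar>t\<bar> \<Longrightarrow> \<beta>0 j t = 0" "\<And>t. 0 \<le> \<beta>0 0 t" "0 < \<beta>0 0 0"
    using bump_family_exists by blast
  \<comment> \<open>If \<delta> \<le> |x|, then some coordinate has modulus at least \<delta> / n.
    Scaling by n / \<delta> takes this coordinate out of the unit interval, where the bump
    vanishes.\<close>
  define s where "s = real CARD('n) / \<delta>"
  have s: "0 < s" using assms by (simp add: s_def)
  define \<beta> where "\<beta> = (\<lambda>j t. s ^ j * \<beta>0 j (s * t))"
  have \<beta>: "derivative_family \<beta>" using derivative_family_scale[OF \<beta>0(1) s] by (simp add: \<beta>_def)
  have z: "\<beta> j t = 0" if "\<delta> / real CARD('n) \<le> \<bar>t\<bar>" for j t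
    using that assms \<beta>0(2)[of "s * t" j] by (simp add: \<beta>_def s_def abs_mult field_simps)
  define P :: "real^'n \<Rightarrow> real" where "P = family_prod \<beta> (\<lambda>_. 0)"
  have P0: "P x = 0" if "\<delta> \<le> norm x" for x
    unfolding P_def by (rule family_prod_support[OF z]) (use that in auto)
  have Pc: "continuous_on UNIV P" unfolding P_def using family_prod_continuous[OF \<beta>] .
  have Pn: "0 \<le> P x" for x
    unfolding P_def family_prod_def \<beta>_def using \<beta>0(3) by (auto intro!: prod_nonneg)
  have Pi: "integrable lborel P" using integrable_continuous_compact_support Pc P0 by blast
  define I where "I = (LINT x|lborel. P x)"
  have "0 < P 0" unfolding P_def family_prod_def \<beta>_def using \<beta>0(4) by (auto intro!: prod_pos)
  then have I: "0 < I"
    unfolding I_def using Pc by (intro integral_pos_continuous[OF Pi Pn, of 0]) (auto simp: continuous_on_eq_continuous_at)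
  define \<zeta> where "\<zeta> = (\<lambda>x. P x / I)"
  have "mollifier \<delta> \<zeta>"
    using I Pn P0 Pc Pi by (auto simp: mollifier_def \<zeta>_def I_def[symmetric] intro!: continuous_intros)
  moreover have "C_k k (conv u \<zeta>)" if u: "continuous_on UNIV u" "\<And>x. c \<le> norm x \<Longrightarrow> u x = 0" for u c k
  proof -
    have "C_k k (conv (\<lambda>x. u x / I) P)" unfolding P_def
      by (rule C_k_conv_family_prod[OF \<beta>, of _ c]) (use u I in \<open>auto intro!: continuous_intros\<close>)
    moreover have "conv (\<lambda>x. u x / I) P = conv u \<zeta>" by (simp add: conv_def \<zeta>_def fun_eq_iff)
    ultimately show ?thesis by simp
  qed
  ultimately show ?thesis using that by blast
qed

section \<open>Test functions and their density in C1\<close>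

lemma test_functions_C1_ball:
  fixes u :: "real^'n::finite \<Rightarrow> real"
  assumes "u \<in> test_functions (ball 0 b)" "0 < b"
  shows "u \<in> C1_ball b"
proof -
  have C: "C_k k u" for k using assms by (simp add: test_functions_def)
  have "C_k (Suc 0) u" "C_k 0 u" by (rule C)+
  then have "u differentiable_on UNIV" "\<And>i. continuous_on UNIV (partial_deriv i u)" by simp_all
  then have "C1 u"
    unfolding C1_def by (auto simp: differentiable_on_def grad_def[abs_def] intro!: continuous_intros)
  moreover have "\<exists>c\<ge>0. c < b \<and> (\<forall>x. c \<le> norm x \<longrightarrow> u x = 0)"
  proof -
    let ?S = "closure {x. u x \<noteq> 0}"
    have S: "compact ?S" "?S \<subseteq> ball 0 b" using assms by (auto simp: test_functions_def)
    show ?thesis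
    proof (cases "?S = {}")
      case True
      then have "\<And>x. u x = 0" by auto
      then show ?thesis using assms(2) by auto
    next
      case False
      obtain y where y: "y \<in> ?S" "\<And>x. x \<in> ?S \<Longrightarrow> norm x \<le> norm y"
        using continuous_attains_sup[OF S(1) False, of norm] by (auto intro: continuous_intros)
      have "u x = 0" if "norm y < norm x" for x
        using y(2)[of x] that closure_subset[of "{x. u x \<noteq> 0}"] by force
      moreover have "norm y < b" using y(1) S(2) by auto
      ultimately show ?thesis
        using assms(2) norm_ge_zero[of y]
        by (intro exI[of _ "(norm y + b) / 2"]) (auto simp: field_simps simp del: norm_ge_zero)
    qed
  qed
  ultimately show ?thesis by (simp add: C1_ball_def)
qed

lemma test_functions_ballI:
  fixes u :: "real^'n::finite \<Rightarrow> real"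
  assumes "\<And>k. C_k k u" "\<And>x. c < norm x \<Longrightarrow> u x = 0" "c < b"
  shows "u \<in> test_functions (ball 0 b)"
proof -
  have "closure {x. u x \<noteq> 0} \<subseteq> cball 0 c"
    using assms(2) by (intro closure_minimal) (auto simp: not_less[symmetric])
  moreover have "cball (0::real^'n) c \<subseteq> ball 0 b" using assms(3) by auto
  moreover have "compact (closure {x. u x \<noteq> 0})"
    using calculation(1) by (metis bounded_cball bounded_subset closed_closure compact_eq_bounded_closed)
  ultimately show ?thesis
    using assms(1) by (auto simp: test_functions_def)
qed

lemma test_functions_UNIV:
  fixes u :: "real^'n::finite \<Rightarrow> real"
  assumes "u \<in> test_functions UNIV"
  obtains b where "0 < b" "u \<in> test_functions (ball 0 b)"
proof -
  have "bounded (closure {x. u x \<noteq> 0})" using assms by (simp add: test_functions_def compact_imp_bounded)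
  then obtain b where "b > 0" "closure {x. u x \<noteq> 0} \<subseteq> ball 0 b"
    using bounded_subset_ballD by blast
  then show ?thesis using assms that by (auto simp: test_functions_def)
qed

text \<open>The gradients are allowed to blow up like \<open>1 / norm x\<close>, as happens when a function is cut off near the origin.\<close>
definition dominated_limit :: "real \<Rightarrow> (nat \<Rightarrow> real^'n::finite \<Rightarrow> real) \<Rightarrow> (real^'n \<Rightarrow> real) \<Rightarrow> bool" where
  "dominated_limit b v u \<longleftrightarrow>
    (\<exists>M. \<forall>k x. x \<noteq> 0 \<longrightarrow> \<bar>v k x\<bar> \<le> M \<and> norm (grad (v k) x) \<le> M + M / norm x) \<and>
    (\<forall>k. v k \<in> C1_ball b) \<and>
    (\<forall>x. x \<noteq> 0 \<longrightarrow> (\<lambda>k. v k x) \<longlonglongrightarrow> u x \<and> (\<lambda>k. grad (v k) x) \<longlonglongrightarrow> grad u x)"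

text \<open>Mollification is read in two ways, identified by commutativity: with the derivatives on
  the kernel it is smooth, with the derivative on u its gradient is the mollified gradient and
  converges pointwise.\<close>

lemma C1_ball_approx:
  fixes u :: "real^'n::finite \<Rightarrow> real"
  assumes "u \<in> C1_ball b"
  obtains v where "\<And>k. v k \<in> test_functions (ball 0 b)" "dominated_limit b v u"
proof -
  obtain c M where c: "0 \<le> c" "c < b" "\<And>x. c \<le> norm x \<Longrightarrow> u x = 0" "0 \<le> M" "\<And>x. \<bar>u x\<bar> \<le> M" "\<And>x. norm (grad u x) \<le> M"
    using C1_ballD[OF assms] by metis
  have u: "C1 u" using assms by (simp add: C1_ball_def)
  note uc = C1_continuous[OF u] C1D(2)[OF u]
  \<comment> \<open>Radii up to half the distance from the support to the sphere of radius b keep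
    every mollification supported inside the ball.\<close>
  define \<delta> where "\<delta> = (\<lambda>k. (b - c) / 2 * (1 / real (Suc k)))"
  have \<delta>: "0 < \<delta> k" "\<delta> k \<le> (b - c) / 2" for k
    using c mult_left_mono[of "1 / real (Suc k)" 1 "(b - c) / 2"] by (simp_all add: \<delta>_def)
  have "\<exists>\<zeta> :: real^'n \<Rightarrow> real. mollifier (\<delta> k) \<zeta> \<and> (\<forall>u c j. continuous_on UNIV u \<longrightarrow> (\<forall>x. c \<le> norm x \<longrightarrow> u x = 0) \<longrightarrow> C_k j (conv u \<zeta>))" for k
    using smooth_mollifier_exists[OF \<delta>(1)[of k]] by metis
  then obtain \<zeta> :: "nat \<Rightarrow> real^'n \<Rightarrow> real" where \<zeta>: "\<And>k. mollifier (\<delta> k) (\<zeta> k)"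
    "\<And>k u c j. continuous_on UNIV u \<Longrightarrow> (\<And>x. c \<le> norm x \<Longrightarrow> u x = 0) \<Longrightarrow> C_k j (conv u (\<zeta> k))"
    by metis
  have \<zeta>c: "continuous_on UNIV (\<zeta> k)" "\<And>x. \<delta> k \<le> norm x \<Longrightarrow> \<zeta> k x = 0" for k
    using \<zeta>(1)[of k] by (auto simp: mollifier_def)
  have lim: "\<delta> \<longlonglongrightarrow> 0"
    unfolding \<delta>_def using tendsto_mult[OF tendsto_const LIMSEQ_inverse_real_of_nat, of "(b - c) / 2"]
    by (simp add: inverse_eq_divide)
  define v where "v = (\<lambda>k. conv (\<zeta> k) u)"
  have g: "C1 (v k)" "grad (v k) = conv (\<zeta> k) (grad u)" for k
    unfolding v_def using conv_C1[OF \<zeta>c assms] by auto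
  have t: "v k \<in> test_functions (ball 0 b)" for k
  proof (rule test_functions_ballI)
    show "C_k j (v k)" for j
    proof -
      have "C_k j (conv u (\<zeta> k))" by (rule \<zeta>(2)[OF uc(1)]) (rule c(3))
      moreover have "conv u (\<zeta> k) = v k" using conv_commute[OF \<zeta>c(1) uc(1)] by (simp add: v_def fun_eq_iff)
      ultimately show ?thesis by simp
    qed
    show "v k x = 0" if "(b + c) / 2 < norm x" for x
      unfolding v_def by (rule conv_mollifier_support[OF \<zeta>(1) uc(1) c(3)]) (use that \<delta>(2)[of k] in \<open>auto simp: field_simps\<close>)
    show "(b + c) / 2 < b" using c by simp
  qed
  have "dominated_limit b v u"
    unfolding dominated_limit_def
  proof (intro conjI allI impI exI[of _ M])
    fix k and x :: "real^'n"
    show "\<bar>v k x\<bar> \<le> M"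
      using conv_mollifier_bound[OF \<zeta>(1) uc(1), of M k x] c(5) by (simp add: v_def)
    have "norm (grad (v k) x) \<le> M"
      using conv_mollifier_bound[OF \<zeta>(1) uc(2), of M k x] c(6) by (simp add: g)
    then show "norm (grad (v k) x) \<le> M + M / norm x" using c(4) by (simp add: add_increasing2)
  next
    show "v k \<in> C1_ball b" for k using test_functions_C1_ball[OF t] c by simp
  next
    fix x :: "real^'n"
    show "(\<lambda>k. v k x) \<longlonglongrightarrow> u x"
      using conv_mollifier_tendsto[OF \<zeta>(1) uc(1) lim] by (simp add: v_def)
    show "(\<lambda>k. grad (v k) x) \<longlonglongrightarrow> grad u x"
      using conv_mollifier_tendsto[OF \<zeta>(1) uc(2) lim] by (simp add: g(2))
  qed
  with t show ?thesis using that by blast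
qed

subsection \<open>Singular weights\<close>

text \<open>The radial map with profile \<open>r powr (1 - 2 / n)\<close> has Jacobian determinant proportional to \<open>r powr -2\<close>.\<close>
lemma integrable_inverse_square_ball:
  assumes n: "3 \<le> CARD('n::finite)" and "0 < b"
  shows "integrable lborel (\<lambda>x::real^'n. indicator {x. 0 < norm x \<and> norm x < b} x / (norm x)\<^sup>2)"
proof -
  define \<gamma> where "\<gamma> = 1 - 2 / real CARD('n)"
  have \<gamma>: "0 < \<gamma>" using n by (simp add: \<gamma>_def)
  define f where "f = (\<lambda>r::real. r powr \<gamma>)"
  define f' where "f' = (\<lambda>r::real. \<gamma> * r powr (\<gamma> - 1))"
  define B where "B = {x::real^'n. 0 < norm x \<and> norm x < b}"
  define G :: "real^'n \<Rightarrow> real" where "G = indicator (radial_map f ` B)"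
  have Fx: "norm (radial_map f x) = f (norm x)" if "x \<in> B" for x
    using that norm_radial_map[of x f] by (simp add: B_def f_def)
  have im: "radial_map f ` B = {y. 0 < norm y \<and> norm y < f b}"
  proof (intro set_eqI iffI)
    fix y assume "y \<in> radial_map f ` B"
    then obtain x where "x \<in> B" "y = radial_map f x" by blast
    then show "y \<in> {y. 0 < norm y \<and> norm y < f b}"
      using Fx[of x] \<gamma> powr_less_mono2[of \<gamma> "norm x" b] by (auto simp: B_def f_def)
  next
    fix y assume y: "y \<in> {y::real^'n. 0 < norm y \<and> norm y < f b}"
    define r where "r = norm y powr (1 / \<gamma>)"
    have r: "0 < r" "f r = norm y" using y \<gamma> by (auto simp: r_def f_def powr_powr)
    have "r < b"
    proof -
      have "r < f b powr (1 / \<gamma>)" unfolding r_def using y \<gamma> by (intro powr_less_mono2) auto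
      then show ?thesis using \<gamma> assms(2) by (simp add: f_def powr_powr)
    qed
    then have "(r / norm y) *\<^sub>R y \<in> B" "radial_map f ((r / norm y) *\<^sub>R y) = y"
      using y r by (auto simp: B_def radial_map_def)
    then show "y \<in> radial_map f ` B" by (metis imageI)
  qed
  have [measurable]: "B \<in> sets borel"
    unfolding B_def by (intro borel_open open_Collect_conj open_Collect_less continuous_intros)
  have mB: "radial_map f ` B \<in> sets borel"
    unfolding im by (intro borel_open open_Collect_conj open_Collect_less continuous_intros)
  have G: "integrable lborel G"
  proof -
    have "radial_map f ` B \<subseteq> ball 0 (f b)" unfolding im by auto
    then have "emeasure lborel (radial_map f ` B) \<le> emeasure lborel (ball (0::real^'n) (f b))"
      by (intro emeasure_mono) auto
    also have "\<dots> < \<infinity>" using emeasure_lborel_ball_finite by blast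
    finally show ?thesis using mB by (simp add: G_def)
  qed
  have eq: "indicator B x * (f' (norm x) * (f (norm x) / norm x) ^ (CARD('n) - 1) * G (radial_map f x))
      = \<gamma> * (indicator B x / (norm x)\<^sup>2)" for x :: "real^'n"
  proof (cases "x \<in> B")
    case True
    then have r: "0 < norm x" by (simp add: B_def)
    have "f (norm x) / norm x = norm x powr (\<gamma> - 1)" using r by (simp add: f_def powr_diff)
    then have "f' (norm x) * (f (norm x) / norm x) ^ (CARD('n) - 1) = \<gamma> * (norm x powr (\<gamma> - 1)) ^ CARD('n)"
      using power_Suc[of "norm x powr (\<gamma> - 1)" "CARD('n) - 1"] by (simp add: f'_def)
    also have "(norm x powr (\<gamma> - 1)) ^ CARD('n) = norm x powr ((\<gamma> - 1) * real CARD('n))"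
      using r n by (subst powr_realpow[symmetric]) (auto simp: powr_powr)
    also have "\<dots> = 1 / (norm x)\<^sup>2"
      using n r by (simp add: \<gamma>_def powr_minus_divide powr_realpow[of _ 2, simplified])
    finally show ?thesis using True by (simp add: G_def)
  qed simp
  have "integrable lborel (\<lambda>x. indicator B x * (f' (norm x) * (f (norm x) / norm x) ^ (CARD('n) - 1) * G (radial_map f x)))"
    unfolding B_def
  proof (rule radial_change_of_variables(1)[OF _ _ _ G])
    show "(f has_real_derivative f' r) (at r)" if "0 < r" "r < b" for r
      unfolding f_def f'_def using that by (auto intro!: derivative_eq_intros)
    show "0 < f r" "0 < f' r" if "0 < r" "r < b" for r using that \<gamma> by (auto simp: f_def f'_def)
    show "G y = 0" if "y \<notin> radial_map f ` {x. 0 < norm x \<and> norm x < b}" for y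
      using that by (simp add: G_def B_def)
    show "(\<lambda>x. indicator {x. 0 < norm x \<and> norm x < b} x * (f' (norm x) * (f (norm x) / norm x) ^ (CARD('n) - 1) * G (radial_map f x)))
        \<in> borel_measurable borel"
      unfolding B_def[symmetric] eq by measurable
  qed
  then have "integrable lborel (\<lambda>x::real^'n. \<gamma> * (indicator B x / (norm x)\<^sup>2))"
    unfolding eq .
  then have "integrable lborel (\<lambda>x::real^'n. (1 / \<gamma>) * (\<gamma> * (indicator B x / (norm x)\<^sup>2)))"
    by (rule integrable_mult_right)
  moreover have "(\<lambda>x::real^'n. (1 / \<gamma>) * (\<gamma> * (indicator B x / (norm x)\<^sup>2))) =
      (\<lambda>x. indicator {x. 0 < norm x \<and> norm x < b} x / (norm x)\<^sup>2)"
    using \<gamma> by (auto simp: B_def)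
  ultimately show ?thesis by simp
qed

lemma AE_nonzero: "AE x in lborel. (x::'a::euclidean_space) \<noteq> 0"
  by (rule AE_I[of _ _ "{0}"]) auto

text \<open>Squared gradients of cut-off functions and all weights in the inequality are bounded by
  C / |x|^2 on a fixed ball, which is an integrable majorant in dimension at least 3.\<close>

lemma inverse_square_dominated:
  fixes F :: "nat \<Rightarrow> real^'n::finite \<Rightarrow> real"
  assumes n: "3 \<le> CARD('n)" and b: "0 < b"
    and meas: "\<And>k. F k \<in> borel_measurable borel" "F0 \<in> borel_measurable borel"
    and bound: "\<And>k x. 0 < norm x \<Longrightarrow> norm x < b \<Longrightarrow> \<bar>F k x\<bar> \<le> C / (norm x)\<^sup>2"
    and zero: "\<And>k x. b \<le> norm x \<Longrightarrow> F k x = 0"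
    and lim: "\<And>x. x \<noteq> 0 \<Longrightarrow> (\<lambda>k. F k x) \<longlonglongrightarrow> F0 x"
  shows "integrable lborel F0" "integrable lborel (F k)" "(\<lambda>k. LINT x|lborel. F k x) \<longlonglongrightarrow> (LINT x|lborel. F0 x)"
proof -
  let ?w = "\<lambda>x::real^'n. C * (indicator {x. 0 < norm x \<and> norm x < b} x / (norm x)\<^sup>2)"
  have w: "integrable lborel ?w" using integrable_inverse_square_ball[OF n b] by (rule integrable_mult_right)
  have bd: "AE x in lborel. norm (F k x) \<le> ?w x" for k
    using AE_nonzero
  proof eventually_elim
    case (elim x)
    then show ?case using bound[of x k] zero[of x k] by (cases "norm x < b") auto
  qed
  have l: "AE x in lborel. (\<lambda>k. F k x) \<longlonglongrightarrow> F0 x"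
    using AE_nonzero by eventually_elim (rule lim)
  have m: "F0 \<in> borel_measurable lborel" "\<And>k. F k \<in> borel_measurable lborel" using meas by auto
  show "integrable lborel F0" by (rule integrable_dominated_convergence[OF m w l bd])
  show "integrable lborel (F k)" by (rule integrable_dominated_convergence2[OF m w l bd])
  show "(\<lambda>k. LINT x|lborel. F k x) \<longlonglongrightarrow> (LINT x|lborel. F0 x)" by (rule integral_dominated_convergence[OF m w l bd])
qed

subsection \<open>Cutting off near the origin\<close>

lemma DERIV_max_square: "((\<lambda>s. (max 0 s)\<^sup>2) has_real_derivative 2 * max 0 s) (at (s::real))"
proof -
  consider "s < 0" | "s = 0" | "s > 0" by linarith
  then show ?thesis
  proof cases
    case 1
    have "((\<lambda>_. 0) has_real_derivative 2 * max 0 s) (at s)" using 1 by simp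
    then show ?thesis
      by (rule has_field_derivative_transform_within_open[of _ _ _ "{..<0}"]) (use 1 in auto)
  next
    case 2
    have "((\<lambda>y. ((max 0 y)\<^sup>2 - (max 0 0)\<^sup>2) / (y - 0)) \<longlongrightarrow> 0) (at (0::real))"
    proof (rule Lim_null_comparison)
      have "\<bar>(max 0 y)\<^sup>2 / y\<bar> \<le> \<bar>y\<bar>" for y :: real by (auto simp: max_def power2_eq_square)
      then show "eventually (\<lambda>y. norm (((max 0 y)\<^sup>2 - (max 0 0)\<^sup>2) / (y - 0)) \<le> \<bar>y\<bar>) (at (0::real))"
        by simp
      show "((\<lambda>y. \<bar>y\<bar>) \<longlongrightarrow> 0) (at (0::real))" by (auto intro!: tendsto_eq_intros)
    qed
    then show ?thesis using 2 by (simp add: has_field_derivative_iff)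
  next
    case 3
    have "((\<lambda>s. s\<^sup>2) has_real_derivative 2 * max 0 s) (at s)" using 3 by (auto intro!: derivative_eq_intros)
    then show ?thesis
      by (rule has_field_derivative_transform_within_open[of _ _ _ "{0<..}"]) (use 3 in auto)
  qed
qed

text \<open>A rational C1 step in the squared positive part: zero up to t = 1, tending to 1 at
  infinity. Evaluated at k |x|^2 it removes a neighbourhood of the origin and converges to 1
  elsewhere as k grows.\<close>

definition cutoff :: "real \<Rightarrow> real" where
  "cutoff t = (max 0 (t - 1))\<^sup>2 / (1 + (max 0 (t - 1))\<^sup>2)"

definition cutoff' :: "real \<Rightarrow> real" where
  "cutoff' t = 2 * max 0 (t - 1) / (1 + (max 0 (t - 1))\<^sup>2)\<^sup>2"

lemma DERIV_cutoff: "(cutoff has_real_derivative cutoff' t) (at t)"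
proof -
  have m: "((\<lambda>t. (max 0 (t - 1))\<^sup>2) has_real_derivative 2 * max 0 (t - 1)) (at t)"
  proof -
    have "((\<lambda>t. t - 1) has_real_derivative 1) (at t)" by (auto intro!: derivative_eq_intros)
    from DERIV_chain2[OF DERIV_max_square this] show ?thesis by simp
  qed
  have nz: "1 + (max 0 (t - 1))\<^sup>2 \<noteq> 0" by (simp add: add_nonneg_eq_0_iff)
  have "((\<lambda>t. (max 0 (t - 1))\<^sup>2 / (1 + (max 0 (t - 1))\<^sup>2)) has_real_derivative
      (2 * max 0 (t - 1) * (1 + (max 0 (t - 1))\<^sup>2) - (max 0 (t - 1))\<^sup>2 * (0 + 2 * max 0 (t - 1)))
      / ((1 + (max 0 (t - 1))\<^sup>2) * (1 + (max 0 (t - 1))\<^sup>2))) (at t)"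
    by (intro DERIV_divide m DERIV_add DERIV_const nz)
  then show ?thesis
    by (simp add: cutoff_def[abs_def] cutoff'_def power2_eq_square algebra_simps)
qed

text \<open>The product t * cutoff' t is invariant under scaling, so its bound 4 gives gradients of
  order 1 / |x| uniformly in the cutoff parameter. Its decay 8 / t makes these gradients tend to 0
  at each fixed x.\<close>

lemma cutoff_bounds:
  assumes "0 < t"
  shows "0 \<le> cutoff t" "cutoff t \<le> 1" "1 - cutoff t \<le> 2 / t" "0 \<le> cutoff' t" "t * cutoff' t \<le> 4" "t * cutoff' t \<le> 8 / t"
proof -
  define m where "m = max 0 (t - 1)"
  have m: "0 \<le> m" "t \<le> 1 + m" by (auto simp: m_def)
  have p: "0 < 1 + m\<^sup>2" by (simp add: add_pos_nonneg)
  show "0 \<le> cutoff t" "cutoff t \<le> 1" "0 \<le> cutoff' t"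
    using p m by (auto simp: cutoff_def cutoff'_def m_def[symmetric] divide_le_eq)
  have q: "1 + m \<le> 2 * (1 + m\<^sup>2)" "m * (1 + m) \<le> 2 * (1 + m\<^sup>2)"
  proof -
    have "2 * m \<le> 1 + m\<^sup>2" using zero_le_power2[of "m - 1"] by (simp add: power2_diff)
    then show "1 + m \<le> 2 * (1 + m\<^sup>2)" using m(1) zero_le_power2[of m] by argo
    have "m * (1 + m) = m + m\<^sup>2" by (simp add: power2_eq_square algebra_simps)
    then show "m * (1 + m) \<le> 2 * (1 + m\<^sup>2)" using \<open>2 * m \<le> 1 + m\<^sup>2\<close> m(1) zero_le_power2[of m] by argo
  qed
  have "1 - cutoff t = 1 / (1 + m\<^sup>2)"
    using p by (simp add: cutoff_def m_def[symmetric] field_simps)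
  also have "\<dots> \<le> 2 / t" using q(1) m(2) p assms by (simp add: field_simps)
  finally show "1 - cutoff t \<le> 2 / t" .
  have c: "cutoff' t = 2 * m / (1 + m\<^sup>2)\<^sup>2" by (simp add: cutoff'_def m_def)
  have "t * cutoff' t \<le> 4 / (1 + m\<^sup>2)"
  proof -
    have "t * (2 * m) \<le> (1 + m) * (2 * m)" using m by (intro mult_right_mono) auto
    also have "\<dots> \<le> 4 * (1 + m\<^sup>2)" using q(2) by (simp add: algebra_simps)
    finally have "t * (2 * m) / (1 + m\<^sup>2)\<^sup>2 \<le> 4 * (1 + m\<^sup>2) / (1 + m\<^sup>2)\<^sup>2"
      by (intro divide_right_mono) auto
    moreover have "4 * P / P\<^sup>2 = 4 / P" for P :: real by (simp add: power2_eq_square)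
    ultimately show ?thesis by (simp only: c times_divide_eq_right)
  qed
  moreover have "4 / (1 + m\<^sup>2) \<le> 4" using p by (simp add: divide_le_eq)
  moreover have "4 / (1 + m\<^sup>2) \<le> 8 / t" using q(1) m(2) p assms by (simp add: field_simps)
  ultimately show "t * cutoff' t \<le> 4" "t * cutoff' t \<le> 8 / t" by linarith+
qed

lemma continuous_cutoff': "continuous_on UNIV cutoff'"
  unfolding cutoff'_def
  by (intro continuous_intros) (simp add: add_nonneg_eq_0_iff)

definition radial :: "(real^'n::finite \<Rightarrow> real) \<Rightarrow> bool" where
  "radial u \<longleftrightarrow> (\<forall>x y. norm x = norm y \<longrightarrow> u x = u y)"

lemma C1_ball_cutoff:
  fixes u :: "real^'n::finite \<Rightarrow> real"
  assumes "u \<in> C1_ball b"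
  obtains v where "\<And>k. v k \<in> C1_annulus b" "dominated_limit b v u" "radial u \<Longrightarrow> \<forall>k. radial (v k)"
proof -
  obtain c M where c: "0 \<le> c" "c < b" "\<And>x. c \<le> norm x \<Longrightarrow> u x = 0" "0 \<le> M" "\<And>x. \<bar>u x\<bar> \<le> M" "\<And>x. norm (grad u x) \<le> M"
    using C1_ballD[OF assms] by metis
  have u: "C1 u" using assms by (simp add: C1_ball_def)
  define \<kappa> where "\<kappa> = (\<lambda>k. real (Suc k))"
  have \<kappa>: "0 < \<kappa> k" for k by (simp add: \<kappa>_def)
  define \<psi> where "\<psi> = (\<lambda>k (x::real^'n). cutoff (\<kappa> k * (x \<bullet> x)))"
  define \<psi>' where "\<psi>' = (\<lambda>k (x::real^'n). (2 * \<kappa> k * cutoff' (\<kappa> k * (x \<bullet> x))) *\<^sub>R x)"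
  define v where "v = (\<lambda>k x. \<psi> k x * u x)"
  define g where "g = (\<lambda>k x. \<psi> k x *\<^sub>R grad u x + u x *\<^sub>R \<psi>' k x)"
  have d\<psi>: "(\<psi> k has_derivative (\<lambda>h. \<psi>' k x \<bullet> h)) (at x)" for k x
  proof -
    have 1: "((\<lambda>x. \<kappa> k * (x \<bullet> x)) has_derivative (\<lambda>h. \<kappa> k * (x \<bullet> h + h \<bullet> x))) (at x)"
      by (auto intro!: derivative_eq_intros)
    have "((\<lambda>x. cutoff (\<kappa> k * (x \<bullet> x))) has_derivative (\<lambda>h. cutoff' (\<kappa> k * (x \<bullet> x)) * (\<kappa> k * (x \<bullet> h + h \<bullet> x)))) (at x)"
      using has_derivative_compose[OF 1 DERIV_cutoff[unfolded has_field_derivative_def]] .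
    then show ?thesis by (simp add: \<psi>_def \<psi>'_def inner_commute algebra_simps)
  qed
  have dv: "(v k has_derivative (\<lambda>h. g k x \<bullet> h)) (at x)" for k x
    using has_derivative_mult[OF d\<psi> C1D(1)[OF u], of k x]
    by (simp add: v_def g_def inner_add_left algebra_simps)
  have cont_\<psi>: "continuous_on UNIV (\<psi> k)" for k
    by (intro continuous_at_imp_continuous_on ballI has_derivative_continuous[OF d\<psi>])
  have "continuous_on UNIV (\<psi>' k)" for k
    unfolding \<psi>'_def by (intro continuous_intros continuous_on_compose2[OF continuous_cutoff']) auto
  then have "continuous_on UNIV (g k)" for k
    unfolding g_def by (intro continuous_intros cont_\<psi> C1D(2)[OF u] C1_continuous[OF u])
  note gv = C1I[OF dv this]
  have an: "v k \<in> C1_annulus b" for k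
  proof -
    have "\<forall>x. norm x \<le> 1 / sqrt (\<kappa> k) \<longrightarrow> v k x = 0"
    proof (intro allI impI)
      fix x :: "real^'n" assume "norm x \<le> 1 / sqrt (\<kappa> k)"
      then have "(norm x)\<^sup>2 \<le> (1 / sqrt (\<kappa> k))\<^sup>2" by (intro power_mono) auto
      then have "\<kappa> k * (x \<bullet> x) \<le> 1" using \<kappa>[of k] by (simp add: power2_norm_eq_inner power_divide field_simps)
      then show "v k x = 0" by (simp add: v_def \<psi>_def cutoff_def)
    qed
    moreover have "v k x = 0" if "c \<le> norm x" for x using c(3)[OF that] by (simp add: v_def)
    ultimately have "v k \<in> C1_ball b"
      using gv(1)[of k] c(1,2) unfolding C1_ball_def by blast
    moreover have "0 < 1 / sqrt (\<kappa> k)" using \<kappa>[of k] by simp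
    ultimately show ?thesis
      using \<open>\<forall>x. norm x \<le> 1 / sqrt (\<kappa> k) \<longrightarrow> v k x = 0\<close> unfolding C1_annulus_def by blast
  qed
  have bd: "norm (\<psi>' k x) \<le> 8 / norm x" "norm (\<psi>' k x) \<le> 16 / (\<kappa> k * norm x ^ 3)" if "x \<noteq> 0" for k x
  proof -
    define t where "t = \<kappa> k * (x \<bullet> x)"
    have t: "0 < t" "t = \<kappa> k * (norm x)\<^sup>2" using that \<kappa>[of k] by (auto simp: t_def power2_norm_eq_inner)
    have nx: "0 < norm x" using that by simp
    have "norm (\<psi>' k x) = 2 * \<kappa> k * cutoff' t * norm x"
      using \<kappa>[of k] cutoff_bounds(4)[OF t(1)] by (simp add: \<psi>'_def t_def abs_mult)
    also have "\<dots> = 2 * (t * cutoff' t) / norm x"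
      using nx by (simp add: t(2) power2_eq_square)
    finally have e: "norm (\<psi>' k x) = 2 * (t * cutoff' t) / norm x" .
    show "norm (\<psi>' k x) \<le> 8 / norm x"
      unfolding e using cutoff_bounds(5)[OF t(1)] nx by (intro divide_right_mono) auto
    have "norm (\<psi>' k x) \<le> 2 * (8 / t) / norm x"
      unfolding e using cutoff_bounds(6)[OF t(1)] nx by (intro divide_right_mono mult_left_mono) auto
    also have "\<dots> = 16 / (\<kappa> k * norm x ^ 3)" by (simp add: t(2) power2_eq_square power3_eq_cube mult.assoc)
    finally show "norm (\<psi>' k x) \<le> 16 / (\<kappa> k * norm x ^ 3)" .
  qed
  have \<psi>b: "0 \<le> \<psi> k x" "\<psi> k x \<le> 1" "1 - \<psi> k x \<le> 2 / (\<kappa> k * (norm x)\<^sup>2)" if "x \<noteq> 0" for k x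
    using cutoff_bounds(1-3)[of "\<kappa> k * (x \<bullet> x)"] that \<kappa>[of k] by (auto simp: \<psi>_def power2_norm_eq_inner)
  have inv: "(\<lambda>k. C / (\<kappa> k * d)) \<longlonglongrightarrow> 0" for C d :: real
  proof -
    have "(\<lambda>k. (C / d) * inverse (\<kappa> k)) \<longlonglongrightarrow> (C / d) * 0"
      unfolding \<kappa>_def by (intro tendsto_mult tendsto_const LIMSEQ_inverse_real_of_nat)
    then show ?thesis by (simp add: field_simps)
  qed
  have dl: "dominated_limit b v u"
    unfolding dominated_limit_def gv(2)
  proof (intro conjI allI impI exI[of _ "8 * M"])
    fix k and x :: "real^'n" assume x: "x \<noteq> 0"
    have "\<bar>v k x\<bar> \<le> 1 * M" unfolding v_def abs_mult using \<psi>b[OF x] c(5) by (intro mult_mono) auto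
    then show "\<bar>v k x\<bar> \<le> 8 * M" using c(4) by simp
    have "norm (g k x) \<le> \<bar>\<psi> k x\<bar> * norm (grad u x) + \<bar>u x\<bar> * norm (\<psi>' k x)"
      unfolding g_def by (rule norm_triangle_le) simp
    also have "\<dots> \<le> 1 * M + M * (8 / norm x)"
      using \<psi>b[OF x] c(4-6) bd(1)[OF x] by (intro add_mono mult_mono) auto
    finally show "norm (g k x) \<le> 8 * M + 8 * M / norm x" using c(4) by (simp add: mult.commute)
  next
    show "v k \<in> C1_ball b" for k using an by (simp add: C1_annulus_def)
  next
    fix x :: "real^'n" assume x: "x \<noteq> 0"
    have "(\<lambda>k. 1 - \<psi> k x) \<longlonglongrightarrow> 0"
      by (rule Lim_null_comparison[OF _ inv[of 2 "(norm x)\<^sup>2"]]) (use \<psi>b[OF x] in \<open>auto intro!: always_eventually simp: abs_of_nonneg\<close>)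
    then have l: "(\<lambda>k. \<psi> k x) \<longlonglongrightarrow> 1" using tendsto_diff[OF tendsto_const[of 1]] by fastforce
    then show "(\<lambda>k. v k x) \<longlonglongrightarrow> u x" unfolding v_def using tendsto_mult_right[OF l, of "u x"] by simp
    have "(\<lambda>k. \<psi>' k x) \<longlonglongrightarrow> 0"
      by (rule Lim_null_comparison[OF _ inv[of 16 "norm x ^ 3"]]) (use bd(2)[OF x] in simp)
    then show "(\<lambda>k. g k x) \<longlonglongrightarrow> grad u x"
      unfolding g_def by (auto intro!: tendsto_eq_intros l)
  qed
  have rad: "\<forall>k. radial (v k)" if "radial u"
    unfolding radial_def
  proof (intro allI impI)
    fix k and x y :: "real^'n" assume xy: "norm x = norm y"
    then have "x \<bullet> x = y \<bullet> y" by (metis power2_norm_eq_inner)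
    moreover have "u x = u y" using that xy unfolding radial_def by blast
    ultimately show "v k x = v k y" by (simp add: v_def \<psi>_def)
  qed
  show ?thesis by (rule that[OF an dl rad])
qed

subsection \<open>Continuity of the functionals\<close>

definition dirichlet :: "(real^'n::finite \<Rightarrow> real) \<Rightarrow> real" where
  "dirichlet u = (LINT x|lborel. (norm (grad u x))\<^sup>2)"

definition weight :: "real \<Rightarrow> real^'n::finite \<Rightarrow> real" where
  "weight p x = norm x powr (p * (real CARD('n) - 2) / 2 - real CARD('n))"

definition Lp_term :: "real \<Rightarrow> (real^'n::finite \<Rightarrow> real) \<Rightarrow> real" where
  "Lp_term p u = (LINT x|lborel. weight p x * \<bar>u x\<bar> powr p)"

lemma Lp_term_nonneg: "0 \<le> Lp_term p u"
  unfolding Lp_term_def weight_def by (intro integral_nonneg_AE) auto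

lemma C1_ball_measurable:
  assumes "u \<in> C1_ball b"
  shows "u \<in> borel_measurable borel" "grad u \<in> borel_measurable borel"
  using assms C1_continuous C1D(2) by (auto simp: C1_ball_def intro: borel_measurable_continuous_onI)

lemma C1_ball_zero:
  assumes "u \<in> C1_ball b" "b \<le> norm x"
  shows "u x = 0" "grad u x = 0"
proof -
  obtain c where "c < b" "\<And>x. c \<le> norm x \<Longrightarrow> u x = 0" "\<And>x. c \<le> norm x \<Longrightarrow> grad u x = 0"
    using C1_ballD[OF assms(1)] by metis
  then show "u x = 0" "grad u x = 0" using assms(2) by auto
qed

lemma dominated_limitD:
  assumes "dominated_limit b v u"
  obtains M where "0 \<le> M" "\<And>k x. x \<noteq> 0 \<Longrightarrow> \<bar>v k x\<bar> \<le> M" "\<And>k x. x \<noteq> 0 \<Longrightarrow> norm (grad (v k) x) \<le> M + M / norm x"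
    "\<And>k. v k \<in> C1_ball b" "\<And>x. x \<noteq> 0 \<Longrightarrow> (\<lambda>k. v k x) \<longlonglongrightarrow> u x" "\<And>x. x \<noteq> 0 \<Longrightarrow> (\<lambda>k. grad (v k) x) \<longlonglongrightarrow> grad u x"
proof -
  obtain M where M: "\<And>k x. x \<noteq> 0 \<Longrightarrow> \<bar>v k x\<bar> \<le> M \<and> norm (grad (v k) x) \<le> M + M / norm x"
    using assms unfolding dominated_limit_def by blast
  have "(axis undefined 1 :: real^'a) \<noteq> 0" by (simp add: axis_eq_0_iff)
  then have "0 \<le> M" using M by (meson abs_ge_zero order_trans)
  then show ?thesis using that[of M] M assms unfolding dominated_limit_def by blast
qed

lemma dirichlet_limit:
  fixes u :: "real^'n::finite \<Rightarrow> real"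
  assumes n: "3 \<le> CARD('n)" and b: "0 < b" and u: "u \<in> C1_ball b" and d: "dominated_limit b v u"
  shows "(\<lambda>k. dirichlet (v k)) \<longlonglongrightarrow> dirichlet u"
proof -
  obtain M where M: "0 \<le> M" "\<And>k x. x \<noteq> 0 \<Longrightarrow> norm (grad (v k) x) \<le> M + M / norm x"
    "\<And>k. v k \<in> C1_ball b" "\<And>x. x \<noteq> 0 \<Longrightarrow> (\<lambda>k. grad (v k) x) \<longlonglongrightarrow> grad u x"
    using dominated_limitD[OF d] by metis
  note [measurable] = C1_ball_measurable[OF u] C1_ball_measurable[OF M(3)]
  show ?thesis
    unfolding dirichlet_def
  proof (rule inverse_square_dominated(3)[OF n b, where C = "(M * b + M)\<^sup>2"])
    fix k and x :: "real^'n"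
    { assume x: "0 < norm x" "norm x < b"
      have "norm (grad (v k) x) \<le> M + M / norm x" using M(2) x by auto
      also have "\<dots> = (M * norm x + M) / norm x" using x by (simp add: add_divide_distrib)
      also have "\<dots> \<le> (M * b + M) / norm x"
        using x M(1) by (intro divide_right_mono add_right_mono mult_left_mono) auto
      finally have "(norm (grad (v k) x))\<^sup>2 \<le> ((M * b + M) / norm x)\<^sup>2" by (intro power_mono) auto
      then show "\<bar>(norm (grad (v k) x))\<^sup>2\<bar> \<le> (M * b + M)\<^sup>2 / (norm x)\<^sup>2" by (simp add: power_divide) }
    show "b \<le> norm x \<Longrightarrow> (norm (grad (v k) x))\<^sup>2 = 0" using C1_ball_zero[OF M(3)] by simp
    show "x \<noteq> 0 \<Longrightarrow> (\<lambda>k. (norm (grad (v k) x))\<^sup>2) \<longlonglongrightarrow> (norm (grad u x))\<^sup>2"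
      by (intro tendsto_intros M(4))
  qed measurable
qed

lemma dirichlet_integrable:
  fixes u :: "real^'n::finite \<Rightarrow> real"
  assumes u: "u \<in> C1_ball b"
  shows "integrable lborel (\<lambda>x. (norm (grad u x))\<^sup>2)"
proof -
  obtain c where c: "\<And>x. c \<le> norm x \<Longrightarrow> grad u x = 0" using C1_ballD[OF u] by metis
  have "C1 u" using u by (simp add: C1_ball_def)
  then show ?thesis
    by (intro integrable_continuous_compact_support[where c = c] continuous_intros C1D(2)) (auto simp: c)
qed

text \<open>One statement for all zero-order terms: q is later the power weight, the logarithmic
  weight or, with s = 2, either Hardy weight.\<close>

lemma weighted_limit:
  fixes u :: "real^'n::finite \<Rightarrow> real" and q :: "real^'n \<Rightarrow> real"
  assumes n: "3 \<le> CARD('n)" and b: "0 < b" and u: "u \<in> C1_ball b" and d: "dominated_limit b v u"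
    and s: "0 < s" and q: "q \<in> borel_measurable borel" "\<And>x. 0 < norm x \<Longrightarrow> norm x < b \<Longrightarrow> \<bar>q x\<bar> \<le> C / (norm x)\<^sup>2"
  shows "integrable lborel (\<lambda>x. q x * \<bar>u x\<bar> powr s)"
    "(\<lambda>k. LINT x|lborel. q x * \<bar>v k x\<bar> powr s) \<longlonglongrightarrow> (LINT x|lborel. q x * \<bar>u x\<bar> powr s)"
proof -
  obtain M where M: "0 \<le> M" "\<And>k x. x \<noteq> 0 \<Longrightarrow> \<bar>v k x\<bar> \<le> M" "\<And>k. v k \<in> C1_ball b"
    "\<And>x. x \<noteq> 0 \<Longrightarrow> (\<lambda>k. v k x) \<longlonglongrightarrow> u x"
    using dominated_limitD[OF d] by metis
  note [measurable] = C1_ball_measurable[OF u] C1_ball_measurable[OF M(3)] q(1)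
  have m: "(\<lambda>x. q x * \<bar>v k x\<bar> powr s) \<in> borel_measurable borel" "(\<lambda>x. q x * \<bar>u x\<bar> powr s) \<in> borel_measurable borel" for k
    by measurable
  have bd: "\<bar>q x * \<bar>v k x\<bar> powr s\<bar> \<le> C * M powr s / (norm x)\<^sup>2" if x: "0 < norm x" "norm x < b" for k x
  proof -
    have "\<bar>v k x\<bar> powr s \<le> M powr s" using M(2)[of x k] x s by (intro powr_mono2) auto
    then have "\<bar>q x\<bar> * \<bar>v k x\<bar> powr s \<le> C / (norm x)\<^sup>2 * M powr s"
      using q(2)[OF x] by (intro mult_mono) auto
    then show ?thesis by (simp add: abs_mult)
  qed
  have z: "q x * \<bar>v k x\<bar> powr s = 0" if "b \<le> norm x" for k x using C1_ball_zero[OF M(3) that] by simp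
  have l: "(\<lambda>k. q x * \<bar>v k x\<bar> powr s) \<longlonglongrightarrow> q x * \<bar>u x\<bar> powr s" if "x \<noteq> 0" for x
    using s by (intro tendsto_mult tendsto_const tendsto_powr' tendsto_rabs M(4) that) auto
  show "integrable lborel (\<lambda>x. q x * \<bar>u x\<bar> powr s)"
    "(\<lambda>k. LINT x|lborel. q x * \<bar>v k x\<bar> powr s) \<longlonglongrightarrow> (LINT x|lborel. q x * \<bar>u x\<bar> powr s)"
    using inverse_square_dominated(1,3)[OF n b m bd z l] by blast+
qed

lemma dominated_limit_const:
  fixes u :: "real^'n::finite \<Rightarrow> real"
  shows "u \<in> C1_ball b \<Longrightarrow> dominated_limit b (\<lambda>_. u) u"
proof -
  assume u: "u \<in> C1_ball b"
  obtain M where M: "0 \<le> M" "\<And>x. \<bar>u x\<bar> \<le> M" "\<And>x. norm (grad u x) \<le> M" using C1_ballD[OF u] by metis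
  then have "norm (grad u x) \<le> M + M / norm x" for x by (simp add: add_increasing2)
  then show ?thesis using M u unfolding dominated_limit_def by auto
qed

section \<open>The exponent range and the best constant \<open>S_const\<close>\<close>

locale hardy_sobolev_exponent =
  fixes p :: real and ty :: "'n::finite itself"
  assumes n3: "3 \<le> CARD('n)" and p2: "2 < p" and p_le: "p \<le> 2 * real CARD('n) / (real CARD('n) - 2)"
begin

text \<open>The condition p > 2 keeps the singularity weaker than |x|^(-2), which provides the
  majorant. That p is at most the critical exponent makes the weight nonincreasing in |x| off the
  origin, as polarization requires.\<close>

lemma weight_exponent: "-2 < (p * (real CARD('n) - 2) / 2 - real CARD('n))" "(p * (real CARD('n) - 2) / 2 - real CARD('n)) \<le> 0"
proof -
  have N: "0 < real CARD('n) - 2" using n3 by simp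
  have "2 * (real CARD('n) - 2) < p * (real CARD('n) - 2)"
    using p2 N by (intro mult_strict_right_mono) auto
  then show "-2 < (p * (real CARD('n) - 2) / 2 - real CARD('n))" by simp
  show "(p * (real CARD('n) - 2) / 2 - real CARD('n)) \<le> 0" using p_le N by (simp add: field_simps)
qed

lemma weight_bound:
  assumes "0 < norm (x::real^'n)" "norm x < b"
  shows "\<bar>weight p x\<bar> \<le> (max 1 b)\<^sup>2 / (norm x)\<^sup>2"
proof -
  let ?a = "p * (real CARD('n) - 2) / 2 - real CARD('n)"
  have "weight p x = norm x powr (?a + 2) / (norm x)\<^sup>2"
    using assms(1) powr_add[of "norm x" ?a 2] powr_realpow[of "norm x" 2] by (simp add: weight_def)
  moreover have "norm x powr (?a + 2) \<le> (max 1 b) powr (?a + 2)"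
    using weight_exponent assms by (intro powr_mono2) auto
  moreover have "(max 1 b) powr (?a + 2) \<le> (max 1 b) powr 2"
    using weight_exponent by (intro powr_mono) auto
  moreover have "(max 1 b) powr 2 = (max 1 b)\<^sup>2"
    using powr_realpow[of "max 1 b" 2] by simp
  ultimately show ?thesis by (simp add: divide_right_mono)
qed

lemma weight_measurable: "(weight p :: real^'n \<Rightarrow> real) \<in> borel_measurable borel"
  unfolding weight_def[abs_def] by measurable

lemma Lp_limit:
  fixes u :: "real^'n \<Rightarrow> real"
  assumes "0 < b" "u \<in> C1_ball b" "dominated_limit b v u"
  shows "(\<lambda>k. Lp_term p (v k)) \<longlonglongrightarrow> Lp_term p u"
  unfolding Lp_term_def
  using weighted_limit(2)[OF n3 assms, of p "weight p" "(max 1 b)\<^sup>2"] weight_bound weight_measurable p2 by auto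

lemma Lp_integrable:
  fixes u :: "real^'n \<Rightarrow> real"
  assumes "0 < b" "u \<in> C1_ball b"
  shows "integrable lborel (\<lambda>x. weight p x * \<bar>u x\<bar> powr p)"
  using weighted_limit(1)[OF n3 assms dominated_limit_const[OF assms(2)], of p "weight p" "(max 1 b)\<^sup>2"]
    weight_bound weight_measurable p2 by auto

end

lemma inequality_limit:
  fixes A B :: "nat \<Rightarrow> real"
  assumes "\<And>k. C * B k powr e \<le> A k" "A \<longlonglongrightarrow> a" "B \<longlonglongrightarrow> b" "0 < e" "\<And>k. 0 \<le> B k"
  shows "C * b powr e \<le> a"
proof (rule LIMSEQ_le[OF _ assms(2)])
  show "(\<lambda>k. C * B k powr e) \<longlonglongrightarrow> C * b powr e"
    using assms by (intro tendsto_mult tendsto_const tendsto_powr') auto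
  show "\<exists>N. \<forall>n\<ge>N. C * B n powr e \<le> A n" using assms(1) by blast
qed

text \<open>Squaring the positive part gives class C1, and the inner product in place of the norm
  avoids a singularity at the origin. It serves as a test function bounding \<open>S_const\<close>
  and as the kernel of the radial mollifier.\<close>

definition rad_bump :: "real \<Rightarrow> real^'n::finite \<Rightarrow> real" where
  "rad_bump s x = (max 0 (s\<^sup>2 - x \<bullet> x))\<^sup>2"

lemma rad_bump_zero: "0 \<le> s \<Longrightarrow> s \<le> norm x \<Longrightarrow> rad_bump s x = 0"
proof -
  assume "0 \<le> s" "s \<le> norm x"
  then have "s\<^sup>2 \<le> (norm x)\<^sup>2" by (intro power_mono)
  then show ?thesis by (simp add: rad_bump_def power2_norm_eq_inner max_def)
qed

lemma radial_rad_bump: "radial (rad_bump s)"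
  unfolding radial_def rad_bump_def by (metis power2_norm_eq_inner)

lemma rad_bump_C1_ball:
  assumes "0 < s" "s < b"
  shows "(rad_bump s :: real^'n::finite \<Rightarrow> real) \<in> C1_ball b"
proof -
  let ?g = "\<lambda>x::real^'n. (- 4 * max 0 (s\<^sup>2 - x \<bullet> x)) *\<^sub>R x"
  have "(rad_bump s has_derivative (\<lambda>h. ?g x \<bullet> h)) (at x)" for x :: "real^'n"
  proof -
    have 1: "((\<lambda>x. s\<^sup>2 - x \<bullet> x) has_derivative (\<lambda>h. - (x \<bullet> h + h \<bullet> x))) (at x)"
      by (auto intro!: derivative_eq_intros)
    have "((\<lambda>x. (max 0 (s\<^sup>2 - x \<bullet> x))\<^sup>2) has_derivative (\<lambda>h. 2 * max 0 (s\<^sup>2 - x \<bullet> x) * - (x \<bullet> h + h \<bullet> x))) (at x)"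
      using has_derivative_compose[OF 1 DERIV_max_square[unfolded has_field_derivative_def]] .
    then show ?thesis by (simp add: rad_bump_def[abs_def] inner_commute algebra_simps)
  qed
  then have "C1 (rad_bump s :: real^'n \<Rightarrow> real)"
    by (rule C1I(1)) (intro continuous_intros)
  then show ?thesis using assms rad_bump_zero[of s] by (auto simp: C1_ball_def intro!: exI[of _ s])
qed

context hardy_sobolev_exponent
begin

lemma Lp_rad_bump_pos: "0 < Lp_term p (rad_bump 1 :: real^'n \<Rightarrow> real)"
proof -
  \<comment> \<open>A point inside the support but off the origin, where \<open>weight p\<close> is
    continuous and positive.\<close>
  let ?x = "(1 / 2) *\<^sub>R axis undefined 1 :: real^'n"
  have C: "(rad_bump 1 :: real^'n \<Rightarrow> real) \<in> C1_ball 2" by (rule rad_bump_C1_ball) auto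
  have nx: "norm ?x = 1 / 2" by simp
  have ux: "rad_bump 1 ?x > 0"
    using nx by (simp add: rad_bump_def inner_axis_axis)
  have "isCont (rad_bump 1) ?x"
    using C1_continuous[of "rad_bump 1 :: real^'n \<Rightarrow> real"] C by (simp add: C1_ball_def continuous_on_eq_continuous_at)
  then have "isCont (\<lambda>x. weight p x * \<bar>rad_bump 1 x\<bar> powr p) ?x"
    unfolding weight_def using ux nx by (intro continuous_intros) auto
  then show ?thesis
    unfolding Lp_term_def using Lp_integrable[OF _ C] ux nx
    by (intro integral_pos_continuous[where ?x0.0 = ?x]) (auto simp: weight_def)
qed

definition sobolev_bound :: "real \<Rightarrow> bool" where
  "sobolev_bound S \<longleftrightarrow> (\<forall>u \<in> test_functions (UNIV :: (real^'n) set). S * Lp_term p u powr (2 / p) \<le> dirichlet u)"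

lemma S_const_eq: "S_const TYPE('n) p = Sup {S. sobolev_bound S}"
  unfolding S_const_def sobolev_bound_def dirichlet_def Lp_term_def weight_def by simp

lemma sobolev_bound_C1:
  fixes u :: "real^'n \<Rightarrow> real"
  assumes "sobolev_bound S" "u \<in> C1_ball b" "0 < b"
  shows "S * Lp_term p u powr (2 / p) \<le> dirichlet u"
proof -
  obtain v where v: "\<And>k. v k \<in> test_functions (ball 0 b)" "dominated_limit b v u"
    using C1_ball_approx[OF assms(2)] by blast
  have "test_functions (ball 0 b) \<subseteq> test_functions (UNIV :: (real^'n) set)" by (auto simp: test_functions_def)
  then have "S * Lp_term p (v k) powr (2 / p) \<le> dirichlet (v k)" for k
    using assms(1) v(1) by (auto simp: sobolev_bound_def)
  then show ?thesis
  proof (rule inequality_limit)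
    show "(\<lambda>k. dirichlet (v k)) \<longlonglongrightarrow> dirichlet u" by (rule dirichlet_limit[OF n3 assms(3,2) v(2)])
    show "(\<lambda>k. Lp_term p (v k)) \<longlonglongrightarrow> Lp_term p u" by (rule Lp_limit[OF assms(3,2) v(2)])
  qed (use p2 Lp_term_nonneg in auto)
qed

text \<open>One function with positive weighted norm bounds every admissible constant by its
  quotient. Without an upper bound the real supremum in \<open>S_const\<close> would carry no
  information.\<close>

lemma bdd_sobolev_bound: "bdd_above {S. sobolev_bound S}"
proof -
  let ?u = "rad_bump 1 :: real^'n \<Rightarrow> real"
  have C: "?u \<in> C1_ball 2" by (rule rad_bump_C1_ball) auto
  have "S \<le> dirichlet ?u / Lp_term p ?u powr (2 / p)" if "sobolev_bound S" for S
    using sobolev_bound_C1[OF that C] Lp_rad_bump_pos by (simp add: pos_le_divide_eq)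
  then show ?thesis by (meson bdd_aboveI mem_Collect_eq)
qed

lemma sobolev_bound_0: "sobolev_bound 0"
  by (auto simp: sobolev_bound_def dirichlet_def intro!: integral_nonneg_AE)

lemma sobolev_bound_le_S_const: "sobolev_bound S \<Longrightarrow> S \<le> S_const TYPE('n) p"
  unfolding S_const_eq using bdd_sobolev_bound by (intro cSup_upper) auto

lemma S_const_nonneg: "0 \<le> S_const TYPE('n) p"
  using sobolev_bound_le_S_const sobolev_bound_0 by blast

text \<open>The best constant is itself admissible: for each u with positive weighted norm, every
  admissible S is at most the quotient of u, hence so is the supremum. If the weighted norm is 0,
  the claim is the one for S = 0.\<close>

lemma sobolev_bound_S_const: "sobolev_bound (S_const TYPE('n) p)"
  unfolding sobolev_bound_def
proof
  fix u :: "real^'n \<Rightarrow> real" assume u: "u \<in> test_functions UNIV"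
  show "S_const TYPE('n) p * Lp_term p u powr (2 / p) \<le> dirichlet u"
  proof (cases "Lp_term p u = 0")
    case True
    then show ?thesis using sobolev_bound_0 u by (auto simp: sobolev_bound_def)
  next
    case False
    then have L: "0 < Lp_term p u" using Lp_term_nonneg[of p u] by simp
    have "S_const TYPE('n) p \<le> dirichlet u / Lp_term p u powr (2 / p)"
      unfolding S_const_eq
    proof (rule cSup_least)
      show "{S. sobolev_bound S} \<noteq> {}" using sobolev_bound_0 by blast
      show "S \<le> dirichlet u / Lp_term p u powr (2 / p)" if "S \<in> {S. sobolev_bound S}" for S
        using that u L by (auto simp: sobolev_bound_def pos_le_divide_eq)
    qed
    then show ?thesis using L by (simp add: pos_le_divide_eq)
  qed
qed

end

subsection \<open>Integration by parts\<close>

text \<open>By translation invariance F(x + t e) - F(x) has integral 0. It differs from t (grad F x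
  \<bullet> e) by at most \<epsilon> t |e| on a fixed ball and by nothing outside it; dividing by t
  and letting \<epsilon> tend to 0 gives the claim.\<close>

lemma integral_grad_eq_0:
  fixes F :: "real^'n::finite \<Rightarrow> real"
  assumes F: "F \<in> C1_ball b"
  shows "(LINT x|lborel. grad F x \<bullet> e) = 0"
proof -
  obtain c where c: "0 \<le> c" "\<And>x. c \<le> norm x \<Longrightarrow> F x = 0" "\<And>x. c \<le> norm x \<Longrightarrow> grad F x = 0"
    using C1_ballD[OF F] by metis
  have C1: "C1 F" using F by (simp add: C1_ball_def)
  let ?B = "ball (0::real^'n) (c + norm e + 1)"
  have i1: "integrable lborel F" using C1_continuous[OF C1] c(2) by (rule integrable_continuous_compact_support)
  have i2: "integrable lborel (\<lambda>x. grad F x \<bullet> e)"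
    by (rule integrable_continuous_compact_support[where c = c]) (use C1D(2)[OF C1] c(3) in \<open>auto intro!: continuous_intros\<close>)
  have mF: "F \<in> borel_measurable borel" using C1_continuous[OF C1] by (rule borel_measurable_continuous_onI)
  have "\<bar>LINT x|lborel. grad F x \<bullet> e\<bar> \<le> \<epsilon> * norm e * measure lborel ?B" if \<epsilon>: "0 < \<epsilon>" for \<epsilon>
  proof -
    obtain d where d: "0 < d" "\<And>x h. norm h < d \<Longrightarrow> \<bar>F (x + h) - F x - grad F x \<bullet> h\<bar> \<le> \<epsilon> * norm h"
      using C1_uniformly_differentiable[OF F \<epsilon>] by blast
    define t where "t = min 1 (d / (norm e + 1)) / 2"
    have ne: "0 < norm e + 1" by (simp add: add_nonneg_pos)
    have t: "0 < t" "t \<le> 1" using d(1) ne by (auto simp: t_def)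
    have "t * norm e < d"
    proof -
      have "t \<le> (d / (norm e + 1)) / 2" unfolding t_def by (intro divide_right_mono) auto
      then have "t * norm e \<le> (d / (norm e + 1)) / 2 * norm e" by (intro mult_right_mono) auto
      also have "\<dots> = d / 2 * (norm e / (norm e + 1))" by simp
      also have "\<dots> \<le> d / 2 * 1" using d(1) ne by (intro mult_left_mono) auto
      also have "\<dots> < d" using d(1) by simp
      finally show ?thesis .
    qed
    then have th: "norm (t *\<^sub>R e) < d" using t by simp
    have i3: "integrable lborel (\<lambda>x. F (x + t *\<^sub>R e))" "(LINT x|lborel. F (x + t *\<^sub>R e)) = (LINT x|lborel. F x)"
      using integral_translate[OF mF] i1 by auto
    have "t * (LINT x|lborel. grad F x \<bullet> e) = (LINT x|lborel. t * (grad F x \<bullet> e))" by simp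
    also have "\<dots> = - (LINT x|lborel. F (x + t *\<^sub>R e) - F x - t * (grad F x \<bullet> e))"
      using i1 i2 i3 by simp
    finally have "\<bar>t * (LINT x|lborel. grad F x \<bullet> e)\<bar> \<le> norm (LINT x|lborel. F (x + t *\<^sub>R e) - F x - t * (grad F x \<bullet> e))"
      by simp
    also have "\<dots> \<le> (LINT x|lborel. norm (F (x + t *\<^sub>R e) - F x - t * (grad F x \<bullet> e)))" by (rule integral_norm_bound)
    also have "\<dots> \<le> (LINT x|lborel. (\<epsilon> * (t * norm e)) * indicator ?B x)"
    proof (rule integral_mono)
      show "integrable lborel (\<lambda>x. (\<epsilon> * (t * norm e)) * indicator ?B x)"
        using emeasure_lborel_ball_finite[of "0::real^'n"] by (intro integrable_mult_right) simp
      fix x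
      show "norm (F (x + t *\<^sub>R e) - F x - t * (grad F x \<bullet> e)) \<le> (\<epsilon> * (t * norm e)) * indicator ?B x"
      proof (cases "x \<in> ?B")
        case True
        then show ?thesis using d(2)[OF th, of x] t by simp
      next
        case False
        then have x: "c + norm e + 1 \<le> norm x" by simp
        have "norm (t *\<^sub>R e) \<le> norm e" using t by (simp add: mult_left_le_one_le)
        then have "c \<le> norm (x + t *\<^sub>R e)" using x norm_diff_ineq[of x "t *\<^sub>R e"] by linarith
        moreover have "c \<le> norm x" using x by (smt (verit) norm_ge_zero)
        ultimately show ?thesis using False c by simp
      qed
    qed (intro integrable_norm Bochner_Integration.integrable_diff i1 i2 i3 integrable_mult_right)+
    also have "\<dots> = t * (\<epsilon> * norm e * measure lborel ?B)" by simp
    finally show ?thesis using t(1) by (simp add: abs_mult)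
  qed
  then have le: "\<bar>LINT x|lborel. grad F x \<bullet> e\<bar> \<le> \<epsilon> * (norm e * measure lborel ?B)" if "0 < \<epsilon>" for \<epsilon>
    using that by (simp add: mult.assoc)
  have "\<bar>LINT x|lborel. grad F x \<bullet> e\<bar> \<le> 0"
  proof (rule field_le_epsilon)
    fix \<delta> :: real assume \<delta>: "0 < \<delta>"
    define K where "K = norm e * measure lborel ?B"
    have K: "0 \<le> K" by (simp add: K_def)
    have "\<bar>LINT x|lborel. grad F x \<bullet> e\<bar> \<le> \<delta> / (K + 1) * K"
      unfolding K_def using \<delta> K[unfolded K_def] by (intro le divide_pos_pos add_nonneg_pos) auto
    also have "\<dots> \<le> \<delta>" using \<delta> K by (simp add: divide_le_eq algebra_simps)
    finally show "\<bar>LINT x|lborel. grad F x \<bullet> e\<bar> \<le> 0 + \<delta>" by simp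
  qed
  then show ?thesis by simp
qed

text \<open>The divergence of the field G(x) x integrates to 0: each coordinate function G(x) x_i
  has a directional derivative with integral 0, and the sum over i produces the factor n.\<close>

lemma integral_divergence_radial_field:
  fixes G :: "real^'n::finite \<Rightarrow> real"
  assumes G: "G \<in> C1_ball b"
  shows "(LINT x|lborel. grad G x \<bullet> x) = - real CARD('n) * (LINT x|lborel. G x)"
    "integrable lborel (\<lambda>x. grad G x \<bullet> x)"
proof -
  obtain c where c: "0 \<le> c" "c < b" "\<And>x. c \<le> norm x \<Longrightarrow> G x = 0" "\<And>x. c \<le> norm x \<Longrightarrow> grad G x = 0"
    using C1_ballD[OF G] by metis
  have C1: "C1 G" using G by (simp add: C1_ball_def)
  have i1: "integrable lborel G" using C1_continuous[OF C1] c(3) by (rule integrable_continuous_compact_support)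
  have i2: "integrable lborel (\<lambda>x. (grad G x \<bullet> axis i 1) * x $ i)" for i
    by (rule integrable_continuous_compact_support[where c = c])
      (use C1D(2)[OF C1] c(4) in \<open>auto intro!: continuous_intros\<close>)
  have F: "(LINT x|lborel. (grad G x \<bullet> axis i 1) * x $ i) = - (LINT x|lborel. G x)" for i
  proof -
    define F where "F = (\<lambda>x. G x * x $ i)"
    let ?g = "\<lambda>x. (x $ i) *\<^sub>R grad G x + G x *\<^sub>R axis i 1"
    have d: "(F has_derivative (\<lambda>h. ?g x \<bullet> h)) (at x)" for x
    proof -
      have "((\<lambda>x. x $ i) has_derivative (\<lambda>h. h $ i)) (at x)"
        by (simp add: bounded_linear_imp_has_derivative bounded_linear_vec_nth)
      from has_derivative_mult[OF C1D(1)[OF C1] this] show ?thesis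
        by (simp add: F_def inner_add_left inner_axis' algebra_simps)
    qed
    have "continuous_on UNIV ?g" using C1D(2)[OF C1] C1_continuous[OF C1] by (intro continuous_intros)
    note CF = C1I[OF d this]
    have "F \<in> C1_ball b" using CF(1) c(1-3) by (auto simp: C1_ball_def F_def)
    then have "(LINT x|lborel. grad F x \<bullet> axis i 1) = 0" by (rule integral_grad_eq_0)
    moreover have "grad F x \<bullet> axis i 1 = (grad G x \<bullet> axis i 1) * x $ i + G x" for x
      unfolding CF(2) by (simp add: inner_add_left inner_axis_axis)
    ultimately show ?thesis using i1 i2[of i] by simp
  qed
  have eq: "grad G x \<bullet> x = (\<Sum>i\<in>UNIV. (grad G x \<bullet> axis i 1) * x $ i)" for x
    by (simp add: inner_vec_def[of "grad G x" x] flip: cart_eq_inner_axis)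
  show "integrable lborel (\<lambda>x. grad G x \<bullet> x)" unfolding eq using i2 by simp
  show "(LINT x|lborel. grad G x \<bullet> x) = - real CARD('n) * (LINT x|lborel. G x)"
    unfolding eq using i2 F by simp
qed

subsection \<open>Functions supported in an annulus\<close>

text \<open>A ball around the origin, the punctured ball of radius b and the exterior of a smaller
  ball are open and cover the space, so regularity can be checked on each of them.\<close>

lemma C1_annulusI:
  fixes u :: "real^'n::finite \<Rightarrow> real"
  assumes a: "0 < a" "\<And>x. norm x \<le> a \<Longrightarrow> u x = 0" and c: "c < b" "\<And>x. c \<le> norm x \<Longrightarrow> u x = 0"
    and d: "\<And>x. 0 < norm x \<Longrightarrow> norm x < b \<Longrightarrow> (u has_derivative (\<lambda>h. g x \<bullet> h)) (at x)"
    and g: "continuous_on {x. 0 < norm x \<and> norm x < b} g" and b: "0 < b"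
  shows "u \<in> C1_annulus b" "0 < norm x \<Longrightarrow> norm x < b \<Longrightarrow> grad u x = g x"
proof -
  show gr: "grad u x = g x" if "0 < norm x" "norm x < b" for x using d[OF that] by (rule grad_eqI)
  define O1 where "O1 = {x::real^'n. 0 < norm x \<and> norm x < b}"
  define O2 where "O2 = {x::real^'n. norm x < a}"
  define O3 where "O3 = {x::real^'n. c < norm x}"
  have op: "open O1" "open O2" "open O3"
    unfolding O1_def O2_def O3_def by (intro open_Collect_conj open_Collect_less continuous_intros)+
  have un: "O1 \<union> (O2 \<union> O3) = UNIV"
    using a(1) c(1) by (auto simp: O1_def O2_def O3_def)
  have z: "u y = 0" if "y \<in> O2 \<union> O3" for y
    using that a(2)[of y] c(2)[of y] by (auto simp: O2_def O3_def)
  have gz: "grad u x = 0" if "x \<in> O2 \<union> O3" for x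
    by (rule grad_eq_0[OF _ that z]) (use op in auto)
  have dz: "u differentiable (at x)" if "x \<in> O2 \<union> O3" for x
  proof -
    have "((\<lambda>_. 0) has_derivative (\<lambda>_. 0)) (at x)" by simp
    then have "(u has_derivative (\<lambda>_. 0)) (at x)"
      by (rule has_derivative_transform_within_open[of _ _ _ _ "O2 \<union> O3"]) (use op that z in auto)
    then show ?thesis by (auto simp: differentiable_def)
  qed
  have "u differentiable (at x)" for x
    using dz[of x] d[of x] un by (auto simp: O1_def differentiable_def)
  moreover have "continuous_on (O1 \<union> (O2 \<union> O3)) (grad u)"
  proof (rule continuous_on_open_Un)
    show "continuous_on O1 (grad u)"
      using g by (rule continuous_on_cong[THEN iffD1, rotated -1]) (auto simp: O1_def gr)
    show "continuous_on (O2 \<union> O3) (grad u)"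
      by (rule continuous_on_cong[THEN iffD1, of _ _ "\<lambda>_. 0"]) (auto simp: gz)
  qed (use op in auto)
  ultimately have "C1 u" by (simp add: C1_def un)
  moreover have "\<exists>c\<ge>0. c < b \<and> (\<forall>x. c \<le> norm x \<longrightarrow> u x = 0)"
    using c b by (intro exI[of _ "max c 0"]) auto
  ultimately show "u \<in> C1_annulus b" using a unfolding C1_annulus_def C1_ball_def by blast
qed

lemma C1_annulusD:
  fixes u :: "real^'n::finite \<Rightarrow> real"
  assumes "u \<in> C1_annulus b"
  obtains a c where "0 < a" "\<And>x. norm x \<le> a \<Longrightarrow> u x = 0" "0 \<le> c" "c < b" "\<And>x. c \<le> norm x \<Longrightarrow> u x = 0" "C1 u"
  using assms unfolding C1_annulus_def C1_ball_def by blast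

lemma C1_annulus_radial_mult:
  fixes u :: "real^'n::finite \<Rightarrow> real"
  assumes u: "u \<in> C1_annulus b" and b: "0 < b"
    and m: "\<And>r. 0 < r \<Longrightarrow> r < b \<Longrightarrow> (m has_real_derivative m' r) (at r)" and m': "continuous_on {0<..<b} m'"
  shows "(\<lambda>x. m (norm x) * u x) \<in> C1_annulus b"
    "0 < norm x \<Longrightarrow> norm x < b \<Longrightarrow> grad (\<lambda>x. m (norm x) * u x) x
      = m (norm x) *\<^sub>R grad u x + (u x * m' (norm x) / norm x) *\<^sub>R x"
proof -
  obtain a c where a: "0 < a" "\<And>x. norm x \<le> a \<Longrightarrow> u x = 0" and c: "c < b" "\<And>x. c \<le> norm x \<Longrightarrow> u x = 0" and C1: "C1 u"
    using C1_annulusD[OF u] by metis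
  let ?g = "\<lambda>x. m (norm x) *\<^sub>R grad u x + (u x * m' (norm x) / norm x) *\<^sub>R x"
  have d: "((\<lambda>x. m (norm x) * u x) has_derivative (\<lambda>h. ?g x \<bullet> h)) (at x)" if "0 < norm x" "norm x < b" for x
  proof -
    have "(norm has_derivative (\<lambda>h. (x \<bullet> h) / norm x)) (at x)"
      using has_derivative_norm[of x] that by (simp add: sgn_div_norm inner_commute divide_inverse mult.commute)
    from has_derivative_compose[OF this m[OF that, unfolded has_field_derivative_def]]
    have "((\<lambda>x. m (norm x)) has_derivative (\<lambda>h. m' (norm x) * ((x \<bullet> h) / norm x))) (at x)" .
    from has_derivative_mult[OF this C1D(1)[OF C1]] show ?thesis
      by (simp add: inner_add_left algebra_simps)
  qed
  have cm: "continuous_on {0<..<b} m"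
    using m by (intro continuous_at_imp_continuous_on ballI) (auto intro: DERIV_isCont)
  have g: "continuous_on {x. 0 < norm x \<and> norm x < b} ?g"
    by (intro continuous_intros continuous_on_compose2[OF cm] continuous_on_compose2[OF m']
        continuous_on_subset[OF C1D(2)[OF C1]] continuous_on_subset[OF C1_continuous[OF C1]]) auto
  show "(\<lambda>x. m (norm x) * u x) \<in> C1_annulus b"
    by (rule C1_annulusI(1)[OF a(1) _ c(1) _ d g b]) (use a c in auto)
  show "grad (\<lambda>x. m (norm x) * u x) x = ?g x" if "0 < norm x" "norm x < b"
    by (rule grad_eqI[OF d[OF that]])
qed

text \<open>The profile f is controlled only on (0, b), so the composite is extended by
  zero.\<close>

definition annulus_pullback :: "real \<Rightarrow> (real \<Rightarrow> real) \<Rightarrow> (real^'n::finite \<Rightarrow> real) \<Rightarrow> real^'n \<Rightarrow> real" where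
  "annulus_pullback b f u x = (if 0 < norm x \<and> norm x < b then u (radial_map f x) else 0)"

text \<open>The derivative of a radial map is self-adjoint, so the new gradient is this derivative
  applied to grad u. Monotonicity and surjectivity of f keep the support away from the origin and
  from the outer sphere.\<close>

lemma C1_annulus_pullback:
  fixes u :: "real^'n::finite \<Rightarrow> real"
  assumes u: "u \<in> C1_annulus b'" and b: "0 < b" "0 < b'"
    and f: "\<And>r. 0 < r \<Longrightarrow> r < b \<Longrightarrow> (f has_real_derivative f' r) (at r)" "continuous_on {0<..<b} f'"
    and pos: "\<And>r. 0 < r \<Longrightarrow> r < b \<Longrightarrow> 0 < f r"
    and mono: "\<And>r s. 0 < r \<Longrightarrow> r \<le> s \<Longrightarrow> s < b \<Longrightarrow> f r \<le> f s"
    and surj: "\<And>s. 0 < s \<Longrightarrow> s < b' \<Longrightarrow> \<exists>r. 0 < r \<and> r < b \<and> f r = s"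
  shows "annulus_pullback b f u \<in> C1_annulus b"
    "0 < norm x \<Longrightarrow> norm x < b \<Longrightarrow> grad (annulus_pullback b f u) x =
      (f (norm x) / norm x) *\<^sub>R grad u (radial_map f x) +
      ((f' (norm x) - f (norm x) / norm x) * (x \<bullet> grad u (radial_map f x)) / (norm x)\<^sup>2) *\<^sub>R x"
proof -
  obtain a c where a: "0 < a" "\<And>x. norm x \<le> a \<Longrightarrow> u x = 0" and c: "0 \<le> c" "c < b'" "\<And>x. c \<le> norm x \<Longrightarrow> u x = 0" and C1: "C1 u"
    using C1_annulusD[OF u] by metis
  let ?g = "\<lambda>x. (f (norm x) / norm x) *\<^sub>R grad u (radial_map f x) +
      ((f' (norm x) - f (norm x) / norm x) * (x \<bullet> grad u (radial_map f x)) / (norm x)\<^sup>2) *\<^sub>R x"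
  let ?v = "annulus_pullback b f u"
  let ?O = "{x::real^'n. 0 < norm x \<and> norm x < b}"
  have op: "open ?O" by (intro open_Collect_conj open_Collect_less continuous_intros)
  have d: "(?v has_derivative (\<lambda>h. ?g x \<bullet> h)) (at x)" if x: "0 < norm x" "norm x < b" for x
  proof -
    have rm: "(radial_map f has_derivative (\<lambda>h. (f (norm x) / norm x) *\<^sub>R h +
        ((f' (norm x) - f (norm x) / norm x) * ((x /\<^sub>R norm x) \<bullet> h)) *\<^sub>R (x /\<^sub>R norm x))) (at x)"
      using x f(1)[OF x] by (intro has_derivative_radial_map) auto
    have "((\<lambda>x. u (radial_map f x)) has_derivative (\<lambda>h. ?g x \<bullet> h)) (at x)"
    proof -
      have "grad u (radial_map f x) \<bullet> ((f (norm x) / norm x) *\<^sub>R h +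
          ((f' (norm x) - f (norm x) / norm x) * ((x /\<^sub>R norm x) \<bullet> h)) *\<^sub>R (x /\<^sub>R norm x)) = ?g x \<bullet> h" for h
        by (simp add: inner_add_left inner_add_right inner_commute power2_eq_square divide_inverse mult_ac)
      then show ?thesis using has_derivative_compose[OF rm C1D(1)[OF C1]] by simp
    qed
    then show ?thesis
      by (rule has_derivative_transform_within_open[OF _ op]) (use x in \<open>auto simp: annulus_pullback_def\<close>)
  qed
  have cf: "continuous_on {0<..<b} f"
    using f(1) by (intro continuous_at_imp_continuous_on ballI) (auto intro: DERIV_isCont)
  have crm: "continuous_on ?O (radial_map f)"
    unfolding radial_map_def by (intro continuous_intros continuous_on_compose2[OF cf]) auto
  have cg: "continuous_on ?O ?g"
    by (intro continuous_intros continuous_on_compose2[OF cf] continuous_on_compose2[OF f(2)]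
        continuous_on_compose2[OF C1D(2)[OF C1] crm]) auto
  have nr: "norm (radial_map f x) = f (norm x)" if "0 < norm x" "norm x < b" for x :: "real^'n"
    using norm_radial_map[of x f] pos[OF that] that by simp
  have "0 < min a (b' / 2)" "min a (b' / 2) < b'" using a(1) b(2) by auto
  then obtain r where r: "0 < r" "r < b" "f r \<le> a"
    using surj[of "min a (b' / 2)"] by (metis min.cobounded1)
  have z1: "?v x = 0" if "norm x \<le> r" for x
    using a(2)[of "radial_map f x"] mono[of "norm x" r] r that nr[of x] by (auto simp: annulus_pullback_def)
  obtain s where s: "0 < s" "s < b" "f s = (c + b') / 2"
    using surj[of "(c + b') / 2"] c b(2) by auto
  have z2: "?v x = 0" if "s \<le> norm x" for x
    using c(2) c(3)[of "radial_map f x"] mono[of s "norm x"] s that nr[of x] by (auto simp: annulus_pullback_def)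
  show "?v \<in> C1_annulus b" by (rule C1_annulusI(1)[OF r(1) z1 s(2) z2 d cg b(1)])
  show "grad ?v x = ?g x" if "0 < norm x" "norm x < b" by (rule grad_eqI[OF d[OF that]])
qed

subsection \<open>The one-dimensional profile\<close>

locale profile =
  fixes N \<theta> A :: real
  assumes N: "1 \<le> N" and \<theta>: "0 < \<theta>" and A: "A = 1 + 1 / sqrt N"
begin

definition "g r = A - r powr \<theta>"
text \<open>An antiderivative of \<open>Q'\<close>, the integrand in the definition of
  \<open>\<alpha>\<^sub>0\<close>. Since \<open>0 powr \<theta> = 0\<close>, the value Q 0 is the
  limit at the origin.\<close>

definition "Q r = A / (\<theta> * g r) - ln (g r) / \<theta>"
definition "Q' r = r powr (\<theta> - 1) * (2 * A - r powr \<theta>) / (A - r powr \<theta>)\<^sup>2"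
text \<open>The integrated equation for \<rho>: H' = - 1 / (r g^2), so \<rho>^(-N) = N H. The
  constant of integration is chosen so that H 1 = 1.\<close>

definition "H r = 1 + (Q 1 - Q r - ln r) / A\<^sup>2"
definition "\<rho> r = (N * H r) powr (- 1 / N)"
definition "\<rho>' r = \<rho> r powr (N + 1) / (r * (g r)\<^sup>2)"
definition "\<rho>\<^sub>1 = N powr (- 1 / N)"

lemma A_gt: "1 < A" "0 < A - 1" "(A - 1)\<^sup>2 = 1 / N"
  using N by (auto simp: A power_divide)

lemma powr_\<theta>: "0 \<le> r \<Longrightarrow> r \<le> 1 \<Longrightarrow> r powr \<theta> \<le> 1"
  using \<theta> powr_mono2[of \<theta> r 1] by simp

lemma g_bounds: "0 \<le> r \<Longrightarrow> r \<le> 1 \<Longrightarrow> A - 1 \<le> g r" "g r \<le> A" "0 \<le> r \<Longrightarrow> r \<le> 1 \<Longrightarrow> 0 < g r"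
  using powr_\<theta>[of r] A_gt by (auto simp: g_def)

lemma DERIV_g: "0 < r \<Longrightarrow> (g has_real_derivative - (\<theta> * r powr (\<theta> - 1))) (at r)"
  unfolding g_def by (auto intro!: derivative_eq_intros)

lemma DERIV_Q:
  assumes "0 < r" "r \<le> 1"
  shows "(Q has_real_derivative Q' r) (at r)"
proof -
  define G where "G = g r"
  have G: "0 < G" "r powr \<theta> = A - G" using g_bounds(3)[of r] assms by (auto simp: G_def g_def)
  define D where "D = - (\<theta> * r powr (\<theta> - 1))"
  have d: "(g has_real_derivative D) (at r)" using DERIV_g assms by (simp add: D_def)
  have "((\<lambda>G. A / (\<theta> * G) - ln G / \<theta>) has_real_derivative - (A / (\<theta> * G\<^sup>2)) - 1 / (\<theta> * G)) (at (g r))"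
    unfolding G_def[symmetric] using G(1) \<theta>
    by (auto intro!: derivative_eq_intros simp: power2_eq_square field_simps)
  from DERIV_chain2[OF this d]
  have "(Q has_real_derivative (- (A / (\<theta> * G\<^sup>2)) - 1 / (\<theta> * G)) * D) (at r)"
    unfolding Q_def[abs_def] .
  moreover have "(- (A / (\<theta> * G\<^sup>2)) - 1 / (\<theta> * G)) * D = Q' r"
    using G(1) \<theta> unfolding Q'_def G(2) D_def
    by (simp add: field_simps power2_eq_square)
  ultimately show ?thesis by simp
qed

lemma Q'_nonneg: "0 < r \<Longrightarrow> r \<le> 1 \<Longrightarrow> 0 \<le> Q' r"
  unfolding Q'_def using powr_\<theta>[of r] A_gt by (intro divide_nonneg_nonneg mult_nonneg_nonneg) auto

lemma Q_ge_Q0: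
  assumes "0 \<le> r" "r \<le> 1"
  shows "Q 0 \<le> Q r"
proof -
  have "A / (\<theta> * A) \<le> A / (\<theta> * g r)"
    using g_bounds[of r] assms \<theta> A_gt by (intro divide_left_mono) auto
  moreover have "ln (g r) / \<theta> \<le> ln A / \<theta>"
    using g_bounds[of r] assms \<theta> A_gt by (intro divide_right_mono) auto
  ultimately show ?thesis by (simp add: Q_def g_def)
qed

lemma Q_le_Q1:
  assumes "0 < r" "r \<le> 1"
  shows "Q r \<le> Q 1"
  using assms by (intro DERIV_nonneg_imp_nondecreasing[of r 1 Q]) (meson DERIV_Q Q'_nonneg less_le_trans)+

lemma g_tendsto_0: "(g \<longlongrightarrow> g 0) (at_right 0)"
proof -
  have "((\<lambda>r. r powr \<theta>) \<longlongrightarrow> 0 powr \<theta>) (at_right (0::real))"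
    using \<theta> by (intro tendsto_powr') (auto simp: eventually_at_filter)
  then show ?thesis unfolding g_def by (intro tendsto_diff tendsto_const)
qed

lemma Q_tendsto_0: "(Q \<longlongrightarrow> Q 0) (at_right 0)"
  unfolding Q_def using g_bounds(3)[of 0] \<theta> by (intro tendsto_intros g_tendsto_0) auto

text \<open>For \<theta> < 1 the integrand blows up at 0, so the fundamental theorem is used on the
  open interval with one-sided limits of Q; nonnegativity of \<open>Q'\<close> takes the place of an
  integrability check.\<close>

lemma integral_Q': "(LINT s:{0<..<1}|lborel. Q' s) = Q 1 - Q 0"
proof -
  have 1: "isCont Q' s" if "0 < s" "s < 1" for s
    unfolding Q'_def using that g_bounds(3)[of s] by (intro continuous_intros) (auto simp: g_def)
  have "(LBINT s=0..1. Q' s) = Q 1 - Q 0"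
  proof (rule interval_integral_FTC_nonneg(2))
    show "(Q has_real_derivative Q' s) (at s)" if "0 < ereal s" "ereal s < 1" for s
      using DERIV_Q[of s] that by simp
    show "isCont Q' s" if "0 < ereal s" "ereal s < 1" for s using 1[of s] that by simp
    show "AE s in lborel. 0 < ereal s \<longrightarrow> ereal s < 1 \<longrightarrow> 0 \<le> Q' s"
      using Q'_nonneg by auto
    show "((Q \<circ> real_of_ereal) \<longlongrightarrow> Q 0) (at_right 0)"
      unfolding zero_ereal_def ereal_tendsto_simps by (rule Q_tendsto_0)
    have "isCont Q 1" using DERIV_Q[of 1] DERIV_isCont by simp
    then have "(Q \<longlongrightarrow> Q 1) (at_left 1)" using isCont_def filterlim_at_split by blast
    then show "((Q \<circ> real_of_ereal) \<longlongrightarrow> Q 1) (at_left 1)"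
      unfolding one_ereal_def ereal_tendsto_simps .
  qed simp
  moreover have "einterval 0 1 = {0<..<1}" by (auto simp: einterval_def)
  ultimately show ?thesis by (simp add: interval_lebesgue_integral_def)
qed

text \<open>With G = g r the integrand \<open>Q' r\<close> is (A - G) (A + G) / (r G^2). Adding 1 /
  r completes the difference of squares to A^2 / (r G^2), which explains the divisor A^2 in
  \<open>H\<close>.\<close>

lemma DERIV_H:
  assumes "0 < r" "r \<le> 1"
  shows "(H has_real_derivative - (1 / (r * (g r)\<^sup>2))) (at r)"
proof -
  define G where "G = g r"
  have G: "0 < G" "r powr \<theta> = A - G" using g_bounds(3)[of r] assms by (auto simp: G_def g_def)
  have "(H has_real_derivative 0 + (0 - Q' r - inverse r) / A\<^sup>2) (at r)"
    unfolding H_def[abs_def]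
    by (intro DERIV_add DERIV_const DERIV_cdivide DERIV_diff DERIV_Q DERIV_ln assms)
  moreover have "0 + (0 - Q' r - inverse r) / A\<^sup>2 = - (1 / (r * (g r)\<^sup>2))"
  proof -
    have "Q' r = (A - G) * (A + G) / (r * G\<^sup>2)"
      using assms G by (simp add: Q'_def powr_diff divide_simps)
    moreover have "inverse r = G\<^sup>2 / (r * G\<^sup>2)" using assms G(1) by (simp add: divide_simps)
    ultimately have "Q' r + inverse r = ((A - G) * (A + G) + G\<^sup>2) / (r * G\<^sup>2)" by (simp only: add_divide_distrib)
    also have "(A - G) * (A + G) + G\<^sup>2 = A\<^sup>2" by (simp add: power2_eq_square algebra_simps)
    finally have "Q' r + inverse r = A\<^sup>2 / (r * G\<^sup>2)" .
    moreover have "0 + (0 - Q' r - inverse r) / A\<^sup>2 = - (Q' r + inverse r) / A\<^sup>2" by simp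
    ultimately show ?thesis using A_gt by (simp add: G_def)
  qed
  ultimately show ?thesis by simp
qed

lemma H_1: "H 1 = 1" by (simp add: H_def)

lemma H_strict_antimono:
  assumes "0 < r" "r < s" "s \<le> 1"
  shows "H s < H r"
proof (rule DERIV_neg_imp_decreasing[OF assms(2)])
  fix t assume "r \<le> t" "t \<le> s"
  then have t: "0 < t" "t \<le> 1" using assms by auto
  then have "0 < t * (g t)\<^sup>2" using g_bounds(3)[of t] by simp
  then show "\<exists>y. DERIV H t :> y \<and> y < 0" using DERIV_H[OF t] by (intro exI conjI) auto
qed

lemma H_ge_1: "0 < r \<Longrightarrow> r \<le> 1 \<Longrightarrow> 1 \<le> H r"
  using H_strict_antimono[of r 1] H_1 by (cases "r = 1") auto

lemma H_lower: "0 < r \<Longrightarrow> r \<le> 1 \<Longrightarrow> - ln r / A\<^sup>2 \<le> H r"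
  unfolding H_def using Q_le_Q1[of r] divide_right_mono[of "- ln r" "Q 1 - Q r - ln r" "A\<^sup>2"] by simp

text \<open>H and g both decrease in r, and at r = 1 they equal 1 and A - 1. The relation N (A -
  1)^2 = 1, which defines A, makes this an equality there.\<close>

lemma N_H_g: "0 < r \<Longrightarrow> r \<le> 1 \<Longrightarrow> 1 \<le> N * H r * (g r)\<^sup>2"
proof -
  assume r: "0 < r" "r \<le> 1"
  have "1 / N \<le> (g r)\<^sup>2"
    unfolding A_gt(3)[symmetric] using g_bounds(1)[of r] r A_gt by (intro power_mono) auto
  then have "1 \<le> N * (g r)\<^sup>2" using N by (simp add: field_simps)
  also have "\<dots> = N * 1 * (g r)\<^sup>2" by simp
  also have "\<dots> \<le> N * H r * (g r)\<^sup>2" using H_ge_1[OF r] N by (intro mult_right_mono mult_left_mono) auto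
  finally show ?thesis .
qed

lemma \<rho>_pos: "0 < r \<Longrightarrow> r \<le> 1 \<Longrightarrow> 0 < \<rho> r"
  using H_ge_1[of r] N by (simp add: \<rho>_def)

lemma \<rho>_powr_N: "0 < r \<Longrightarrow> r \<le> 1 \<Longrightarrow> \<rho> r powr N = 1 / (N * H r)"
proof -
  assume "0 < r" "r \<le> 1"
  then have "0 < N * H r" using H_ge_1[of r] N by simp
  moreover have "- 1 / N * N = - 1" using N by simp
  ultimately show ?thesis unfolding \<rho>_def powr_powr by (simp add: powr_minus_divide)
qed

lemma DERIV_\<rho>:
  assumes "0 < r" "r \<le> 1"
  shows "(\<rho> has_real_derivative \<rho>' r) (at r)"
proof -
  have h: "0 < N * H r" using H_ge_1[OF assms] N by simp
  have "((\<lambda>r. N * H r) has_real_derivative N * - (1 / (r * (g r)\<^sup>2))) (at r)"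
    by (intro DERIV_cmult DERIV_H assms)
  from DERIV_chain2[OF has_real_derivative_powr[OF h] this]
  have "(\<rho> has_real_derivative (- 1 / N) * (N * H r) powr (- 1 / N - 1) * (N * - (1 / (r * (g r)\<^sup>2)))) (at r)"
    unfolding \<rho>_def[abs_def] .
  moreover have "\<rho> r powr (N + 1) = (N * H r) powr (- 1 / N - 1)"
  proof -
    have "(- 1 / N) * (N + 1) = - 1 / N - 1" using N by (simp add: field_simps)
    then show ?thesis by (simp add: \<rho>_def powr_powr)
  qed
  ultimately show ?thesis using N by (simp add: \<rho>'_def)
qed

lemma \<rho>'_pos: "0 < r \<Longrightarrow> r \<le> 1 \<Longrightarrow> 0 < \<rho>' r"
  using \<rho>_pos[of r] g_bounds(3)[of r] by (simp add: \<rho>'_def)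

text \<open>The quotient of the two sides is 1 / (N H g^2), which \<open>N_H_g\<close> bounds by 1.
  This is the sign condition on the tangential part of the transformed energy.\<close>

lemma \<rho>'_le:
  assumes "0 < r" "r \<le> 1"
  shows "\<rho>' r \<le> \<rho> r / r"
proof -
  have "\<rho> r powr N \<le> (g r)\<^sup>2"
    unfolding \<rho>_powr_N[OF assms] using N_H_g[OF assms] H_ge_1[OF assms] N by (simp add: divide_le_eq mult.commute)
  then have "\<rho> r * \<rho> r powr N / (r * (g r)\<^sup>2) \<le> \<rho> r * (g r)\<^sup>2 / (r * (g r)\<^sup>2)"
    using assms \<rho>_pos[OF assms] by (intro divide_right_mono mult_left_mono) auto
  then show ?thesis
    using g_bounds(3)[of r] assms \<rho>_pos[OF assms] by (simp add: \<rho>'_def powr_add mult.commute)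
qed

lemma \<rho>_strict_mono:
  assumes "0 < r" "r < s" "s \<le> 1"
  shows "\<rho> r < \<rho> s"
proof (rule DERIV_pos_imp_increasing[OF assms(2)])
  fix t assume "r \<le> t" "t \<le> s"
  then have t: "0 < t" "t \<le> 1" using assms by auto
  then show "\<exists>y. DERIV \<rho> t :> y \<and> 0 < y" using DERIV_\<rho>[OF t] \<rho>'_pos[OF t] by blast
qed

lemma \<rho>_1: "\<rho> 1 = \<rho>\<^sub>1" by (simp add: \<rho>_def \<rho>\<^sub>1_def H_1)

lemma \<rho>\<^sub>1_pos: "0 < \<rho>\<^sub>1" using N by (simp add: \<rho>\<^sub>1_def)

lemma \<rho>_less: "0 < r \<Longrightarrow> r < 1 \<Longrightarrow> \<rho> r < \<rho>\<^sub>1"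
  using \<rho>_strict_mono[of r 1] \<rho>_1 by simp

lemma isCont_\<rho>: "0 < r \<Longrightarrow> r \<le> 1 \<Longrightarrow> isCont \<rho> r"
  using DERIV_\<rho> DERIV_isCont by blast

lemma \<rho>_small:
  assumes "0 < y"
  obtains r where "0 < r" "r < 1" "\<rho> r < y"
proof -
  define h where "h = max 1 (y powr (- N) / N + 1)"
  \<comment> \<open>At this r the estimate \<open>H_lower\<close> reads h \<le> H r, and h was taken
    larger than y^(-N) / N; h \<ge> 1 keeps r below 1.\<close>
  define r where "r = exp (- (A\<^sup>2 * h))"
  have Ah: "0 < A\<^sup>2 * h" using A_gt by (simp add: h_def)
  have r: "0 < r" "r < 1" using Ah by (auto simp: r_def)
  have "y powr (- N) / N < h" by (simp add: h_def)
  also have "h \<le> H r" using H_lower[of r] r A_gt by (simp add: r_def)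
  finally have *: "y powr (- N) < N * H r" using N by (simp add: divide_less_eq mult.commute)
  have "\<rho> r < (y powr (- N)) powr (- 1 / N)"
    unfolding \<rho>_def using * N assms by (intro powr_less_mono2_neg) auto
  then show ?thesis using that r N assms by (simp add: powr_powr)
qed

lemma \<rho>_surj:
  assumes "0 < y" "y < \<rho>\<^sub>1"
  obtains r where "0 < r" "r < 1" "\<rho> r = y"
proof -
  obtain r0 where r0: "0 < r0" "r0 < 1" "\<rho> r0 < y" using \<rho>_small[OF assms(1)] .
  have "\<exists>r\<ge>r0. r \<le> 1 \<and> \<rho> r = y"
    using IVT[of \<rho> r0 y 1] r0 assms(2) isCont_\<rho> \<rho>_1 by auto
  then obtain r where r: "r0 \<le> r" "r \<le> 1" "\<rho> r = y" by blast
  moreover have "r \<noteq> 1" using r(3) assms(2) \<rho>_1 by auto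
  ultimately show ?thesis using that[of r] r0 by simp
qed

definition "\<tau> = inv_into {0<..<1} \<rho>"

lemma inj_\<rho>: "inj_on \<rho> {0<..<1}"
proof (rule inj_onI)
  fix r s assume "r \<in> {0<..<1}" "s \<in> {0<..<1}" "\<rho> r = \<rho> s"
  then show "r = s" using \<rho>_strict_mono[of r s] \<rho>_strict_mono[of s r] by (cases r s rule: linorder_cases) auto
qed

lemma \<tau>:
  assumes "0 < y" "y < \<rho>\<^sub>1"
  shows "0 < \<tau> y" "\<tau> y < 1" "\<rho> (\<tau> y) = y"
proof -
  have "y \<in> \<rho> ` {0<..<1}" using \<rho>_surj[OF assms] by (metis greaterThanLessThan_iff image_eqI)
  then show "0 < \<tau> y" "\<tau> y < 1" "\<rho> (\<tau> y) = y"
    using inv_into_into[of y \<rho> "{0<..<1}"] f_inv_into_f[of y \<rho> "{0<..<1}"] by (auto simp: \<tau>_def)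
qed

lemma \<tau>_\<rho>: "0 < r \<Longrightarrow> r < 1 \<Longrightarrow> \<tau> (\<rho> r) = r"
  unfolding \<tau>_def by (rule inv_into_f_f[OF inj_\<rho>]) auto

lemma isCont_\<tau>:
  assumes "0 < y" "y < \<rho>\<^sub>1"
  shows "isCont \<tau> y"
proof -
  have "isCont \<tau> (\<rho> (\<tau> y))"
  proof (rule isCont_inverse_function2[where f = \<rho> and g = \<tau> and x = "\<tau> y" and a = "\<tau> y / 2" and b = "(\<tau> y + 1) / 2"])
    fix z assume z: "\<tau> y / 2 \<le> z" "z \<le> (\<tau> y + 1) / 2"
    then have "0 < z" "z < 1" using \<tau>[OF assms] by auto
    then show "\<tau> (\<rho> z) = z" "isCont \<rho> z" using \<tau>_\<rho> isCont_\<rho> by auto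
  qed (use \<tau>[OF assms] in auto)
  then show ?thesis using \<tau>(3)[OF assms] by simp
qed

lemma DERIV_\<tau>:
  assumes "0 < y" "y < \<rho>\<^sub>1"
  shows "(\<tau> has_real_derivative inverse (\<rho>' (\<tau> y))) (at y)"
proof (rule DERIV_inverse_function[of \<rho>])
  show "DERIV \<rho> (\<tau> y) :> \<rho>' (\<tau> y)" using DERIV_\<rho> \<tau>[OF assms] by simp
  show "\<rho>' (\<tau> y) \<noteq> 0" using \<rho>'_pos[of "\<tau> y"] \<tau>[OF assms] by simp
  show "\<rho> (\<tau> z) = z" if "0 < z" "z < \<rho>\<^sub>1" for z using \<tau>(3)[OF that] .
qed (use assms isCont_\<tau> in auto)

lemma \<tau>_mono:
  assumes "0 < y" "y \<le> z" "z < \<rho>\<^sub>1"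
  shows "\<tau> y \<le> \<tau> z"
proof (rule ccontr)
  assume "\<not> \<tau> y \<le> \<tau> z"
  then have "\<rho> (\<tau> z) < \<rho> (\<tau> y)" using \<tau>[of y] \<tau>[of z] assms by (intro \<rho>_strict_mono) auto
  then show False using \<tau>(3)[of y] \<tau>(3)[of z] assms by simp
qed

lemma continuous_\<rho>': "continuous_on {0<..1} \<rho>'"
proof -
  have "continuous_on {0<..1} \<rho>" using isCont_\<rho> by (intro continuous_at_imp_continuous_on) auto
  moreover have "\<rho> r \<noteq> 0" "g r \<noteq> 0" if "r \<in> {0<..1}" for r
    using \<rho>_pos[of r] g_bounds(3)[of r] that by auto
  ultimately show ?thesis
    unfolding \<rho>'_def g_def by (intro continuous_intros) (auto simp: g_def)
qed

lemma continuous_\<tau>': "continuous_on {0<..<\<rho>\<^sub>1} (\<lambda>y. inverse (\<rho>' (\<tau> y)))"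
proof -
  have "continuous_on {0<..<\<rho>\<^sub>1} \<tau>" using isCont_\<tau> by (intro continuous_at_imp_continuous_on) auto
  then have "continuous_on {0<..<\<rho>\<^sub>1} (\<lambda>y. \<rho>' (\<tau> y))"
    by (rule continuous_on_compose2[OF continuous_\<rho>']) (use \<tau> in force)
  moreover have "\<rho>' (\<tau> y) \<noteq> 0" if "y \<in> {0<..<\<rho>\<^sub>1}" for y
    using \<rho>'_pos[of "\<tau> y"] \<tau>[of y] that by force
  ultimately show ?thesis by (intro continuous_intros) auto
qed

text \<open>Estimating g by A and Q r by Q 0 gives H g^2 \<le> A^2 + Q 1 - Q 0 - ln r. The
  hypothesis on \<alpha> says exactly that this is at most 1 - ln (\<alpha> r), which is the origin
  of \<open>\<alpha>\<^sub>0\<close>.\<close>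

lemma X_upper:
  assumes "0 < r" "r < 1" and \<alpha>: "0 < \<alpha>" "ln \<alpha> \<le> 1 - A\<^sup>2 - Q 1 + Q 0"
  shows "0 < 1 - ln (\<alpha> * r)" "X (\<alpha> * r) * (N * H r * (g r)\<^sup>2) \<le> N"
proof -
  have h: "1 \<le> H r" using H_ge_1[of r] assms by simp
  have "(g r)\<^sup>2 \<le> A\<^sup>2" using g_bounds[of r] assms by (intro power_mono) auto
  then have "H r * (g r)\<^sup>2 \<le> H r * A\<^sup>2" using h by (intro mult_left_mono) auto
  also have "\<dots> = A\<^sup>2 + (Q 1 - Q r - ln r)" using A_gt by (simp add: H_def field_simps)
  also have "\<dots> \<le> 1 - ln (\<alpha> * r)"
    using Q_ge_Q0[of r] assms by (simp add: ln_mult)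
  finally have le: "H r * (g r)\<^sup>2 \<le> 1 - ln (\<alpha> * r)" .
  have "0 < H r * (g r)\<^sup>2" using h g_bounds(3)[of r] assms by simp
  with le show pos: "0 < 1 - ln (\<alpha> * r)" by linarith
  have "N * (H r * (g r)\<^sup>2) \<le> N * (1 - ln (\<alpha> * r))" using le N by (intro mult_left_mono) auto
  then show "X (\<alpha> * r) * (N * H r * (g r)\<^sup>2) \<le> N"
    using pos by (simp add: X_def divide_le_eq mult.assoc)
qed

text \<open>A^2 H r and 1 - ln (\<alpha> r) differ by a bounded quantity while both tend to infinity
  as r tends to 0, and g r tends to A. Hence the factor tends to N whatever the value of
  \<alpha>.\<close>

lemma X_lower:
  assumes \<alpha>: "0 < \<alpha>" and "0 < \<eta>"
  obtains r0 where "0 < r0" "r0 < 1" "\<And>r. 0 < r \<Longrightarrow> r < r0 \<Longrightarrow> (1 - \<eta>) * N \<le> X (\<alpha> * r) * (N * H r * (g r)\<^sup>2)"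
proof -
  have r: "eventually (\<lambda>r. 0 < r) (at_right (0::real))" by (simp add: eventually_at_filter)
  define D where "D = (\<lambda>r. 1 - ln \<alpha> - ln r)"
  have D: "filterlim D at_top (at_right 0)"
  proof -
    have "filterlim (\<lambda>r. - ln r) at_top (at_right (0::real))"
      using ln_at_0 by (simp add: filterlim_uminus_at_top)
    then have "filterlim (\<lambda>r. (1 - ln \<alpha>) + - ln r) at_top (at_right (0::real))"
      by (rule filterlim_tendsto_add_at_top[OF tendsto_const])
    then show ?thesis by (simp add: D_def)
  qed
  have iD: "((\<lambda>r. inverse (D r)) \<longlongrightarrow> 0) (at_right 0)"
    using D tendsto_inverse_0_at_top by blast
  have D0: "eventually (\<lambda>r. 0 < D r) (at_right 0)" using D by (simp add: filterlim_at_top_dense)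
  have "((\<lambda>r. 1 + (A\<^sup>2 + Q 1 - Q r - 1 + ln \<alpha>) * inverse (D r)) \<longlongrightarrow> 1 + (A\<^sup>2 + Q 1 - Q 0 - 1 + ln \<alpha>) * 0) (at_right 0)"
    by (intro tendsto_intros Q_tendsto_0 iD)
  moreover have "eventually (\<lambda>r. 1 + (A\<^sup>2 + Q 1 - Q r - 1 + ln \<alpha>) * inverse (D r) = A\<^sup>2 * H r / D r) (at_right 0)"
    using D0
  proof eventually_elim
    case (elim r)
    have "A\<^sup>2 * H r = D r + (A\<^sup>2 + Q 1 - Q r - 1 + ln \<alpha>)" using A_gt by (simp add: H_def D_def field_simps)
    then show ?case using elim by (simp add: field_simps)
  qed
  ultimately have 1: "((\<lambda>r. A\<^sup>2 * H r / D r) \<longlongrightarrow> 1) (at_right 0)"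
    using tendsto_cong by fastforce
  have "((\<lambda>r. (g r)\<^sup>2 / A\<^sup>2) \<longlongrightarrow> (g 0)\<^sup>2 / A\<^sup>2) (at_right 0)"
    using A_gt by (intro tendsto_divide tendsto_power g_tendsto_0 tendsto_const) auto
  then have 2: "((\<lambda>r. (g r)\<^sup>2 / A\<^sup>2) \<longlongrightarrow> 1) (at_right 0)" using A_gt by (simp add: g_def)
  have "((\<lambda>r. N * (A\<^sup>2 * H r / D r * ((g r)\<^sup>2 / A\<^sup>2))) \<longlongrightarrow> N * (1 * 1)) (at_right 0)"
    by (intro tendsto_mult tendsto_const 1 2)
  moreover have "(1 - \<eta>) * N < N * (1 * 1)" using N assms(2) by simp
  ultimately have "eventually (\<lambda>r. (1 - \<eta>) * N < N * (A\<^sup>2 * H r / D r * ((g r)\<^sup>2 / A\<^sup>2))) (at_right 0)"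
    by (rule order_tendstoD(1))
  then obtain b where b: "0 < b" "\<And>r. 0 < r \<Longrightarrow> r < b \<Longrightarrow> (1 - \<eta>) * N < N * (A\<^sup>2 * H r / D r * ((g r)\<^sup>2 / A\<^sup>2))"
    unfolding eventually_at_right_field by blast
  have "(1 - \<eta>) * N \<le> X (\<alpha> * r) * (N * H r * (g r)\<^sup>2)" if "0 < r" "r < b" for r
    using b(2)[OF that] that \<alpha> A_gt by (simp add: X_def D_def ln_mult mult_ac diff_diff_eq)
  then show ?thesis using that[of "min b (1 / 2)"] b(1) by auto
qed

end

subsection \<open>Ground state representation\<close>

lemma C1_annulus_square:
  fixes u :: "real^'n::finite \<Rightarrow> real"
  assumes "u \<in> C1_annulus b"
  shows "(\<lambda>x. u x * u x) \<in> C1_annulus b" "grad (\<lambda>x. u x * u x) x = (2 * u x) *\<^sub>R grad u x"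
proof -
  obtain a c where a: "0 < a" "\<And>x. norm x \<le> a \<Longrightarrow> u x = 0" and c: "0 \<le> c" "c < b" "\<And>x. c \<le> norm x \<Longrightarrow> u x = 0" and C1: "C1 u"
    using C1_annulusD[OF assms] by metis
  have d: "((\<lambda>x. u x * u x) has_derivative (\<lambda>h. ((2 * u x) *\<^sub>R grad u x) \<bullet> h)) (at x)" for x
    using has_derivative_mult[OF C1D(1)[OF C1] C1D(1)[OF C1], of x] by (simp add: algebra_simps)
  have "continuous_on UNIV (\<lambda>x. (2 * u x) *\<^sub>R grad u x)"
    by (intro continuous_intros C1D(2) C1_continuous C1)
  note g = C1I[OF d this]
  show "grad (\<lambda>x. u x * u x) x = (2 * u x) *\<^sub>R grad u x" by (simp add: g(2))
  have "(\<lambda>x. u x * u x) \<in> C1_ball b" unfolding C1_ball_def using g(1) c by auto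
  then show "(\<lambda>x. u x * u x) \<in> C1_annulus b" unfolding C1_annulus_def using a by auto
qed

lemma set_integral_ball_eq:
  assumes "\<And>x. 1 \<le> norm x \<Longrightarrow> f x = (0::real)"
  shows "(LINT x:ball 0 1|lborel. f x) = (LINT x|lborel. f (x :: real^'n::finite))"
proof -
  have "(\<lambda>x. indicator (ball 0 1) x *\<^sub>R f x) = f"
    using assms by (auto simp: indicator_def fun_eq_iff)
  then show ?thesis by (simp add: set_lebesgue_integral_def)
qed

lemma abs_powr_2: "\<bar>x::real\<bar> powr 2 = x\<^sup>2"
  using powr_numeral[of "\<bar>x\<bar>" "Num.Bit0 Num.One"] by simp

locale hardy_setting = hardy_sobolev_exponent p ty + profile N \<theta> A
  for p N \<theta> A :: real and ty :: "'n::finite itself" +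
  fixes R :: real
  assumes N_eq: "N = real CARD('n) - 2" and R: "A = R powr \<theta>"
begin

text \<open>The indicator is part of the weight because the limit theorems are formulated for
  integrals over the whole space.\<close>

definition "hardy2 x = indicator (ball 0 1) x / (norm (x::real^'n) powr (2 - \<theta>) * (A - norm x powr \<theta>))"
definition "hardy1 x = indicator (ball 0 1) x / (norm (x::real^'n))\<^sup>2"

lemma hardy_measurable: "hardy1 \<in> borel_measurable borel" "hardy2 \<in> borel_measurable borel"
proof -
  have [measurable]: "ball (0 :: real^'n) 1 \<in> sets borel" by simp
  show "hardy1 \<in> borel_measurable borel" "hardy2 \<in> borel_measurable borel"
    unfolding hardy1_def[abs_def] hardy2_def[abs_def] by measurable
qed

lemma hardy_bounds:
  assumes "0 < norm x" "norm x < 1"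
  shows "\<bar>hardy1 x\<bar> \<le> 1 / (norm x)\<^sup>2" "\<bar>hardy2 x\<bar> \<le> 1 / (A - 1) / (norm x)\<^sup>2"
proof -
  show "\<bar>hardy1 x\<bar> \<le> 1 / (norm x)\<^sup>2" using assms by (simp add: hardy1_def)
  have 1: "(norm x)\<^sup>2 \<le> norm x powr (2 - \<theta>)"
    using assms \<theta> powr_mono'[of "2 - \<theta>" 2 "norm x"] by (simp add: powr_numeral)
  have 2: "A - 1 \<le> A - norm x powr \<theta>" "0 < A - 1" using powr_\<theta>[of "norm x"] assms A_gt by auto
  have "(norm x)\<^sup>2 * (A - 1) \<le> norm x powr (2 - \<theta>) * (A - norm x powr \<theta>)"
    using 1 2 by (intro mult_mono) auto
  then have "1 / (norm x powr (2 - \<theta>) * (A - norm x powr \<theta>)) \<le> 1 / ((norm x)\<^sup>2 * (A - 1))"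
    using assms 2 by (intro divide_left_mono mult_pos_pos) auto
  then show "\<bar>hardy2 x\<bar> \<le> 1 / (A - 1) / (norm x)\<^sup>2"
    using assms 2 by (simp add: hardy2_def mult.commute)
qed

lemma hardy_deficit_eq:
  fixes u :: "real^'n \<Rightarrow> real"
  assumes "u \<in> C1_ball 1"
  shows "hardy_deficit \<theta> R u = dirichlet u - (N / 2)\<^sup>2 * (LINT x|lborel. hardy1 x * \<bar>u x\<bar> powr 2)
    - \<theta>\<^sup>2 * (LINT x|lborel. hardy2 x * \<bar>u x\<bar> powr 2)"
proof -
  have "(LINT x:ball 0 1|lborel. (norm (grad u x))\<^sup>2) = dirichlet u"
    unfolding dirichlet_def by (rule set_integral_ball_eq) (simp add: C1_ball_zero[OF assms])
  then show ?thesis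
    unfolding hardy_deficit_def N_eq set_lebesgue_integral_def hardy1_def hardy2_def abs_powr_2 R[symmetric] by simp
qed

lemma hardy_integrable:
  fixes u :: "real^'n \<Rightarrow> real"
  assumes "u \<in> C1_ball 1"
  shows "integrable lborel (\<lambda>x. hardy1 x * \<bar>u x\<bar> powr 2)" "integrable lborel (\<lambda>x. hardy2 x * \<bar>u x\<bar> powr 2)"
  using weighted_limit(1)[OF n3 _ assms dominated_limit_const[OF assms] _ hardy_measurable(1), of 2 1]
    weighted_limit(1)[OF n3 _ assms dominated_limit_const[OF assms] _ hardy_measurable(2), of 2 "1 / (A - 1)"]
    hardy_bounds by auto

lemma hardy_deficit_limit:
  fixes u :: "real^'n \<Rightarrow> real"
  assumes u: "u \<in> C1_ball 1" and d: "dominated_limit 1 v u"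
  shows "(\<lambda>k. hardy_deficit \<theta> R (v k)) \<longlonglongrightarrow> hardy_deficit \<theta> R u"
proof -
  have v: "v k \<in> C1_ball 1" for k using d by (simp add: dominated_limit_def)
  have "(\<lambda>k. LINT x|lborel. hardy1 x * \<bar>v k x\<bar> powr 2) \<longlonglongrightarrow> (LINT x|lborel. hardy1 x * \<bar>u x\<bar> powr 2)"
    using weighted_limit(2)[OF n3 _ u d _ hardy_measurable(1), of 2 1] hardy_bounds by auto
  moreover have "(\<lambda>k. LINT x|lborel. hardy2 x * \<bar>v k x\<bar> powr 2) \<longlonglongrightarrow> (LINT x|lborel. hardy2 x * \<bar>u x\<bar> powr 2)"
    using weighted_limit(2)[OF n3 _ u d _ hardy_measurable(2), of 2 "1 / (A - 1)"] hardy_bounds by auto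
  ultimately show ?thesis
    unfolding hardy_deficit_eq[OF u] hardy_deficit_eq[OF v]
    by (intro tendsto_intros dirichlet_limit[OF n3 _ u d]) auto
qed

text \<open>The logarithmic derivative of the ground state over r: \<phi>' = r \<kappa> \<phi>, so
  the gradient of \<phi>(|x|) is \<kappa> \<phi> x.\<close>

definition "\<kappa> r = - (N / 2 + \<theta> * r powr \<theta> / g r) / r\<^sup>2"
definition "\<kappa>' r = 2 * (N / 2 + \<theta> * r powr \<theta> / g r) / r ^ 3 - \<theta>\<^sup>2 * A * r powr \<theta> / ((g r)\<^sup>2 * r ^ 3)"

lemma DERIV_\<kappa>:
  assumes "0 < r" "r \<le> 1"
  shows "(\<kappa> has_real_derivative \<kappa>' r) (at r)"
proof -
  define G s where "G = g r" and "s = r powr \<theta>"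
  have G: "0 < G" "A = G + s" using g_bounds(3)[of r] assms by (auto simp: G_def s_def g_def)
  have dg: "(g has_real_derivative - (\<theta> * s / r)) (at r)"
    using DERIV_g[OF assms(1)] assms by (simp add: s_def powr_diff)
  have ds: "((\<lambda>r. r powr \<theta>) has_real_derivative \<theta> * s / r) (at r)"
    using assms by (auto intro!: derivative_eq_intros simp: s_def powr_diff)
  have 1: "((\<lambda>r. \<theta> * r powr \<theta> / g r) has_real_derivative (\<theta> * (\<theta> * s / r) * G - \<theta> * s * - (\<theta> * s / r)) / (G * G)) (at r)"
    unfolding G_def s_def
    by (rule DERIV_divide[OF DERIV_cmult[OF ds[unfolded s_def], of \<theta>] dg[unfolded s_def]]) (use G(1) in \<open>simp add: G_def\<close>)
  have r2: "((\<lambda>r. r\<^sup>2) has_real_derivative 2 * r) (at r)" by (auto intro!: derivative_eq_intros)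
  have "(\<kappa> has_real_derivative (- ((\<theta> * (\<theta> * s / r) * G - \<theta> * s * - (\<theta> * s / r)) / (G * G)) * r\<^sup>2
       - - (N / 2 + \<theta> * s / G) * (2 * r)) / (r\<^sup>2 * r\<^sup>2)) (at r)"
  proof -
    have "((\<lambda>r. N / 2 + \<theta> * r powr \<theta> / g r) has_real_derivative
        (\<theta> * (\<theta> * s / r) * G - \<theta> * s * - (\<theta> * s / r)) / (G * G)) (at r)"
      using DERIV_add[OF DERIV_const 1, of "N / 2"] by (simp only: add_0)
    from DERIV_divide[OF DERIV_minus[OF this] r2] show ?thesis
      unfolding \<kappa>_def[abs_def] G_def s_def using assms(1) by simp
  qed
  moreover have "(- ((\<theta> * (\<theta> * s / r) * G - \<theta> * s * - (\<theta> * s / r)) / (G * G)) * r\<^sup>2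
       - - (N / 2 + \<theta> * s / G) * (2 * r)) / (r\<^sup>2 * r\<^sup>2) = \<kappa>' r"
  proof -
    define M K where "M = N / 2 + \<theta> * s / G" and "K = \<theta>\<^sup>2 * A * s / G\<^sup>2"
    have "(\<theta> * (\<theta> * s / r) * G - \<theta> * s * - (\<theta> * s / r)) / (G * G) = K / r"
    proof -
      have "\<theta> * (\<theta> * s / r) * G - \<theta> * s * - (\<theta> * s / r) = \<theta>\<^sup>2 * (G + s) * s / r"
        by (simp add: power2_eq_square add_divide_distrib algebra_simps)
      then show ?thesis unfolding K_def G(2) by (simp add: power2_eq_square mult_ac)
    qed
    then have "(- ((\<theta> * (\<theta> * s / r) * G - \<theta> * s * - (\<theta> * s / r)) / (G * G)) * r\<^sup>2
       - - (N / 2 + \<theta> * s / G) * (2 * r)) / (r\<^sup>2 * r\<^sup>2) = (- (K / r) * r\<^sup>2 - - M * (2 * r)) / (r\<^sup>2 * r\<^sup>2)"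
      by (simp only: M_def)
    also have "\<dots> = 2 * M / r ^ 3 - K / r ^ 3"
      using assms(1) by (simp add: field_simps power2_eq_square power3_eq_cube)
    also have "\<dots> = \<kappa>' r"
      by (simp add: \<kappa>'_def G_def s_def M_def K_def)
    finally show ?thesis .
  qed
  ultimately show ?thesis by simp
qed

lemma continuous_\<kappa>': "continuous_on {0<..<1} \<kappa>'"
proof -
  have "continuous_on {0<..<1} g"
    unfolding g_def by (intro continuous_intros) auto
  moreover have "g r \<noteq> 0" if "r \<in> {0<..<1}" for r using g_bounds(3)[of r] that by auto
  ultimately show ?thesis unfolding \<kappa>'_def by (intro continuous_intros) auto
qed

text \<open>The Euler equation of the ground state in Riccati form: the left side is the divergence
  of the field \<kappa>(|x|) x plus its squared length, the right side minus the sum of the two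
  Hardy potentials.\<close>

lemma \<kappa>_riccati:
  assumes "0 < r" "r < 1"
  shows "\<kappa>' r * r + real CARD('n) * \<kappa> r + (\<kappa> r)\<^sup>2 * r\<^sup>2 = - ((N / 2)\<^sup>2 / r\<^sup>2 + \<theta>\<^sup>2 / (r powr (2 - \<theta>) * (A - r powr \<theta>)))"
proof -
  define G s where "G = g r" and "s = r powr \<theta>"
  have G: "0 < G" "A = G + s" using g_bounds(3)[of r] assms by (auto simp: G_def s_def g_def)
  have s: "0 < s" using assms by (simp add: s_def)
  have e: "r powr (2 - \<theta>) = r\<^sup>2 / s" using assms by (simp add: powr_diff s_def powr_numeral)
  have c: "real CARD('n) = N + 2" by (simp add: N_eq)
  \<comment> \<open>As A = G + s, the term \<theta>^2 A s / G^2 equals \<theta> m + m^2. The claim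
    then becomes a polynomial identity in m over r^2.\<close>
  define m where "m = \<theta> * s / G"
  have k: "\<kappa> r = - (N / 2 + m) / r\<^sup>2" by (simp add: \<kappa>_def G_def s_def m_def)
  have "\<theta>\<^sup>2 * (G + s) * s / G\<^sup>2 = \<theta> * m + m * m"
    unfolding m_def using G(1) by (simp add: field_simps power2_eq_square)
  then have Am: "\<theta>\<^sup>2 * A * s / G\<^sup>2 = \<theta> * m + m * m" unfolding G(2) .
  have "\<kappa>' r = 2 * (N / 2 + m) / r ^ 3 - \<theta>\<^sup>2 * A * s / G\<^sup>2 / r ^ 3"
    by (simp add: \<kappa>'_def G_def s_def m_def)
  then have k': "\<kappa>' r = 2 * (N / 2 + m) / r ^ 3 - (\<theta> * m + m * m) / r ^ 3" unfolding Am .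
  have e1: "\<kappa>' r * r = 2 * (N / 2 + m) / r\<^sup>2 - (\<theta> * m + m * m) / r\<^sup>2"
  proof -
    have "c / r ^ 3 * r = c / r\<^sup>2" for c using assms by (simp add: power3_eq_cube power2_eq_square)
    then show ?thesis using k' by (simp only: left_diff_distrib)
  qed
  have e2: "real CARD('n) * \<kappa> r = - ((N + 2) * (N / 2 + m)) / r\<^sup>2"
    unfolding k c by (simp only: times_divide_eq_right mult_minus_right)
  have e3: "(\<kappa> r)\<^sup>2 * r\<^sup>2 = (N / 2 + m)\<^sup>2 / r\<^sup>2"
    unfolding k using assms by (simp add: power2_eq_square field_simps)
  have "\<kappa>' r * r + real CARD('n) * \<kappa> r + (\<kappa> r)\<^sup>2 * r\<^sup>2 =
      (2 * (N / 2 + m) - (\<theta> * m + m * m) - (N + 2) * (N / 2 + m) + (N / 2 + m)\<^sup>2) / r\<^sup>2"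
  proof -
    have "a / x - b / x + - c / x + d / x = (a - b - c + d) / x" for a b c d x :: real
      by (simp add: add_divide_distrib diff_divide_distrib)
    then show ?thesis by (simp only: e1 e2 e3)
  qed
  also have "2 * (N / 2 + m) - (\<theta> * m + m * m) - (N + 2) * (N / 2 + m) + (N / 2 + m)\<^sup>2 = - ((N / 2)\<^sup>2 + \<theta> * m)"
    by (simp add: power2_eq_square algebra_simps)
  also have "- ((N / 2)\<^sup>2 + \<theta> * m) / r\<^sup>2 = - ((N / 2)\<^sup>2 / r\<^sup>2 + \<theta>\<^sup>2 / (r powr (2 - \<theta>) * (A - r powr \<theta>)))"
  proof -
    have "A - r powr \<theta> = G" using G(2) by (simp add: s_def)
    moreover have "\<theta>\<^sup>2 / (r\<^sup>2 / s * G) = \<theta> * m / r\<^sup>2" using s by (simp add: m_def power2_eq_square mult_ac)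
    moreover have "- (a + b) / x = - (a / x + b / x)" for a b x :: real by (simp add: diff_divide_distrib)
    ultimately show ?thesis by (simp only: e)
  qed
  finally show ?thesis .
qed

text \<open>Expanding the square, the cross term is absorbed by the divergence of \<kappa> u^2 x,
  which integrates to 0. What remains is u^2 times the left side of the Riccati equation. Vanishing
  of u near the origin makes this field C1.\<close>

lemma ground_state:
  fixes u :: "real^'n \<Rightarrow> real"
  assumes u: "u \<in> C1_annulus 1"
  defines "W \<equiv> \<lambda>x. (norm (grad u x - (u x * \<kappa> (norm x)) *\<^sub>R x))\<^sup>2"
  shows "integrable lborel W" "hardy_deficit \<theta> R u = (LINT x|lborel. W x)"
proof -
  have ub: "u \<in> C1_ball 1" using u by (simp add: C1_annulus_def)
  obtain a c where a: "0 < a" "\<And>x. norm x \<le> a \<Longrightarrow> u x = 0" and c: "0 \<le> c" "c < 1" "\<And>x. c \<le> norm x \<Longrightarrow> u x = 0" and C1: "C1 u"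
    using C1_annulusD[OF u] by metis
  define G where "G = (\<lambda>x. \<kappa> (norm x) * (u x * u x))"
  note G = C1_annulus_radial_mult[OF C1_annulus_square(1)[OF u] zero_less_one DERIV_\<kappa> continuous_\<kappa>', folded G_def]
  have Gb: "G \<in> C1_ball 1" using G(1) by (simp add: C1_annulus_def)
  have Gi: "integrable lborel G"
    using Gb C1_ballD[OF Gb] by (intro integrable_continuous_compact_support[where c = 1] C1_continuous)
      (auto simp: C1_ball_def C1_ball_zero[OF Gb])
  have W: "W x = (norm (grad u x))\<^sup>2 - (grad G x \<bullet> x + real CARD('n) * G x)
      - ((N / 2)\<^sup>2 * (hardy1 x * \<bar>u x\<bar> powr 2) + \<theta>\<^sup>2 * (hardy2 x * \<bar>u x\<bar> powr 2))" for x
  proof (cases "0 < norm x \<and> norm x < 1")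
    case True
    define r where "r = norm x"
    have r: "0 < r" "r < 1" "x \<bullet> x = r\<^sup>2" using True by (auto simp: r_def power2_norm_eq_inner)
    have "grad G x \<bullet> x = 2 * \<kappa> r * u x * (grad u x \<bullet> x) + (u x)\<^sup>2 * (\<kappa>' r * r)"
      using G(2)[of x] True r by (simp add: inner_add_left C1_annulus_square(2)[OF u] r_def[symmetric] power2_eq_square field_simps)
    then have "(norm (grad u x))\<^sup>2 - (grad G x \<bullet> x + real CARD('n) * G x) + (u x)\<^sup>2 * (\<kappa>' r * r + real CARD('n) * \<kappa> r + (\<kappa> r)\<^sup>2 * r\<^sup>2)
       = (norm (grad u x))\<^sup>2 - 2 * \<kappa> r * u x * (grad u x \<bullet> x) + (u x)\<^sup>2 * (\<kappa> r)\<^sup>2 * r\<^sup>2"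
      by (simp add: G_def r_def[symmetric] power2_eq_square algebra_simps)
    also have "\<dots> = W x"
    proof -
      have "(norm (a - k *\<^sub>R x))\<^sup>2 = (norm a)\<^sup>2 - 2 * k * (a \<bullet> x) + k\<^sup>2 * (x \<bullet> x)" for a and k :: real
        unfolding power2_norm_eq_inner
        by (simp add: inner_diff_left inner_diff_right inner_commute power2_eq_square algebra_simps)
      then show ?thesis unfolding W_def r_def[symmetric] r(3) by (simp add: power_mult_distrib mult_ac)
    qed
    finally have e: "W x = (norm (grad u x))\<^sup>2 - (grad G x \<bullet> x + real CARD('n) * G x)
       + (u x)\<^sup>2 * (\<kappa>' r * r + real CARD('n) * \<kappa> r + (\<kappa> r)\<^sup>2 * r\<^sup>2)" by simp
    have "(u x)\<^sup>2 * (\<kappa>' r * r + real CARD('n) * \<kappa> r + (\<kappa> r)\<^sup>2 * r\<^sup>2)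
       = - ((N / 2)\<^sup>2 * (hardy1 x * \<bar>u x\<bar> powr 2) + \<theta>\<^sup>2 * (hardy2 x * \<bar>u x\<bar> powr 2))"
      unfolding \<kappa>_riccati[OF r(1,2)] hardy1_def hardy2_def abs_powr_2 using r True
      by (simp add: r_def algebra_simps)
    then show ?thesis unfolding e by simp
  next
    case False
    have "u x = 0" using False a c by auto
    moreover have "grad u x = 0"
    proof (cases "x = 0")
      case True
      have "grad u x = 0" by (rule grad_eq_0[of "ball 0 a"]) (use a True in auto)
      then show ?thesis .
    next
      case False then show ?thesis using \<open>\<not> (0 < norm x \<and> norm x < 1)\<close> C1_ball_zero[OF ub] by auto
    qed
    moreover have "grad G x \<bullet> x = 0" using False C1_ball_zero[OF Gb, of x] by (cases "x = 0") auto
    ultimately show ?thesis by (simp add: W_def G_def)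
  qed
  have i: "integrable lborel (\<lambda>x. (norm (grad u x))\<^sup>2)" "integrable lborel (\<lambda>x. grad G x \<bullet> x)"
    "integrable lborel (\<lambda>x. hardy1 x * \<bar>u x\<bar> powr 2)" "integrable lborel (\<lambda>x. hardy2 x * \<bar>u x\<bar> powr 2)"
    using dirichlet_integrable[OF ub] integral_divergence_radial_field(2)[OF Gb] hardy_integrable[OF ub] by auto
  show "integrable lborel W" unfolding W[abs_def] using i Gi by simp
  have "(LINT x|lborel. W x) = dirichlet u - ((LINT x|lborel. grad G x \<bullet> x) + real CARD('n) * (LINT x|lborel. G x))
      - ((N / 2)\<^sup>2 * (LINT x|lborel. hardy1 x * \<bar>u x\<bar> powr 2) + \<theta>\<^sup>2 * (LINT x|lborel. hardy2 x * \<bar>u x\<bar> powr 2))"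
    unfolding W[abs_def] dirichlet_def using i Gi by simp
  then show "hardy_deficit \<theta> R u = (LINT x|lborel. W x)"
    unfolding hardy_deficit_eq[OF ub] integral_divergence_radial_field(1)[OF Gb] by simp
qed

end

text \<open>The curve cos t y + sin t h stays on the sphere when h is orthogonal to y and of equal
  length, so w is constant along it and its gradient has no tangential component. The statement is
  equality in Cauchy-Schwarz.\<close>

lemma radial_grad_parallel:
  fixes w :: "real^'n::finite \<Rightarrow> real"
  assumes w: "radial w" and C1: "C1 w"
  shows "(y \<bullet> grad w y)\<^sup>2 = (norm y)\<^sup>2 * (norm (grad w y))\<^sup>2"
proof (cases "y = 0")
  case False
  let ?\<xi> = "grad w y"
  have orth: "?\<xi> \<bullet> h = 0" if h: "y \<bullet> h = 0" "norm h = norm y" for h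
  proof -
    define \<gamma> where "\<gamma> = (\<lambda>t::real. cos t *\<^sub>R y + sin t *\<^sub>R h)"
    have "norm (\<gamma> t) = norm y" for t
    proof -
      have "(norm (\<gamma> t))\<^sup>2 = (cos t)\<^sup>2 * (norm y)\<^sup>2 + (sin t)\<^sup>2 * (norm h)\<^sup>2"
        unfolding power2_norm_eq_inner \<gamma>_def using h(1)
        by (simp add: inner_add_left inner_add_right inner_commute power2_eq_square)
      also have "\<dots> = (norm y)\<^sup>2" using h(2) by (simp add: flip: distrib_right)
      finally show ?thesis by simp
    qed
    then have const: "(\<lambda>t. w (\<gamma> t)) = (\<lambda>_. w y)" using w unfolding radial_def by blast
    have "(\<gamma> has_derivative (\<lambda>t. t *\<^sub>R h)) (at 0)"
      unfolding \<gamma>_def by (auto intro!: derivative_eq_intros)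
    moreover have "(w has_derivative (\<lambda>h. ?\<xi> \<bullet> h)) (at (\<gamma> 0))" using C1D(1)[OF C1] by (simp add: \<gamma>_def)
    ultimately have "((\<lambda>t. w (\<gamma> t)) has_derivative (\<lambda>t. ?\<xi> \<bullet> (t *\<^sub>R h))) (at 0)"
      by (rule has_derivative_compose)
    moreover have "((\<lambda>t. w (\<gamma> t)) has_derivative (\<lambda>_. 0)) (at 0)" unfolding const by simp
    ultimately have "(\<lambda>t. ?\<xi> \<bullet> (t *\<^sub>R h)) = (\<lambda>_. 0)" by (rule has_derivative_unique)
    from fun_cong[OF this, of 1] show ?thesis by simp
  qed
  \<comment> \<open>The tangential component of the gradient; rescaled to the length of y it is an
    admissible direction for \<open>orth\<close>.\<close>
  define h where "h = ?\<xi> - ((y \<bullet> ?\<xi>) / (y \<bullet> y)) *\<^sub>R y"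
  have yy: "y \<bullet> y \<noteq> 0" using False by simp
  have yh: "y \<bullet> h = 0" using yy by (simp add: h_def inner_diff_right)
  have "?\<xi> \<bullet> h = 0"
  proof (cases "h = 0")
    case False
    have "?\<xi> \<bullet> ((norm y / norm h) *\<^sub>R h) = 0" by (rule orth) (use yh False in auto)
    then show ?thesis using False \<open>y \<noteq> 0\<close> by simp
  qed simp
  then have "?\<xi> \<bullet> ?\<xi> = (y \<bullet> ?\<xi>)\<^sup>2 / (y \<bullet> y)"
    by (simp add: h_def inner_diff_right inner_commute power2_eq_square)
  then show ?thesis using yy by (simp add: power2_norm_eq_inner)
qed simp

section \<open>The substitution u = \<phi> (w composed with the radial map) and the deficit\<close>

context hardy_setting
begin

definition "\<phi> r = r powr (- (N / 2)) * g r"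
definition "jac r = \<rho>' r * (\<rho> r / r) ^ (CARD('n) - 1)"
definition transform :: "(real^'n \<Rightarrow> real) \<Rightarrow> real^'n \<Rightarrow> real" where
  "transform w x = \<phi> (norm x) * annulus_pullback 1 \<rho> w x"

lemma \<phi>_pos: "0 < r \<Longrightarrow> r \<le> 1 \<Longrightarrow> 0 < \<phi> r"
  using g_bounds(3)[of r] by (simp add: \<phi>_def)

lemma DERIV_\<phi>:
  assumes "0 < r" "r < 1"
  shows "(\<phi> has_real_derivative r * \<kappa> r * \<phi> r) (at r)"
proof -
  have G: "0 < g r" using g_bounds(3)[of r] assms by simp
  have 1: "((\<lambda>r. r powr (- (N / 2))) has_real_derivative - (N / 2) * r powr (- (N / 2) - 1)) (at r)"
    using has_real_derivative_powr[OF assms(1)] .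
  have "(\<phi> has_real_derivative - (N / 2) * r powr (- (N / 2) - 1) * g r + - (\<theta> * r powr (\<theta> - 1)) * r powr (- (N / 2))) (at r)"
    unfolding \<phi>_def[abs_def] using DERIV_mult[OF 1 DERIV_g[OF assms(1)]] .
  moreover have "- (N / 2) * r powr (- (N / 2) - 1) * g r + - (\<theta> * r powr (\<theta> - 1)) * r powr (- (N / 2)) = r * \<kappa> r * \<phi> r"
  proof -
    define P s where "P = r powr (- (N / 2))" and "s = r powr \<theta>"
    have "r powr (- (N / 2) - 1) = P / r" "r powr (\<theta> - 1) = s / r"
      using assms by (simp_all add: P_def s_def powr_diff)
    moreover have "- (N / 2) * (P / r) * g r + - (\<theta> * (s / r)) * P = r * (- (N / 2 + \<theta> * s / g r) / r\<^sup>2) * (P * g r)"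
      using G assms(1) by (simp add: field_simps power2_eq_square)
    ultimately show ?thesis by (simp add: \<kappa>_def \<phi>_def P_def s_def)
  qed
  ultimately show ?thesis by simp
qed

lemma continuous_\<phi>': "continuous_on {0<..<1} (\<lambda>r. r * \<kappa> r * \<phi> r)" "continuous_on {0<..<1} \<phi>"
proof -
  show \<phi>: "continuous_on {0<..<1} \<phi>"
    by (intro continuous_at_imp_continuous_on ballI DERIV_isCont[OF DERIV_\<phi>]) auto
  have "continuous_on {0<..<1} \<kappa>"
    by (intro continuous_at_imp_continuous_on ballI DERIV_isCont[OF DERIV_\<kappa>]) auto
  with \<phi> show "continuous_on {0<..<1} (\<lambda>r. r * \<kappa> r * \<phi> r)" by (intro continuous_intros)
qed

lemma pullback_\<rho>:
  fixes w :: "real^'n \<Rightarrow> real"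
  assumes "w \<in> C1_annulus \<rho>\<^sub>1"
  shows "annulus_pullback 1 \<rho> w \<in> C1_annulus 1"
    "0 < norm x \<Longrightarrow> norm x < 1 \<Longrightarrow> grad (annulus_pullback 1 \<rho> w) x =
      (\<rho> (norm x) / norm x) *\<^sub>R grad w (radial_map \<rho> x) +
      ((\<rho>' (norm x) - \<rho> (norm x) / norm x) * (x \<bullet> grad w (radial_map \<rho> x)) / (norm x)\<^sup>2) *\<^sub>R x"
proof -
  have c: "continuous_on {0<..<1} \<rho>'" using continuous_\<rho>' by (rule continuous_on_subset) auto
  have m: "\<rho> r \<le> \<rho> s" if "0 < r" "r \<le> s" "s < 1" for r s
    using \<rho>_strict_mono[of r s] that by (cases "r = s") auto
  have s: "\<exists>r. 0 < r \<and> r < 1 \<and> \<rho> r = s" if "0 < s" "s < \<rho>\<^sub>1" for s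
    using \<rho>_surj[OF that] by metis
  note P = C1_annulus_pullback[OF assms zero_less_one \<rho>\<^sub>1_pos DERIV_\<rho> c \<rho>_pos m s]
  show "annulus_pullback 1 \<rho> w \<in> C1_annulus 1" using P(1) by simp
  show "0 < norm x \<Longrightarrow> norm x < 1 \<Longrightarrow> grad (annulus_pullback 1 \<rho> w) x =
      (\<rho> (norm x) / norm x) *\<^sub>R grad w (radial_map \<rho> x) +
      ((\<rho>' (norm x) - \<rho> (norm x) / norm x) * (x \<bullet> grad w (radial_map \<rho> x)) / (norm x)\<^sup>2) *\<^sub>R x"
    using P(2) by simp
qed

lemma transform_C1:
  fixes w :: "real^'n \<Rightarrow> real"
  assumes "w \<in> C1_annulus \<rho>\<^sub>1"
  shows "transform w \<in> C1_annulus 1"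
    "0 < norm x \<Longrightarrow> norm x < 1 \<Longrightarrow> grad (transform w) x - (transform w x * \<kappa> (norm x)) *\<^sub>R x
      = \<phi> (norm x) *\<^sub>R grad (annulus_pullback 1 \<rho> w) x"
proof -
  show "transform w \<in> C1_annulus 1"
    unfolding transform_def[abs_def]
    by (rule C1_annulus_radial_mult(1)[OF pullback_\<rho>(1)[OF assms] zero_less_one DERIV_\<phi> continuous_\<phi>'(1)])
  show "grad (transform w) x - (transform w x * \<kappa> (norm x)) *\<^sub>R x = \<phi> (norm x) *\<^sub>R grad (annulus_pullback 1 \<rho> w) x"
    if x: "0 < norm x" "norm x < 1"
  proof -
    have "grad (transform w) x = \<phi> (norm x) *\<^sub>R grad (annulus_pullback 1 \<rho> w) x +
        (annulus_pullback 1 \<rho> w x * (norm x * \<kappa> (norm x) * \<phi> (norm x)) / norm x) *\<^sub>R x"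
      unfolding transform_def[abs_def]
      by (rule C1_annulus_radial_mult(2)[OF pullback_\<rho>(1)[OF assms] zero_less_one DERIV_\<phi> continuous_\<phi>'(1)])
        (use x in simp_all)
    then show ?thesis using x by (simp add: transform_def mult_ac)
  qed
qed

lemma norm_radial_\<rho>: "0 < norm (x::real^'n) \<Longrightarrow> norm x < 1 \<Longrightarrow> norm (radial_map \<rho> x) = \<rho> (norm x)"
  using norm_radial_map[of x \<rho>] \<rho>_pos[of "norm x"] by simp

lemma norm_radial_\<tau>: "0 < norm (y::real^'n) \<Longrightarrow> norm y < \<rho>\<^sub>1 \<Longrightarrow> norm (radial_map \<tau> y) = \<tau> (norm y)"
  using norm_radial_map[of y \<tau>] \<tau>(1)[of "norm y"] by simp

lemma radial_\<tau>_\<rho>: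
  assumes "0 < norm (x::real^'n)" "norm x < 1"
  shows "radial_map \<tau> (radial_map \<rho> x) = x"
  unfolding radial_map_def[of \<tau>] norm_radial_\<rho>[OF assms] \<tau>_\<rho>[OF assms]
  using assms \<rho>_pos[of "norm x"] by (simp add: radial_map_def)

lemma radial_\<rho>_\<tau>:
  assumes "0 < norm (y::real^'n)" "norm y < \<rho>\<^sub>1"
  shows "radial_map \<rho> (radial_map \<tau> y) = y"
  unfolding radial_map_def[of \<rho>] norm_radial_\<tau>[OF assms] \<tau>(3)[OF assms]
  using assms \<tau>(1)[OF assms] by (simp add: radial_map_def)

text \<open>The inverse is division by \<phi> followed by the pullback along \<tau>; the annulus
  condition makes both harmless.\<close>

lemma transform_surj:
  fixes u :: "real^'n \<Rightarrow> real"
  assumes u: "u \<in> C1_annulus 1"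
  obtains w where "w \<in> C1_annulus \<rho>\<^sub>1" "transform w = u"
proof -
  obtain a c where a: "0 < a" "\<And>x. norm x \<le> a \<Longrightarrow> u x = 0" and c: "c < 1" "\<And>x. c \<le> norm x \<Longrightarrow> u x = 0"
    using C1_annulusD[OF u] by metis
  define v where "v = (\<lambda>x. 1 / \<phi> (norm x) * u x)"
  have d: "((\<lambda>r. 1 / \<phi> r) has_real_derivative - (r * \<kappa> r * \<phi> r) / (\<phi> r * \<phi> r)) (at r)" if "0 < r" "r < 1" for r
    using DERIV_divide[OF DERIV_const[of 1] DERIV_\<phi>[OF that]] \<phi>_pos[of r] that by simp
  have cd: "continuous_on {0<..<1} (\<lambda>r. - (r * \<kappa> r * \<phi> r) / (\<phi> r * \<phi> r))"
    using \<phi>_pos by (intro continuous_intros continuous_\<phi>') (auto simp: less_imp_neq[THEN not_sym])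
  have v: "v \<in> C1_annulus 1" unfolding v_def by (rule C1_annulus_radial_mult(1)[OF u zero_less_one d cd])
  define w where "w = annulus_pullback \<rho>\<^sub>1 \<tau> v"
  have w: "w \<in> C1_annulus \<rho>\<^sub>1"
    unfolding w_def
  proof (rule C1_annulus_pullback(1)[OF v \<rho>\<^sub>1_pos zero_less_one DERIV_\<tau> continuous_\<tau>' \<tau>(1) \<tau>_mono])
    fix s :: real assume s: "0 < s" "s < 1"
    then show "\<exists>r. 0 < r \<and> r < \<rho>\<^sub>1 \<and> \<tau> r = s"
      using \<rho>_pos[of s] \<rho>_less[of s] \<tau>_\<rho>[of s] by (intro exI[of _ "\<rho> s"]) auto
  qed
  have "transform w x = u x" for x
  proof (cases "0 < norm x \<and> norm x < 1")
    case True
    then have "0 < norm (radial_map \<rho> x) \<and> norm (radial_map \<rho> x) < \<rho>\<^sub>1"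
      using norm_radial_\<rho>[of x] \<rho>_pos[of "norm x"] \<rho>_less[of "norm x"] by auto
    then have "w (radial_map \<rho> x) = v x"
      using True radial_\<tau>_\<rho>[of x] by (simp add: annulus_pullback_def w_def)
    then have "transform w x = \<phi> (norm x) * v x"
      using True by (simp add: transform_def annulus_pullback_def)
    then show ?thesis using True \<phi>_pos[of "norm x"] by (simp add: v_def)
  next
    case False
    then have "transform w x = 0" by (auto simp: transform_def annulus_pullback_def)
    moreover have "u x = 0" using False a c by (cases "x = 0") auto
    ultimately show ?thesis by simp
  qed
  then show ?thesis using that w by blast
qed

lemma measurable_profile [measurable]:
  "g \<in> borel_measurable borel" "\<rho> \<in> borel_measurable borel" "\<rho>' \<in> borel_measurable borel" "jac \<in> borel_measurable borel"
proof -
  show g[measurable]: "g \<in> borel_measurable borel" unfolding g_def[abs_def] by measurable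
  have [measurable]: "Q \<in> borel_measurable borel" unfolding Q_def[abs_def] by measurable
  have [measurable]: "H \<in> borel_measurable borel" unfolding H_def[abs_def] by measurable
  show [measurable]: "\<rho> \<in> borel_measurable borel" unfolding \<rho>_def[abs_def] by measurable
  show [measurable]: "\<rho>' \<in> borel_measurable borel" unfolding \<rho>'_def[abs_def] by measurable
  show "jac \<in> borel_measurable borel" unfolding jac_def[abs_def] by measurable
qed

definition "punct = {x::real^'n. 0 < norm x \<and> norm x < 1}"

lemma change_of_variables:
  fixes G :: "real^'n \<Rightarrow> real"
  assumes G: "integrable lborel G" and z: "G 0 = 0" "\<And>y. \<rho>\<^sub>1 \<le> norm y \<Longrightarrow> G y = 0"
  shows "integrable lborel (\<lambda>x. indicator punct x * (jac (norm x) * G (radial_map \<rho> x)))"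
    "(LINT x|lborel. indicator punct x * (jac (norm x) * G (radial_map \<rho> x))) = (LINT y|lborel. G y)"
proof -
  have [measurable]: "G \<in> borel_measurable borel" using G borel_measurable_integrable by auto
  have [measurable]: "punct \<in> sets borel"
    unfolding punct_def by (intro borel_open open_Collect_conj open_Collect_less continuous_intros)
  have [measurable]: "(radial_map \<rho> :: real^'n \<Rightarrow> _) \<in> borel_measurable borel"
    unfolding radial_map_def[abs_def] by measurable
  have m: "(\<lambda>x. indicator punct x * (jac (norm x) * G (radial_map \<rho> x))) \<in> borel_measurable borel"
    by measurable
  have im: "G y = 0" if "y \<notin> radial_map \<rho> ` punct" for y
  proof (rule ccontr)
    assume "G y \<noteq> 0"
    then have y: "0 < norm y" "norm y < \<rho>\<^sub>1" using z(1) z(2)[of y] by (auto simp: not_le[symmetric])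
    then have "radial_map \<tau> y \<in> punct" using norm_radial_\<tau>[of y] \<tau>[of "norm y"] by (simp add: punct_def del: zero_less_norm_iff)
    then show False using radial_\<rho>_\<tau>[OF y] that by (metis imageI)
  qed
  have e: "indicator punct x * (\<rho>' (norm x) * (\<rho> (norm x) / norm x) ^ (CARD('n) - 1) * G (radial_map \<rho> x))
     = indicator punct x * (jac (norm x) * G (radial_map \<rho> x))" for x by (simp add: jac_def)
  show "integrable lborel (\<lambda>x. indicator punct x * (jac (norm x) * G (radial_map \<rho> x)))"
    using radial_change_of_variables(1)[of 1 \<rho> \<rho>' G, folded punct_def, unfolded e] DERIV_\<rho> \<rho>_pos \<rho>'_pos G im m by simp
  show "(LINT x|lborel. indicator punct x * (jac (norm x) * G (radial_map \<rho> x))) = (LINT y|lborel. G y)"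
    using radial_change_of_variables(2)[of 1 \<rho> \<rho>' G, folded punct_def, unfolded e] DERIV_\<rho> \<rho>_pos \<rho>'_pos G im m by simp
qed

text \<open>The second identity is what dictates the equation for \<rho>: the radial part \<phi>^2
  \<rho>'^2 of the energy density has to coincide with the Jacobian, that is \<phi>^2 \<rho>' =
  (\<rho> / r)^(N + 1).\<close>

lemma jac_eq:
  assumes "0 < r" "r < 1"
  shows "jac r = \<rho>' r * (\<rho> r / r) powr (N + 1)" "(\<phi> r)\<^sup>2 * (\<rho>' r)\<^sup>2 = jac r" "0 < jac r"
proof -
  have p: "0 < \<rho> r" "0 < g r" "0 < \<rho>' r" using \<rho>_pos[of r] g_bounds(3)[of r] \<rho>'_pos[of r] assms by auto
  have n: "real (CARD('n) - 1) = N + 1" using n3 by (simp add: N_eq)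
  show j: "jac r = \<rho>' r * (\<rho> r / r) powr (N + 1)"
    unfolding jac_def n[symmetric] using p assms by (subst powr_realpow) auto
  then show "0 < jac r" using p assms by simp
  have "(\<phi> r)\<^sup>2 * \<rho>' r = (\<rho> r / r) powr (N + 1)"
  proof -
    have "(r powr (- (N / 2)))\<^sup>2 = r powr (- N)"
      using assms by (simp add: power2_eq_square flip: powr_add)
    moreover have "r powr (- N) / r = 1 / r powr (N + 1)"
      using assms by (simp add: powr_minus powr_add field_simps)
    moreover have "(\<phi> r)\<^sup>2 * \<rho>' r = ((r powr (- (N / 2)))\<^sup>2 / r) * \<rho> r powr (N + 1)"
      using p by (simp add: \<phi>_def \<rho>'_def power_mult_distrib)
    ultimately show ?thesis
      using p assms by (simp add: powr_divide)
  qed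
  then show "(\<phi> r)\<^sup>2 * (\<rho>' r)\<^sup>2 = jac r" unfolding j by (simp add: power2_eq_square mult_ac)
qed

text \<open>Splitting the gradient of w into radial and tangential parts, the density of the deficit
  is the Jacobian times the squared radial part plus \<phi>^2 (\<rho> / r)^2 times the squared
  tangential part. By \<open>\<rho>'_le\<close> the second coefficient is at least the Jacobian; for
  radial w the tangential part vanishes.\<close>

lemma transform_deficit:
  fixes w :: "real^'n \<Rightarrow> real"
  assumes w: "w \<in> C1_annulus \<rho>\<^sub>1"
  shows "dirichlet w \<le> hardy_deficit \<theta> R (transform w)"
    "radial w \<Longrightarrow> hardy_deficit \<theta> R (transform w) = dirichlet w"
proof -
  have wb: "w \<in> C1_ball \<rho>\<^sub>1" using w by (simp add: C1_annulus_def)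
  obtain a where a: "0 < a" "\<And>x. norm x \<le> a \<Longrightarrow> w x = 0" and C1: "C1 w" using C1_annulusD[OF w] by metis
  have g0: "grad w 0 = 0" by (rule grad_eq_0[of "ball 0 a"]) (use a in auto)
  define W where "W = (\<lambda>x. (norm (grad (transform w) x - (transform w x * \<kappa> (norm x)) *\<^sub>R x))\<^sup>2)"
  define V where "V = (\<lambda>x. indicator punct x * (jac (norm x) * (norm (grad w (radial_map \<rho> x)))\<^sup>2))"
  note gs = ground_state[OF transform_C1(1)[OF w], folded W_def]
  have V: "integrable lborel V" "(LINT x|lborel. V x) = dirichlet w"
    unfolding V_def dirichlet_def
    using change_of_variables[of "\<lambda>y. (norm (grad w y))\<^sup>2"] dirichlet_integrable[OF wb] g0 C1_ball_zero[OF wb] by auto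
  have eq: "\<exists>t. 0 \<le> t \<and> t \<le> (norm (grad w (radial_map \<rho> x)))\<^sup>2 \<and> (radial w \<longrightarrow> t = (norm (grad w (radial_map \<rho> x)))\<^sup>2) \<and>
     W x = (\<phi> (norm x))\<^sup>2 * (\<rho> (norm x) / norm x)\<^sup>2 * ((norm (grad w (radial_map \<rho> x)))\<^sup>2 - t) + jac (norm x) * t"
    if x: "0 < norm x" "norm x < 1" for x
  proof -
    define \<xi> r c d where "\<xi> = grad w (radial_map \<rho> x)" and "r = norm x" and "c = \<rho> (norm x) / norm x" and "d = \<rho>' (norm x)"
    \<comment> \<open>The squared radial component of \<xi>.\<close>
    define t where "t = (x \<bullet> \<xi>)\<^sup>2 / r\<^sup>2"
    have r: "0 < r" "r < 1" "x \<bullet> x = r\<^sup>2" using x by (auto simp: r_def power2_norm_eq_inner)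
    have "(x \<bullet> \<xi>)\<^sup>2 \<le> r\<^sup>2 * (norm \<xi>)\<^sup>2"
      using Cauchy_Schwarz_ineq[of x \<xi>] by (simp add: r(3) power2_norm_eq_inner)
    then have t: "0 \<le> t" "t \<le> (norm \<xi>)\<^sup>2" using r by (auto simp: t_def divide_le_eq mult.commute)
    have trad: "t = (norm \<xi>)\<^sup>2" if "radial w"
    proof -
      let ?y = "radial_map \<rho> x"
      have k: "?y = c *\<^sub>R x" "0 < c" using \<rho>_pos[of r] r by (auto simp: radial_map_def c_def r_def)
      have "(?y \<bullet> \<xi>)\<^sup>2 = (norm ?y)\<^sup>2 * (norm \<xi>)\<^sup>2"
        unfolding \<xi>_def by (rule radial_grad_parallel[OF that C1])
      then have "c\<^sup>2 * (x \<bullet> \<xi>)\<^sup>2 = c\<^sup>2 * (r\<^sup>2 * (norm \<xi>)\<^sup>2)"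
        unfolding k(1) by (simp add: power_mult_distrib r_def)
      then show ?thesis using k(2) r by (simp add: t_def)
    qed
    have "W x = (\<phi> r)\<^sup>2 * (norm (c *\<^sub>R \<xi> + ((d - c) * (x \<bullet> \<xi>) / r\<^sup>2) *\<^sub>R x))\<^sup>2"
      unfolding W_def transform_C1(2)[OF w x] pullback_\<rho>(2)[OF w x]
      by (simp add: power_mult_distrib \<xi>_def r_def c_def d_def)
    also have "(norm (c *\<^sub>R \<xi> + ((d - c) * (x \<bullet> \<xi>) / r\<^sup>2) *\<^sub>R x))\<^sup>2 = c\<^sup>2 * ((norm \<xi>)\<^sup>2 - t) + d\<^sup>2 * t"
    proof -
      define k where "k = (d - c) * (x \<bullet> \<xi>) / r\<^sup>2"
      have "(norm (c *\<^sub>R \<xi> + k *\<^sub>R x))\<^sup>2 = c\<^sup>2 * (norm \<xi>)\<^sup>2 + 2 * c * (k * (x \<bullet> \<xi>)) + k\<^sup>2 * r\<^sup>2"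
        unfolding power2_norm_eq_inner r(3)[symmetric]
        by (simp add: inner_add_left inner_add_right inner_commute power2_eq_square algebra_simps)
      moreover have "k * (x \<bullet> \<xi>) = (d - c) * t" by (simp add: k_def t_def power2_eq_square)
      moreover have "k\<^sup>2 * r\<^sup>2 = (d - c)\<^sup>2 * t"
        using r by (simp add: k_def t_def power_mult_distrib power_divide power2_eq_square)
      ultimately show ?thesis
        unfolding k_def[symmetric] by (simp add: power2_eq_square algebra_simps)
    qed
    finally have "W x = (\<phi> r)\<^sup>2 * c\<^sup>2 * ((norm \<xi>)\<^sup>2 - t) + ((\<phi> r)\<^sup>2 * d\<^sup>2) * t"
      by (simp add: algebra_simps)
    also have "(\<phi> r)\<^sup>2 * d\<^sup>2 = jac r" using jac_eq(2)[OF r(1,2)] by (simp add: d_def r_def)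
    finally show ?thesis using t trad unfolding \<xi>_def r_def c_def by blast
  qed
  have out: "W x = 0" if "\<not> (0 < norm x \<and> norm x < 1)" for x
  proof -
    have "u x = 0 \<and> grad u x = 0" if u: "u \<in> C1_annulus 1" for u :: "real^'n \<Rightarrow> real"
    proof (cases "x = 0")
      case True
      obtain a where a: "0 < a" "\<And>x. norm x \<le> a \<Longrightarrow> u x = 0" using C1_annulusD[OF u] by metis
      have "grad u x = 0" by (rule grad_eq_0[of "ball 0 a"]) (use a True in auto)
      then show ?thesis using a True by simp
    next
      case False
      have "u \<in> C1_ball 1" using u by (simp add: C1_annulus_def)
      then show ?thesis using C1_ball_zero[of u 1 x] False \<open>\<not> (0 < norm x \<and> norm x < 1)\<close> by auto
    qed
    from this[OF transform_C1(1)[OF w]] show ?thesis by (simp add: W_def)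
  qed
  have le: "V x \<le> W x" for x
  proof (cases "0 < norm x \<and> norm x < 1")
    case True
    define \<xi> r c where "\<xi> = grad w (radial_map \<rho> x)" and "r = norm x" and "c = \<rho> (norm x) / norm x"
    have r: "0 < r" "r < 1" using True by (auto simp: r_def)
    obtain t where t: "t \<le> (norm \<xi>)\<^sup>2" "W x = (\<phi> r)\<^sup>2 * c\<^sup>2 * ((norm \<xi>)\<^sup>2 - t) + jac r * t"
      using eq[of x] True unfolding \<xi>_def r_def c_def by blast
    have "(\<rho>' r)\<^sup>2 \<le> c\<^sup>2" using \<rho>'_le[of r] \<rho>'_pos[of r] r by (intro power_mono) (auto simp: c_def r_def)
    then have "(\<phi> r)\<^sup>2 * (\<rho>' r)\<^sup>2 \<le> (\<phi> r)\<^sup>2 * c\<^sup>2" by (intro mult_left_mono) auto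
    then have "jac r \<le> (\<phi> r)\<^sup>2 * c\<^sup>2" using jac_eq(2)[OF r] by simp
    then have "jac r * ((norm \<xi>)\<^sup>2 - t) \<le> (\<phi> r)\<^sup>2 * c\<^sup>2 * ((norm \<xi>)\<^sup>2 - t)"
      using t(1) by (intro mult_right_mono) auto
    then show ?thesis unfolding t(2) V_def using True by (simp add: punct_def \<xi>_def r_def algebra_simps)
  next
    case False
    then have "V x = 0" by (simp add: V_def punct_def)
    then show ?thesis by (simp add: W_def)
  qed
  show "dirichlet w \<le> hardy_deficit \<theta> R (transform w)"
    unfolding gs(2) V(2)[symmetric] by (rule integral_mono[OF V(1) gs(1) le])
  show "hardy_deficit \<theta> R (transform w) = dirichlet w" if "radial w"
  proof -
    have "W x = V x" for x
    proof (cases "0 < norm x \<and> norm x < 1")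
      case True
      then show ?thesis using eq[of x] that unfolding V_def punct_def by auto
    qed (use out in \<open>simp add: V_def punct_def\<close>)
    then have "W = V" by (rule ext)
    then show ?thesis unfolding gs(2) V(2)[symmetric] by simp
  qed
qed

section \<open>The logarithmic weight under the substitution\<close>

definition "weighted_integral \<alpha> u = (LINT x:ball 0 1|lborel. norm x powr (p * (real CARD('n) - 2) / 2 - real CARD('n))
     * X (\<alpha> * norm (x::real^'n)) powr ((p + 2) / 2) * \<bar>u x\<bar> powr p)"

lemma weighted_term_eq: "weighted_term p \<alpha> u = weighted_integral \<alpha> u powr (2 / p)"
  unfolding weighted_term_def weighted_integral_def ..

definition "weight_X \<alpha> x = indicator (ball 0 1) x * (weight p x * X (\<alpha> * norm (x::real^'n)) powr ((p + 2) / 2))"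

lemma weighted_integral_eq: "weighted_integral \<alpha> u = (LINT x|lborel. weight_X \<alpha> x * \<bar>u x\<bar> powr p)"
  unfolding weighted_integral_def set_lebesgue_integral_def weight_X_def weight_def by (simp add: mult.assoc)

lemma weight_X_bound:
  assumes "0 < \<alpha>" "\<alpha> \<le> 1" "0 < norm (x::real^'n)" "norm x < 1"
  shows "\<bar>weight_X \<alpha> x\<bar> \<le> 1 / (norm x)\<^sup>2" "0 \<le> weight_X \<alpha> x"
proof -
  have "\<alpha> * norm x \<le> 1" using assms by (simp add: mult_le_one)
  then have "ln (\<alpha> * norm x) \<le> 0" using assms by simp
  then have X: "0 \<le> X (\<alpha> * norm x)" "X (\<alpha> * norm x) \<le> 1" by (auto simp: X_def divide_le_eq)
  then have "X (\<alpha> * norm x) powr ((p + 2) / 2) \<le> 1 powr ((p + 2) / 2)"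
    using p2 by (intro powr_mono2) auto
  then have "weight p x * X (\<alpha> * norm x) powr ((p + 2) / 2) \<le> weight p x * 1"
    by (intro mult_left_mono) (auto simp: weight_def)
  moreover have w: "0 \<le> weight p x" by (simp add: weight_def)
  moreover have "weight p x \<le> 1 / (norm x)\<^sup>2" using weight_bound[of x 1] assms w by simp
  ultimately show "\<bar>weight_X \<alpha> x\<bar> \<le> 1 / (norm x)\<^sup>2" "0 \<le> weight_X \<alpha> x"
    using assms by (auto simp: weight_X_def)
qed

lemma weight_X_measurable: "weight_X \<alpha> \<in> borel_measurable borel"
proof -
  have [measurable]: "ball (0 :: real^'n) 1 \<in> sets borel" by simp
  note [measurable] = weight_measurable
  have [measurable]: "X \<in> borel_measurable borel" unfolding X_def[abs_def] by measurable
  show ?thesis unfolding weight_X_def[abs_def] by measurable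
qed

lemma weighted_integral_limit:
  fixes u :: "real^'n \<Rightarrow> real"
  assumes "0 < \<alpha>" "\<alpha> \<le> 1" "u \<in> C1_ball 1" "dominated_limit 1 v u"
  shows "(\<lambda>k. weighted_integral \<alpha> (v k)) \<longlonglongrightarrow> weighted_integral \<alpha> u"
  unfolding weighted_integral_eq
  using weighted_limit(2)[OF n3 _ assms(3,4) _ weight_X_measurable, of p \<alpha> 1] weight_X_bound assms(1,2) p2 by auto

lemma weighted_integrable:
  fixes u :: "real^'n \<Rightarrow> real"
  assumes "0 < \<alpha>" "\<alpha> \<le> 1" "u \<in> C1_ball 1"
  shows "integrable lborel (\<lambda>x. weight_X \<alpha> x * \<bar>u x\<bar> powr p)"
  using weighted_limit(1)[OF n3 _ assms(3) dominated_limit_const[OF assms(3)] _ weight_X_measurable, of p \<alpha> 1]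
    weight_X_bound assms(1,2) p2 by auto

lemma weighted_integral_nonneg: "0 \<le> weighted_integral \<alpha> u"
  unfolding weighted_integral_eq weight_X_def weight_def by (intro integral_nonneg_AE) auto

text \<open>The p powers of g in \<phi>^p and the factor g^(-2) of the Jacobian combine to g^(p +
  2), and \<rho>^(-N) = N H does the same for the powers of \<rho>. All powers of r cancel, so
  exactly X N H g^2 to the power (p + 2) / 2 is left over.\<close>

lemma weight_transform:
  fixes w :: "real^'n \<Rightarrow> real"
  assumes x: "0 < norm x" "norm x < 1" and X: "0 \<le> X (\<alpha> * norm x)"
  shows "weight_X \<alpha> x * \<bar>transform w x\<bar> powr p =
    (X (\<alpha> * norm x) * (N * H (norm x) * (g (norm x))\<^sup>2)) powr ((p + 2) / 2) *
      (jac (norm x) * (weight p (radial_map \<rho> x) * \<bar>w (radial_map \<rho> x)\<bar> powr p))"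
proof -
  define r \<sigma> G where "r = norm x" and "\<sigma> = \<rho> (norm x)" and "G = g (norm x)"
  let ?a = "p * (real CARD('n) - 2) / 2 - real CARD('n)"
  have pos: "0 < r" "0 < \<sigma>" "0 < G" using x \<rho>_pos[of r] g_bounds(3)[of r] by (auto simp: r_def \<sigma>_def G_def)
  have NH: "N * H r = \<sigma> powr (- N)"
    using \<rho>_powr_N[of r] x H_ge_1[of r] N by (simp add: r_def \<sigma>_def powr_minus)
  have tr: "\<bar>transform w x\<bar> powr p = (r powr (- (N / 2)) * G) powr p * \<bar>w (radial_map \<rho> x)\<bar> powr p"
    using x pos by (simp add: transform_def \<phi>_def annulus_pullback_def abs_mult powr_mult r_def G_def)
  have j: "jac r = \<sigma> powr (N + 1) / (r * G\<^sup>2) * (\<sigma> / r) powr (N + 1)"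
    using jac_eq(1)[of r] x by (simp add: r_def \<rho>'_def \<sigma>_def G_def)
  have key: "r powr ?a * (r powr (- (N / 2)) * G) powr p =
      (\<sigma> powr (- N) * G\<^sup>2) powr ((p + 2) / 2) * (\<sigma> powr (N + 1) / (r * G\<^sup>2) * (\<sigma> / r) powr (N + 1) * \<sigma> powr ?a)"
    (is "?L = ?R")
  proof -
    have n: "real CARD('n) = N + 2" by (simp add: N_eq)
    \<comment> \<open>Both sides are positive products of powers, so comparing logarithms reduces
      the identity to a linear one in ln r, ln \<sigma> and ln G.\<close>
    have LR: "0 < ?L" "0 < ?R" using pos by auto
    have "ln ?L = ?a * ln r + p * (- (N / 2) * ln r + ln G)"
      using pos by (simp add: ln_mult)
    moreover have "ln ?R = (p + 2) / 2 * (- N * ln \<sigma> + 2 * ln G) + ((N + 1) * ln \<sigma> - (ln r + 2 * ln G) + (N + 1) * (ln \<sigma> - ln r) + ?a * ln \<sigma>)"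
      using pos by (simp add: ln_mult ln_div ln_realpow)
    moreover have "?a * ln r + p * (- (N / 2) * ln r + ln G) =
       (p + 2) / 2 * (- N * ln \<sigma> + 2 * ln G) + ((N + 1) * ln \<sigma> - (ln r + 2 * ln G) + (N + 1) * (ln \<sigma> - ln r) + ?a * ln \<sigma>)"
      unfolding n by (simp add: field_simps)
    ultimately show ?thesis using ln_inj_iff[OF LR] by simp
  qed
  have Y: "(X (\<alpha> * r) * (N * H r * G\<^sup>2)) powr ((p + 2) / 2) = X (\<alpha> * r) powr ((p + 2) / 2) * (\<sigma> powr (- N) * G\<^sup>2) powr ((p + 2) / 2)"
    unfolding NH using X pos by (simp add: powr_mult r_def)
  have nr: "weight p (radial_map \<rho> x) = \<sigma> powr ?a"
    unfolding weight_def norm_radial_\<rho>[OF x] by (simp add: \<sigma>_def)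
  have "weight_X \<alpha> x * \<bar>transform w x\<bar> powr p =
      X (\<alpha> * r) powr ((p + 2) / 2) * (r powr ?a * (r powr (- (N / 2)) * G) powr p) * \<bar>w (radial_map \<rho> x)\<bar> powr p"
    unfolding tr weight_X_def weight_def using x by (simp add: r_def)
  also have "\<dots> = (X (\<alpha> * r) * (N * H r * G\<^sup>2)) powr ((p + 2) / 2) *
      (jac r * (weight p (radial_map \<rho> x) * \<bar>w (radial_map \<rho> x)\<bar> powr p))"
    unfolding key Y j nr by (simp only: mult_ac)
  finally show ?thesis by (simp only: r_def G_def)
qed

lemma Lp_transform:
  fixes w :: "real^'n \<Rightarrow> real"
  assumes w: "w \<in> C1_annulus \<rho>\<^sub>1"
  defines "V \<equiv> \<lambda>x. indicator punct x * (jac (norm x) * (weight p (radial_map \<rho> x) * \<bar>w (radial_map \<rho> x)\<bar> powr p))"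
  shows "integrable lborel V" "(LINT x|lborel. V x) = Lp_term p w"
proof -
  have wb: "w \<in> C1_ball \<rho>\<^sub>1" using w by (simp add: C1_annulus_def)
  have "w 0 = 0" using C1_annulusD[OF w] by (metis norm_zero less_imp_le)
  then show "integrable lborel V" "(LINT x|lborel. V x) = Lp_term p w"
    unfolding V_def Lp_term_def
    using change_of_variables[of "\<lambda>y. weight p y * \<bar>w y\<bar> powr p"] Lp_integrable[OF \<rho>\<^sub>1_pos wb] C1_ball_zero[OF wb] by auto
qed

lemma weighted_upper:
  fixes w :: "real^'n \<Rightarrow> real"
  assumes w: "w \<in> C1_annulus \<rho>\<^sub>1" and \<alpha>: "0 < \<alpha>" "\<alpha> \<le> 1" "ln \<alpha> \<le> 1 - A\<^sup>2 - Q 1 + Q 0"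
  shows "weighted_integral \<alpha> (transform w) \<le> N powr ((p + 2) / 2) * Lp_term p w"
proof -
  define V where "V = (\<lambda>x. indicator punct x * (jac (norm x) * (weight p (radial_map \<rho> x) * \<bar>w (radial_map \<rho> x)\<bar> powr p)))"
  note V = Lp_transform[OF w, folded V_def]
  have tb: "transform w \<in> C1_ball 1" using transform_C1(1)[OF w] by (simp add: C1_annulus_def)
  have le: "weight_X \<alpha> x * \<bar>transform w x\<bar> powr p \<le> N powr ((p + 2) / 2) * V x" for x
  proof (cases "0 < norm x \<and> norm x < 1")
    case True
    define r where "r = norm x"
    have r: "0 < r" "r < 1" using True by (auto simp: r_def)
    note XU = X_upper[OF r \<alpha>(1,3)]
    have X0: "0 \<le> X (\<alpha> * r)" using XU(1) by (simp add: X_def)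
    have "0 \<le> X (\<alpha> * r) * (N * H r * (g r)\<^sup>2)" using X0 N H_ge_1[of r] r by (intro mult_nonneg_nonneg) auto
    then have Y: "(X (\<alpha> * r) * (N * H r * (g r)\<^sup>2)) powr ((p + 2) / 2) \<le> N powr ((p + 2) / 2)"
      using XU(2) p2 by (intro powr_mono2) auto
    have "0 \<le> jac r * (weight p (radial_map \<rho> x) * \<bar>w (radial_map \<rho> x)\<bar> powr p)"
      using jac_eq(3)[OF r] by (simp add: weight_def)
    from mult_right_mono[OF Y this] show ?thesis
      using weight_transform[of x \<alpha> w] True X0 by (simp add: V_def punct_def r_def)
  next
    case False
    then have "transform w x = 0" by (auto simp: transform_def annulus_pullback_def)
    moreover have "V x = 0" using False by (auto simp: V_def punct_def)
    ultimately show ?thesis by simp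
  qed
  have "weighted_integral \<alpha> (transform w) \<le> (LINT x|lborel. N powr ((p + 2) / 2) * V x)"
    unfolding weighted_integral_eq
    by (rule integral_mono[OF weighted_integrable[OF \<alpha>(1,2) tb] _ le]) (use V(1) in simp)
  then show ?thesis using V(2) by simp
qed

text \<open>Since w vanishes for \<rho> r0 \<le> |y|, the transformed function lives in |x| < r0,
  the only region where the lower bound on the factor is available.\<close>

lemma weighted_lower:
  fixes w :: "real^'n \<Rightarrow> real"
  assumes w: "w \<in> C1_annulus \<rho>\<^sub>1" and \<alpha>: "0 < \<alpha>" "\<alpha> \<le> 1" and c: "0 \<le> c"
    and r0: "0 < r0" "r0 < 1" "\<And>r. 0 < r \<Longrightarrow> r < r0 \<Longrightarrow> c \<le> X (\<alpha> * r) * (N * H r * (g r)\<^sup>2)"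
    and z: "\<And>y. \<rho> r0 \<le> norm y \<Longrightarrow> w y = 0"
  shows "c powr ((p + 2) / 2) * Lp_term p w \<le> weighted_integral \<alpha> (transform w)"
proof -
  define V where "V = (\<lambda>x. indicator punct x * (jac (norm x) * (weight p (radial_map \<rho> x) * \<bar>w (radial_map \<rho> x)\<bar> powr p)))"
  note V = Lp_transform[OF w, folded V_def]
  have tb: "transform w \<in> C1_ball 1" using transform_C1(1)[OF w] by (simp add: C1_annulus_def)
  have le: "c powr ((p + 2) / 2) * V x \<le> weight_X \<alpha> x * \<bar>transform w x\<bar> powr p" for x
  proof (cases "0 < norm x \<and> norm x < 1")
    case True
    define r where "r = norm x"
    have r: "0 < r" "r < 1" using True by (auto simp: r_def)
    show ?thesis
    proof (cases "r < r0")
      case True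
      have "\<alpha> * r \<le> 1" using \<alpha> r by (simp add: mult_le_one)
      then have "ln (\<alpha> * r) \<le> 0" using \<alpha>(1) r(1) by simp
      then have X0: "0 \<le> X (\<alpha> * r)" by (simp add: X_def)
      have Y: "c powr ((p + 2) / 2) \<le> (X (\<alpha> * r) * (N * H r * (g r)\<^sup>2)) powr ((p + 2) / 2)"
        using r0(3)[OF r(1) True] c p2 by (intro powr_mono2) auto
      have "0 \<le> jac r * (weight p (radial_map \<rho> x) * \<bar>w (radial_map \<rho> x)\<bar> powr p)"
        using jac_eq(3)[OF r] by (simp add: weight_def)
      from mult_right_mono[OF Y this] show ?thesis
        using weight_transform[of x \<alpha> w] \<open>0 < norm x \<and> norm x < 1\<close> X0 by (simp add: V_def punct_def r_def)
    next
      case False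
      then have "\<rho> r0 \<le> \<rho> r" using \<rho>_strict_mono[of r0 r] r0 r by (cases "r0 = r") auto
      then have "w (radial_map \<rho> x) = 0" using z norm_radial_\<rho>[of x] r by (simp add: r_def)
      then show ?thesis using p2 by (simp add: V_def transform_def annulus_pullback_def)
    qed
  next
    case False
    then have "transform w x = 0" by (auto simp: transform_def annulus_pullback_def)
    moreover have "V x = 0" using False by (auto simp: V_def punct_def)
    ultimately show ?thesis by simp
  qed
  have "(LINT x|lborel. c powr ((p + 2) / 2) * V x) \<le> weighted_integral \<alpha> (transform w)"
    unfolding weighted_integral_eq
    by (rule integral_mono[OF _ weighted_integrable[OF \<alpha>(1,2) tb] le]) (use V(1) in simp)
  then show ?thesis using V(2) by simp
qed

text \<open>For u vanishing near the origin the chain runs through w: the weight estimate costs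
  N^((p + 2) / p), which the constant compensates, then the Sobolev inequality for w applies, then
  the deficit estimate. Cutoffs remove the condition at the origin.\<close>

lemma hardy_sobolev_inequality:
  fixes u :: "real^'n \<Rightarrow> real"
  assumes \<alpha>: "0 < \<alpha>" "\<alpha> \<le> 1" "ln \<alpha> \<le> 1 - A\<^sup>2 - Q 1 + Q 0" and u: "u \<in> test_functions (ball 0 1)"
  shows "N powr (- (p + 2) / p) * S_const TYPE('n) p * weighted_term p \<alpha> u \<le> hardy_deficit \<theta> R u"
proof -
  let ?S = "S_const TYPE('n) p" and ?K = "N powr (- (p + 2) / p) * S_const TYPE('n) p"
  have an: "?K * weighted_integral \<alpha> v powr (2 / p) \<le> hardy_deficit \<theta> R v" if v: "v \<in> C1_annulus 1" for v :: "real^'n \<Rightarrow> real"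
  proof -
    obtain w where w: "w \<in> C1_annulus \<rho>\<^sub>1" "transform w = v" using transform_surj[OF v] .
    have wb: "w \<in> C1_ball \<rho>\<^sub>1" using w by (simp add: C1_annulus_def)
    have "weighted_integral \<alpha> v powr (2 / p) \<le> (N powr ((p + 2) / 2) * Lp_term p w) powr (2 / p)"
      using weighted_upper[OF w(1) \<alpha>] weighted_integral_nonneg p2 w(2) by (intro powr_mono2) auto
    also have "\<dots> = N powr ((p + 2) / p) * Lp_term p w powr (2 / p)"
    proof -
      have e: "(p + 2) / 2 * (2 / p) = (p + 2) / p" using p2 by (simp add: field_simps)
      have "(N powr ((p + 2) / 2) * Lp_term p w) powr (2 / p) = (N powr ((p + 2) / 2)) powr (2 / p) * Lp_term p w powr (2 / p)"
        by (rule powr_mult)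
      then show ?thesis by (simp only: powr_powr e)
    qed
    finally have "?K * weighted_integral \<alpha> v powr (2 / p) \<le> ?K * (N powr ((p + 2) / p) * Lp_term p w powr (2 / p))"
      using S_const_nonneg N by (intro mult_left_mono) auto
    also have "\<dots> = ?S * Lp_term p w powr (2 / p)"
    proof -
      have "N powr (- (p + 2) / p) * N powr ((p + 2) / p) = 1"
        using N p2 by (simp flip: powr_add add: add_divide_distrib[symmetric])
      then have "?K * (N powr ((p + 2) / p) * L) = ?S * L" for L by (metis mult.assoc mult.commute mult_1)
      then show ?thesis .
    qed
    also have "\<dots> \<le> dirichlet w" by (rule sobolev_bound_C1[OF sobolev_bound_S_const wb \<rho>\<^sub>1_pos])
    also have "\<dots> \<le> hardy_deficit \<theta> R v" using transform_deficit(1)[OF w(1)] w(2) by simp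
    finally show ?thesis .
  qed
  have ub: "u \<in> C1_ball 1" using test_functions_C1_ball[OF u] by simp
  obtain v where v: "\<And>k. v k \<in> C1_annulus 1" "dominated_limit 1 v u" using C1_ball_cutoff[OF ub] by metis
  show ?thesis
    unfolding weighted_term_eq
    by (rule inequality_limit[OF an[OF v(1)] hardy_deficit_limit[OF ub v(2)] weighted_integral_limit[OF \<alpha>(1,2) ub v(2)]])
      (use p2 weighted_integral_nonneg in auto)
qed

end

subsection \<open>Dilations\<close>

lemma integral_dilation:
  fixes f :: "'a::euclidean_space \<Rightarrow> real"
  assumes c: "0 < c" and f: "f \<in> borel_measurable borel"
  shows "(LINT x|lborel. f (c *\<^sub>R x)) = (LINT x|lborel. f x) / c ^ DIM('a)"
proof -
  have L: "lborel = density (distr lborel borel (\<lambda>x::'a. c *\<^sub>R x)) (\<lambda>_. ennreal (c ^ DIM('a)))"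
    using lborel_affine[of c 0] c by simp
  have "(LINT x|lborel. f x) = (LINT x|density (distr lborel borel (\<lambda>x::'a. c *\<^sub>R x)) (\<lambda>_. ennreal (c ^ DIM('a))). f x)"
    using L by simp
  also have "\<dots> = (LINT x|distr lborel borel (\<lambda>x::'a. c *\<^sub>R x). c ^ DIM('a) *\<^sub>R f x)"
    using c f by (intro integral_density) auto
  also have "\<dots> = (LINT x|lborel. c ^ DIM('a) *\<^sub>R f (c *\<^sub>R x))"
    using f by (intro integral_distr) auto
  finally show ?thesis using c by simp
qed

definition dilate :: "real \<Rightarrow> (real^'n::finite \<Rightarrow> real) \<Rightarrow> real^'n \<Rightarrow> real" where
  "dilate \<mu> w x = w (\<mu> *\<^sub>R x)"

lemma C1_dilate:
  fixes w :: "real^'n::finite \<Rightarrow> real"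
  assumes "C1 w"
  shows "C1 (dilate \<mu> w)" "grad (dilate \<mu> w) x = \<mu> *\<^sub>R grad w (\<mu> *\<^sub>R x)"
proof -
  have "(dilate \<mu> w has_derivative (\<lambda>h. (\<mu> *\<^sub>R grad w (\<mu> *\<^sub>R x)) \<bullet> h)) (at x)" for x
  proof -
    have "((\<lambda>x. \<mu> *\<^sub>R x) has_derivative (\<lambda>h. \<mu> *\<^sub>R h)) (at x)" by (auto intro!: derivative_eq_intros)
    from has_derivative_compose[OF this C1D(1)[OF assms]] show ?thesis by (simp add: dilate_def[abs_def])
  qed
  moreover have "continuous_on UNIV (\<lambda>x. \<mu> *\<^sub>R grad w (\<mu> *\<^sub>R x))"
    by (intro continuous_intros continuous_on_compose2[OF C1D(2)[OF assms]]) auto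
  ultimately show "C1 (dilate \<mu> w)" "grad (dilate \<mu> w) x = \<mu> *\<^sub>R grad w (\<mu> *\<^sub>R x)"
    using C1I[of "dilate \<mu> w" "\<lambda>x. \<mu> *\<^sub>R grad w (\<mu> *\<^sub>R x)"] by auto
qed

lemma radial_dilate: "radial w \<Longrightarrow> radial (dilate \<mu> w)"
  by (simp add: radial_def dilate_def)

lemma C1_annulus_dilate:
  fixes w :: "real^'n::finite \<Rightarrow> real"
  assumes w: "w \<in> C1_annulus b" and \<mu>: "0 < \<mu>"
  shows "dilate \<mu> w \<in> C1_annulus (b / \<mu>)"
proof -
  obtain a c where a: "0 < a" "\<And>x. norm x \<le> a \<Longrightarrow> w x = 0" and c: "0 \<le> c" "c < b" "\<And>x. c \<le> norm x \<Longrightarrow> w x = 0" and C1: "C1 w"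
    using C1_annulusD[OF w] by metis
  have "dilate \<mu> w x = 0" if "c / \<mu> \<le> norm x" for x
    using c(3)[of "\<mu> *\<^sub>R x"] that \<mu> by (simp add: dilate_def divide_le_eq mult.commute)
  moreover have "0 \<le> c / \<mu>" "c / \<mu> < b / \<mu>" using c \<mu> by (auto simp: divide_strict_right_mono)
  ultimately have "dilate \<mu> w \<in> C1_ball (b / \<mu>)"
    unfolding C1_ball_def using C1_dilate(1)[OF C1] by blast
  moreover have "dilate \<mu> w x = 0" if "norm x \<le> a / \<mu>" for x
    using a(2)[of "\<mu> *\<^sub>R x"] that \<mu> by (simp add: dilate_def le_divide_eq mult.commute)
  moreover have "0 < a / \<mu>" using a \<mu> by simp
  ultimately show ?thesis unfolding C1_annulus_def by blast
qed

lemma dirichlet_dilate: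
  fixes w :: "real^'n::finite \<Rightarrow> real"
  assumes w: "C1 w" and \<mu>: "0 < \<mu>"
  shows "dirichlet (dilate \<mu> w) = \<mu> powr (2 - real CARD('n)) * dirichlet w"
proof -
  have m: "(\<lambda>y. \<mu>\<^sup>2 * (norm (grad w y))\<^sup>2) \<in> borel_measurable borel"
    using C1D(2)[OF w] by (intro borel_measurable_continuous_onI continuous_intros)
  have "dirichlet (dilate \<mu> w) = (LINT x|lborel. \<mu>\<^sup>2 * (norm (grad w (\<mu> *\<^sub>R x)))\<^sup>2)"
    unfolding dirichlet_def C1_dilate(2)[OF w] by (simp add: power_mult_distrib)
  also have "\<dots> = (LINT x|lborel. \<mu>\<^sup>2 * (norm (grad w x))\<^sup>2) / \<mu> ^ CARD('n)"
    using integral_dilation[OF \<mu> m] by simp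
  also have "\<dots> = \<mu>\<^sup>2 / \<mu> ^ CARD('n) * dirichlet w" by (simp add: dirichlet_def)
  also have "\<mu>\<^sup>2 / \<mu> ^ CARD('n) = \<mu> powr (2 - real CARD('n))"
    using \<mu> by (simp add: powr_diff powr_numeral powr_realpow)
  finally show ?thesis .
qed

text \<open>Raised to the power 2 / p the factor becomes \<mu>^(2 - n), as for the Dirichlet
  integral. The Sobolev quotient is therefore invariant, and supports can be shrunk at no
  cost.\<close>

lemma Lp_dilate:
  fixes w :: "real^'n::finite \<Rightarrow> real"
  assumes w: "C1 w" and \<mu>: "0 < \<mu>"
  shows "Lp_term p (dilate \<mu> w) = \<mu> powr (- (p * (real CARD('n) - 2) / 2)) * Lp_term p w"
proof -
  let ?a = "p * (real CARD('n) - 2) / 2 - real CARD('n)"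
  have [measurable]: "w \<in> borel_measurable borel" using C1_continuous[OF w] by (rule borel_measurable_continuous_onI)
  have m: "(\<lambda>y. \<mu> powr (- ?a) * (weight p y * \<bar>w y\<bar> powr p)) \<in> borel_measurable borel"
    unfolding weight_def by measurable
  have "weight p x * \<bar>dilate \<mu> w x\<bar> powr p = \<mu> powr (- ?a) * (weight p (\<mu> *\<^sub>R x) * \<bar>w (\<mu> *\<^sub>R x)\<bar> powr p)" for x
  proof -
    have "\<mu> powr (- ?a) * weight p (\<mu> *\<^sub>R x) = weight p x"
      unfolding weight_def using \<mu> by (simp add: powr_mult mult.assoc[symmetric] flip: powr_add)
    then show ?thesis by (simp add: dilate_def mult.assoc[symmetric])
  qed
  then have "Lp_term p (dilate \<mu> w) = (LINT x|lborel. \<mu> powr (- ?a) * (weight p (\<mu> *\<^sub>R x) * \<bar>w (\<mu> *\<^sub>R x)\<bar> powr p))"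
    unfolding Lp_term_def by simp
  also have "\<dots> = (LINT x|lborel. \<mu> powr (- ?a) * (weight p x * \<bar>w x\<bar> powr p)) / \<mu> ^ CARD('n)"
    using integral_dilation[OF \<mu> m] by simp
  also have "\<dots> = \<mu> powr (- ?a) / \<mu> ^ CARD('n) * Lp_term p w" by (simp add: Lp_term_def)
  also have "\<mu> powr (- ?a) / \<mu> ^ CARD('n) = \<mu> powr (- ?a - real CARD('n))"
    using \<mu> by (simp only: powr_diff powr_realpow)
  finally show ?thesis by simp
qed

lemma C1_annulus_mono: "b \<le> b' \<Longrightarrow> C1_annulus b \<subseteq> C1_annulus b'"
  using C1_ball_mono unfolding C1_annulus_def by blast

section \<open>Upper bound for the constant, tested on radial functions\<close>

context hardy_setting
begin

text \<open>A dilation moves the support to where the factor is at least (1 - \<eta>) N. The deficit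
  of a radial function equals its Dirichlet integral, so the only loss is \<eta>, which finally
  tends to 0.\<close>

lemma sharp_radial:
  fixes w :: "real^'n \<Rightarrow> real"
  assumes \<alpha>: "0 < \<alpha>" "\<alpha> \<le> 1" and C: "0 \<le> C"
    and hyp: "\<And>u :: real^'n \<Rightarrow> real. u \<in> C1_annulus 1 \<Longrightarrow> C * weighted_integral \<alpha> u powr (2 / p) \<le> hardy_deficit \<theta> R u"
    and w: "w \<in> C1_annulus b" "radial w" "0 < b"
  shows "C * N powr ((p + 2) / p) * Lp_term p w powr (2 / p) \<le> dirichlet w"
proof -
  have C1: "C1 w" using C1_annulusD[OF w(1)] by metis
  have step: "C * (((1 - \<eta>) * N) powr ((p + 2) / p) * Lp_term p w powr (2 / p)) \<le> dirichlet w" if \<eta>: "0 < \<eta>" "\<eta> < 1" for \<eta>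
  proof -
    define c where "c = (1 - \<eta>) * N"
    have c: "0 \<le> c" using \<eta> N by (simp add: c_def)
    obtain r0 where r0: "0 < r0" "r0 < 1" "\<And>r. 0 < r \<Longrightarrow> r < r0 \<Longrightarrow> c \<le> X (\<alpha> * r) * (N * H r * (g r)\<^sup>2)"
      using X_lower[OF \<alpha>(1) \<eta>(1)] unfolding c_def by metis
    \<comment> \<open>This dilation carries the ball of radius b to the ball of radius \<rho>
      r0.\<close>
    define \<mu> where "\<mu> = b / \<rho> r0"
    have \<rho>0: "0 < \<rho> r0" using \<rho>_pos r0 by simp
    then have \<mu>: "0 < \<mu>" "b / \<mu> = \<rho> r0" using w(3) by (auto simp: \<mu>_def)
    let ?w = "dilate \<mu> w"
    have w': "?w \<in> C1_annulus (\<rho> r0)" using C1_annulus_dilate[OF w(1) \<mu>(1)] \<mu>(2) by simp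
    then have w1: "?w \<in> C1_annulus \<rho>\<^sub>1" using C1_annulus_mono[of "\<rho> r0" \<rho>\<^sub>1] \<rho>_less[of r0] r0 by auto
    have z: "?w y = 0" if "\<rho> r0 \<le> norm y" for y
      using C1_ball_zero(1)[of ?w "\<rho> r0" y] w' that by (simp add: C1_annulus_def)
    let ?L = "\<mu> powr (- (p * N / 2))"
    have Lp: "Lp_term p ?w = ?L * Lp_term p w" using Lp_dilate[OF C1 \<mu>(1), of p] by (simp add: N_eq)
    have Lexp: "(p + 2) / 2 * (2 / p) = (p + 2) / p" "- (p * N / 2) * (2 / p) = - N" using p2 by (simp_all add: field_simps)
    have "(c powr ((p + 2) / 2) * Lp_term p ?w) powr (2 / p) = (c powr ((p + 2) / 2)) powr (2 / p) * ((?L powr (2 / p)) * Lp_term p w powr (2 / p))"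
      unfolding Lp using Lp_term_nonneg[of p w] by (simp add: powr_mult)
    also have "\<dots> = c powr ((p + 2) / p) * (\<mu> powr (- N) * Lp_term p w powr (2 / p))"
      by (simp only: powr_powr Lexp)
    finally have e: "(c powr ((p + 2) / 2) * Lp_term p ?w) powr (2 / p) = c powr ((p + 2) / p) * (\<mu> powr (- N) * Lp_term p w powr (2 / p))" .
    have "(c powr ((p + 2) / 2) * Lp_term p ?w) powr (2 / p) \<le> weighted_integral \<alpha> (transform ?w) powr (2 / p)"
      using weighted_lower[OF w1 \<alpha> c r0 z] Lp_term_nonneg[of p ?w] p2 by (intro powr_mono2) auto
    then have "C * (c powr ((p + 2) / p) * (\<mu> powr (- N) * Lp_term p w powr (2 / p))) \<le> C * weighted_integral \<alpha> (transform ?w) powr (2 / p)"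
      unfolding e using C by (rule mult_left_mono)
    also have "\<dots> \<le> hardy_deficit \<theta> R (transform ?w)" using hyp[OF transform_C1(1)[OF w1]] .
    also have "\<dots> = dirichlet ?w" using transform_deficit(2)[OF w1 radial_dilate[OF w(2)]] .
    also have "\<dots> = \<mu> powr (- N) * dirichlet w" using dirichlet_dilate[OF C1 \<mu>(1)] by (simp add: N_eq)
    finally have "\<mu> powr (- N) * (C * (c powr ((p + 2) / p) * Lp_term p w powr (2 / p))) \<le> \<mu> powr (- N) * dirichlet w"
      by (simp add: mult_ac)
    then show ?thesis using \<mu>(1) by (simp add: c_def)
  qed
  \<comment> \<open>The double successor keeps every \<eta> k strictly below 1.\<close>
  define \<eta> where "\<eta> = (\<lambda>k. inverse (real (Suc (Suc k))))"
  have "\<eta> \<longlonglongrightarrow> 0" unfolding \<eta>_def using LIMSEQ_Suc[OF LIMSEQ_inverse_real_of_nat] by simp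
  then have "(\<lambda>k. C * (((1 - \<eta> k) * N) powr ((p + 2) / p) * Lp_term p w powr (2 / p))) \<longlonglongrightarrow>
      C * (((1 - 0) * N) powr ((p + 2) / p) * Lp_term p w powr (2 / p))"
    using N by (intro tendsto_intros) auto
  moreover have "0 < \<eta> k" "\<eta> k < 1" for k by (auto simp: \<eta>_def inverse_eq_divide)
  ultimately have "C * (((1 - 0) * N) powr ((p + 2) / p) * Lp_term p w powr (2 / p)) \<le> dirichlet w"
    by (intro LIMSEQ_le_const2[where X = "\<lambda>k. C * (((1 - \<eta> k) * N) powr ((p + 2) / p) * Lp_term p w powr (2 / p))"]) (use step in auto)
  then show ?thesis by (simp add: mult.assoc)
qed

text \<open>Density is used twice: the hypothesis passes from test functions to C1 functions on the
  annulus, and the conclusion from radial functions vanishing near the origin to all radial ones,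
  since the cutoffs are radial.\<close>

lemma sharp_radial_ball:
  fixes w :: "real^'n \<Rightarrow> real"
  assumes \<alpha>: "0 < \<alpha>" "\<alpha> \<le> 1" and C: "0 \<le> C"
    and hyp: "\<And>u :: real^'n \<Rightarrow> real. u \<in> test_functions (ball 0 1) \<Longrightarrow> C * weighted_term p \<alpha> u \<le> hardy_deficit \<theta> R u"
    and w: "w \<in> C1_ball b" "radial w" "0 < b"
  shows "C * N powr ((p + 2) / p) * Lp_term p w powr (2 / p) \<le> dirichlet w"
proof -
  have hyp': "C * weighted_integral \<alpha> u powr (2 / p) \<le> hardy_deficit \<theta> R u" if "u \<in> C1_annulus 1" for u :: "real^'n \<Rightarrow> real"
  proof -
    have u: "u \<in> C1_ball 1" using that by (simp add: C1_annulus_def)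
    obtain v where v: "\<And>k. v k \<in> test_functions (ball 0 1)" "dominated_limit 1 v u" using C1_ball_approx[OF u] by blast
    show ?thesis
      by (rule inequality_limit[OF hyp[OF v(1), unfolded weighted_term_eq] hardy_deficit_limit[OF u v(2)] weighted_integral_limit[OF \<alpha> u v(2)]])
        (use p2 weighted_integral_nonneg in auto)
  qed
  obtain v where v: "\<And>k. v k \<in> C1_annulus b" "dominated_limit b v w" "\<And>k. radial (v k)" using C1_ball_cutoff[OF w(1)] w(2) by metis
  show ?thesis
    by (rule inequality_limit[OF sharp_radial[OF \<alpha> C hyp' v(1) v(3) w(3)] dirichlet_limit[OF n3 w(3,1) v(2)] Lp_limit[OF w(3,1) v(2)]])
      (use p2 Lp_term_nonneg in auto)
qed

end

subsection \<open>Polarization\<close>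

text \<open>The mirror is the perpendicular bisector of a and b. As a is nearer to the origin, the
  origin lies strictly on the side of a, where \<open>side\<close> is negative.\<close>

locale reflection =
  fixes a b :: "real^'n::finite"
  assumes norm_less: "norm a < norm b"
begin

definition "d = b - a"
definition "m = ((1 / 2) *\<^sub>R (a + b)) \<bullet> d"
definition "side x = x \<bullet> d - m"
definition "reflect x = x - (2 * side x / (d \<bullet> d)) *\<^sub>R d"
text \<open>Two-point rearrangement: of the values at x and at its mirror image, the larger one goes
  to the half-space containing the origin.\<close>

definition "polarize v x = (if side x \<le> 0 then max (v x) (v (reflect x)) else min (v x) (v (reflect x) :: real))"

lemma dd: "0 < d \<bullet> d"
  using norm_less by (auto simp: d_def)

lemma side_reflect: "side (reflect x) = - side x"
proof -
  have "2 * side x / (d \<bullet> d) * (d \<bullet> d) = 2 * side x" using dd by simp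
  then have "reflect x \<bullet> d = x \<bullet> d - 2 * side x" unfolding reflect_def inner_diff_left inner_scaleR_left by simp
  then show ?thesis by (simp add: side_def)
qed

lemma reflect_reflect: "reflect (reflect x) = x"
  unfolding reflect_def[of "reflect x"] side_reflect by (simp add: reflect_def)

lemma m_eq: "m = ((norm b)\<^sup>2 - (norm a)\<^sup>2) / 2"
  unfolding m_def d_def power2_norm_eq_inner inner_scaleR_left inner_add_left inner_diff_right
  by (simp add: inner_commute field_simps)

lemma m_pos: "0 < m"
  unfolding m_eq using norm_less by (simp add: power_strict_mono)

lemma reflect_a: "reflect a = b"
proof -
  have "side a = - (d \<bullet> d) / 2"
    unfolding side_def m_eq power2_norm_eq_inner
    by (simp add: d_def inner_diff_left inner_diff_right inner_commute field_simps)
  then show ?thesis using dd by (simp add: reflect_def d_def)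
qed

lemma inner_minus_scaleR: "(z - c *\<^sub>R d) \<bullet> (z - c *\<^sub>R d) = z \<bullet> z - 2 * c * (z \<bullet> d) + c\<^sup>2 * (d \<bullet> d)"
  by (simp add: inner_diff_left inner_diff_right inner_commute power2_eq_square algebra_simps)

lemma norm_reflect: "(norm (reflect x))\<^sup>2 = (norm x)\<^sup>2 - 4 * (side x / (d \<bullet> d) * m)"
proof -
  define c where "c = side x / (d \<bullet> d)"
  have cd: "c * (d \<bullet> d) = side x" using dd by (simp add: c_def)
  have "(norm (reflect x))\<^sup>2 = (norm x)\<^sup>2 - 4 * c * (x \<bullet> d) + 4 * c * (c * (d \<bullet> d))"
    unfolding power2_norm_eq_inner reflect_def times_divide_eq_right[symmetric] c_def[symmetric] inner_minus_scaleR
    by (simp add: power2_eq_square mult_ac)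
  also have "\<dots> = (norm x)\<^sup>2 - 4 * (c * m)"
    unfolding cd by (simp add: side_def algebra_simps)
  finally show ?thesis by (simp add: c_def)
qed

lemma norm_reflect_le:
  "side x \<le> 0 \<Longrightarrow> norm x \<le> norm (reflect x)" "0 \<le> side x \<Longrightarrow> norm (reflect x) \<le> norm x"
  "side x < 0 \<Longrightarrow> norm x < norm (reflect x)"
proof -
  { assume "side x \<le> 0"
    then have "side x / (d \<bullet> d) * m \<le> 0" using dd m_pos by (intro mult_nonpos_nonneg divide_nonpos_pos) auto
    then have "(norm x)\<^sup>2 \<le> (norm (reflect x))\<^sup>2" unfolding norm_reflect by simp
    then show "norm x \<le> norm (reflect x)" by (rule power2_le_imp_le) simp }
  { assume "0 \<le> side x"
    then have "0 \<le> side x / (d \<bullet> d) * m" using dd m_pos by (intro mult_nonneg_nonneg divide_nonneg_pos) auto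
    then have "(norm (reflect x))\<^sup>2 \<le> (norm x)\<^sup>2" unfolding norm_reflect by simp
    then show "norm (reflect x) \<le> norm x" by (rule power2_le_imp_le) simp }
  { assume "side x < 0"
    then have "side x / (d \<bullet> d) * m < 0" using dd m_pos by (intro mult_neg_pos divide_neg_pos) auto
    then have "(norm x)\<^sup>2 < (norm (reflect x))\<^sup>2" unfolding norm_reflect by simp
    then show "norm x < norm (reflect x)" by (rule power2_less_imp_less) simp }
qed

text \<open>The sign of the correction term decides everything: reflecting y increases its distance
  to x when both lie on the same side and decreases it when they lie on opposite sides.\<close>

lemma dist_reflect2: "(dist x (reflect y))\<^sup>2 = (dist x y)\<^sup>2 + 4 * side x * side y / (d \<bullet> d)"
proof -
  define c where "c = side y / (d \<bullet> d)"
  have cd: "c * (d \<bullet> d) = side y" using dd by (simp add: c_def)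
  have e: "x - reflect y = (x - y) - (- 2 * c) *\<^sub>R d" by (simp add: reflect_def c_def)
  have "(dist x (reflect y))\<^sup>2 = (dist x y)\<^sup>2 + 4 * c * ((x - y) \<bullet> d) + 4 * c * (c * (d \<bullet> d))"
    unfolding dist_norm power2_norm_eq_inner e inner_minus_scaleR by (simp add: power2_eq_square)
  also have "\<dots> = (dist x y)\<^sup>2 + 4 * (c * side x)"
    unfolding cd by (simp add: side_def inner_diff_left algebra_simps)
  finally show ?thesis by (simp add: c_def mult_ac)
qed

lemma dist_reflect_reflect: "dist (reflect x) (reflect y) = dist x y"
proof -
  have "(dist (reflect x) (reflect y))\<^sup>2 = (dist y (reflect x))\<^sup>2 + 4 * side (reflect x) * side y / (d \<bullet> d)"
    using dist_reflect2[of "reflect x" y] by (simp add: dist_commute)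
  also have "\<dots> = (dist x y)\<^sup>2" unfolding dist_reflect2 side_reflect by (simp add: dist_commute)
  finally show ?thesis by simp
qed

lemma dist_reflect_swap: "dist (reflect x) y = dist x (reflect y)"
  using dist_reflect_reflect[of x "reflect y"] by (simp add: reflect_reflect)

lemma dist_reflect_ge: "0 \<le> side x * side y \<Longrightarrow> dist x y \<le> dist x (reflect y)"
proof -
  assume "0 \<le> side x * side y"
  then have "0 \<le> 4 * side x * side y / (d \<bullet> d)" using dd by (simp add: mult.assoc)
  then have "(dist x y)\<^sup>2 \<le> (dist x (reflect y))\<^sup>2" unfolding dist_reflect2 by simp
  then show ?thesis by (rule power2_le_imp_le) simp
qed

lemma dist_reflect_le: "side x * side y \<le> 0 \<Longrightarrow> dist x (reflect y) \<le> dist x y"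
proof -
  assume "side x * side y \<le> 0"
  then have "4 * side x * side y / (d \<bullet> d) \<le> 0" using dd by (simp add: mult.assoc divide_nonpos_pos)
  then have "(dist x (reflect y))\<^sup>2 \<le> (dist x y)\<^sup>2" unfolding dist_reflect2 by simp
  then show ?thesis by (rule power2_le_imp_le) simp
qed

lemma distr_reflection: "distr lborel lborel reflect = lborel"
proof -
  define T where "T = (\<lambda>x::real^'n. x - (2 * (x \<bullet> d) / (d \<bullet> d)) *\<^sub>R d)"
  define c where "c = (2 * m / (d \<bullet> d)) *\<^sub>R d"
  have T: "orthogonal_transformation T"
    unfolding orthogonal_transformation_def
  proof
    show "linear T" by (auto simp: T_def inner_add_left algebra_simps add_divide_distrib intro!: linearI)
    show "\<forall>v w. T v \<bullet> T w = v \<bullet> w"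
      using dd by (simp add: T_def inner_diff_left inner_diff_right inner_commute field_simps)
  qed
  have r: "reflect = (\<lambda>x. x + c) \<circ> T"
    by (auto simp: reflect_def side_def T_def c_def inner_diff_left diff_divide_distrib algebra_simps fun_eq_iff)
  have m: "T \<in> measurable lborel lborel" "(\<lambda>x. x + c) \<in> measurable lborel lborel"
    using orthogonal_transformation_linear[OF T] linear_conv_bounded_linear
    by (auto intro!: borel_measurable_continuous_onI linear_continuous_on)
  have "distr lborel lborel reflect = distr (distr lborel lborel T) lborel (\<lambda>x. x + c)"
    unfolding r by (rule distr_distr[symmetric, OF m(2,1)])
  then show ?thesis by (simp add: distr_orthogonal[OF T] distr_translate)
qed

lemma reflect_continuous: "continuous_on UNIV reflect"
  unfolding reflect_def side_def by (intro continuous_intros) (use dd in auto)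

lemma reflect_measurable [measurable]: "reflect \<in> borel_measurable borel"
  using reflect_continuous by (rule borel_measurable_continuous_onI)

lemma nn_integral_reflect:
  assumes "f \<in> borel_measurable borel"
  shows "(\<integral>\<^sup>+x. f (reflect x) \<partial>lborel) = (\<integral>\<^sup>+x. f x \<partial>lborel)"
  using nn_integral_distr[of reflect lborel lborel f] assms by (simp add: distr_reflection)

lemma integral_reflection:
  fixes f :: "real^'n \<Rightarrow> real"
  assumes "f \<in> borel_measurable borel"
  shows "(LINT x|lborel. f (reflect x)) = (LINT x|lborel. f x)"
    "integrable lborel (\<lambda>x. f (reflect x)) \<longleftrightarrow> integrable lborel f"
  using integral_distr[of reflect lborel lborel f] integrable_distr_eq[of reflect lborel lborel f] assms
  by (simp_all add: distr_reflection)

lemma polarize_reflect: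
  "side x = 0 \<or> (polarize v (reflect x) = (if side x \<le> 0 then min (v x) (v (reflect x)) else max (v x) (v (reflect x))))"
  by (auto simp: polarize_def side_reflect reflect_reflect max.commute min.commute)

lemma polarize_side_0: "side x = 0 \<Longrightarrow> polarize v x = v x \<and> reflect x = x"
  by (simp add: polarize_def reflect_def)

lemma polarize_cases: "polarize v x = v x \<or> polarize v x = v (reflect x)"
  by (auto simp: polarize_def max_def min_def)

lemma abs_max_min_diff:
  fixes p q r s c :: real
  assumes "\<bar>p - r\<bar> \<le> c" "\<bar>q - s\<bar> \<le> c"
  shows "\<bar>max p q - max r s\<bar> \<le> c" "\<bar>min p q - min r s\<bar> \<le> c"
  using assms by linarith+

text \<open>On equal sides maxima are compared with maxima and minima with minima. On opposite sides
  reflecting one point shortens the distance, so each of the four possible pairs of values satisfies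
  the bound.\<close>

lemma polarize_lipschitz:
  assumes L: "\<And>x y. \<bar>v x - v y\<bar> \<le> L * norm (x - y)" and "0 \<le> L"
  shows "\<bar>polarize v x - polarize v y\<bar> \<le> L * norm (x - y)"
proof -
  have L': "\<bar>v x - v y\<bar> \<le> L * dist x y" for x y using L by (simp add: dist_norm)
  have 1: "\<bar>v x - v y\<bar> \<le> L * dist x y" "\<bar>v (reflect x) - v (reflect y)\<bar> \<le> L * dist x y"
    using L'[of x y] L'[of "reflect x" "reflect y"] by (simp_all add: dist_reflect_reflect)
  show ?thesis
  proof (cases "(side x \<le> 0) = (side y \<le> 0)")
    case True
    then show ?thesis using abs_max_min_diff[OF 1] by (auto simp: polarize_def dist_norm)
  next
    case False
    then have "side x * side y \<le> 0" by (auto simp: mult_le_0_iff)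
    then have "L * dist x (reflect y) \<le> L * dist x y" using dist_reflect_le \<open>0 \<le> L\<close> by (intro mult_left_mono) auto
    then have 2: "\<bar>v x - v (reflect y)\<bar> \<le> L * dist x y" "\<bar>v (reflect x) - v y\<bar> \<le> L * dist x y"
      using L'[of x "reflect y"] L'[of "reflect x" y] by (simp_all add: dist_reflect_swap)
    show ?thesis using polarize_cases[of v x] polarize_cases[of v y] 1 2 unfolding dist_norm by metis
  qed
qed

lemma polarize_support:
  assumes "\<And>x. c \<le> norm x \<Longrightarrow> v x = 0" "\<And>x. 0 \<le> v x" "c \<le> norm x"
  shows "polarize v x = 0"
proof (cases "side x \<le> 0")
  case True
  then have "c \<le> norm (reflect x)" using norm_reflect_le(1)[of x] assms(3) by linarith
  then show ?thesis using assms by (simp add: polarize_def)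
qed (use assms in \<open>simp add: polarize_def\<close>)

text \<open>The rearrangement inequality for two numbers: polarization pairs the larger of the two
  values with the larger weight, and \<Psi> preserves their order.\<close>

lemma polarize_weight_pointwise:
  fixes q :: "real^'n \<Rightarrow> real" and \<Psi> :: "real \<Rightarrow> real"
  assumes q: "\<And>x. side x < 0 \<Longrightarrow> q (reflect x) \<le> q x" and \<Psi>: "\<And>s t. 0 \<le> s \<Longrightarrow> s \<le> t \<Longrightarrow> \<Psi> s \<le> \<Psi> t" and v: "\<And>x. 0 \<le> v x"
  shows "q x * \<Psi> (v x) + q (reflect x) * \<Psi> (v (reflect x)) \<le> q x * \<Psi> (polarize v x) + q (reflect x) * \<Psi> (polarize v (reflect x))"
proof -
  have main: "q x * \<Psi> (v x) + q (reflect x) * \<Psi> (v (reflect x)) \<le> q x * \<Psi> (polarize v x) + q (reflect x) * \<Psi> (polarize v (reflect x))"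
    if s: "side x < 0" for x
  proof (cases "v x \<le> v (reflect x)")
    case True
    have "(q x - q (reflect x)) * (\<Psi> (v (reflect x)) - \<Psi> (v x)) \<ge> 0"
      using q[OF s] \<Psi>[OF v[of x] True] by (intro mult_nonneg_nonneg) auto
    then show ?thesis using True s polarize_reflect[of x v] by (simp add: polarize_def algebra_simps max_def min_def)
  next
    case False
    then show ?thesis using s polarize_reflect[of x v] by (simp add: polarize_def max_def min_def)
  qed
  consider "side x < 0" | "side x = 0" | "side x > 0" by linarith
  then show ?thesis
  proof cases
    case 1 then show ?thesis by (rule main)
  next
    case 2 then show ?thesis using polarize_side_0[of x v] by simp
  next
    case 3
    then have "side (reflect x) < 0" by (simp add: side_reflect)
    from main[OF this] show ?thesis by (simp add: reflect_reflect add.commute)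
  qed
qed

end

text \<open>A nonlocal substitute for the Dirichlet integral that makes sense without derivatives.
  With extended nonnegative values, Fubini and Fatou apply to every measurable v.\<close>

definition energy :: "real \<Rightarrow> (real^'n::finite \<Rightarrow> real) \<Rightarrow> ennreal" where
  "energy t v = (\<integral>\<^sup>+x. \<integral>\<^sup>+y. ennreal (if dist x y < t then (v y - v x)\<^sup>2 else 0) \<partial>lborel \<partial>lborel)"

lemma max_min_rearrangement:
  fixes a a' b b' :: real
  shows "(max a a' - max b b')\<^sup>2 + (min a a' - min b b')\<^sup>2 \<le> (a - b)\<^sup>2 + (a' - b')\<^sup>2"
proof -
  have *: "0 \<le> (a - a') * (b' - b)" if "(a' \<le> a \<and> b \<le> b') \<or> (a \<le> a' \<and> b' \<le> b)"
    using that by (auto intro: mult_nonneg_nonneg mult_nonpos_nonpos)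
  show ?thesis
    by (cases "a \<le> a'"; cases "b \<le> b'") (use * in \<open>auto simp: max_def min_def power2_eq_square algebra_simps\<close>)
qed

context reflection
begin

text \<open>Reflection in either variable preserves the measure, so four times the energy is the
  integral of \<open>F\<close>, the sum over the four pairs formed from x, y and their mirror
  images. The comparison is then pointwise on these four points.\<close>

lemma polarize_energy:
  assumes v[measurable]: "v \<in> borel_measurable borel"
  shows "energy t (polarize v) \<le> energy t v"
proof -
  define f where "f = (\<lambda>(v :: real^'n \<Rightarrow> real) x y. if dist x y < t then (v y - v x)\<^sup>2 else 0)"
  define F where "F = (\<lambda>v x y. f v x y + f v x (reflect y) + f v (reflect x) y + f v (reflect x) (reflect y))"
  have nonneg: "0 \<le> f v x y" for v x y by (simp add: f_def)
  have sideM[measurable]: "side \<in> borel_measurable borel"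
    unfolding side_def[abs_def] by (intro borel_measurable_continuous_onI continuous_intros)
  have pv: "polarize v \<in> borel_measurable borel" unfolding polarize_def[abs_def] by measurable
  have four: "4 * energy t w = (\<integral>\<^sup>+x. \<integral>\<^sup>+y. ennreal (F w x y) \<partial>lborel \<partial>lborel)"
    if w[measurable]: "w \<in> borel_measurable borel" for w
  proof -
    have fm[measurable]: "(\<lambda>z. f w (fst z) (snd z)) \<in> borel_measurable (borel \<Otimes>\<^sub>M borel)" unfolding f_def by measurable
    define I where "I = (\<lambda>x. \<integral>\<^sup>+y. ennreal (f w x y) \<partial>lborel)"
    have fx: "(\<lambda>y. ennreal (f w x y)) \<in> borel_measurable borel" for x unfolding f_def by measurable
    have Im[measurable]: "I \<in> borel_measurable borel" unfolding I_def f_def by measurable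
    have IR: "(\<integral>\<^sup>+y. ennreal (f w x (reflect y)) \<partial>lborel) = I x" for x
      unfolding I_def by (rule nn_integral_reflect[OF fx])
    have fr: "(\<lambda>y. ennreal (f w x (reflect y))) \<in> borel_measurable borel" for x unfolding f_def by measurable
    have "(\<integral>\<^sup>+y. ennreal (F w x y) \<partial>lborel) = 2 * I x + 2 * I (reflect x)" for x
    proof -
      have "(\<integral>\<^sup>+y. ennreal (F w x y) \<partial>lborel) = (\<integral>\<^sup>+y. ennreal (f w x y) + ennreal (f w x (reflect y))
          + ennreal (f w (reflect x) y) + ennreal (f w (reflect x) (reflect y)) \<partial>lborel)"
        unfolding F_def by (simp add: nonneg ennreal_plus[symmetric] add_nonneg_nonneg del: ennreal_plus)
      also have "\<dots> = I x + I x + I (reflect x) + I (reflect x)"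
        using fx fr by (simp add: nn_integral_add IR) (simp add: I_def)
      finally show ?thesis by (simp add: mult_2 add.assoc)
    qed
    then have "(\<integral>\<^sup>+x. \<integral>\<^sup>+y. ennreal (F w x y) \<partial>lborel \<partial>lborel) = (\<integral>\<^sup>+x. 2 * I x + 2 * I (reflect x) \<partial>lborel)" by simp
    also have "\<dots> = 2 * (\<integral>\<^sup>+x. I x \<partial>lborel) + 2 * (\<integral>\<^sup>+x. I (reflect x) \<partial>lborel)"
      by (subst nn_integral_add) (auto simp: nn_integral_cmult)
    also have "\<dots> = 4 * (\<integral>\<^sup>+x. I x \<partial>lborel)"
      unfolding nn_integral_reflect[OF Im] by (simp flip: distrib_right)
    finally show ?thesis by (simp add: energy_def I_def f_def)
  qed
  have point: "F (polarize v) x y \<le> F v x y" for x y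
  proof -
    \<comment> \<open>k1 belongs to the pairs (x, y) and (reflect x, reflect y), k2 to the two
      crossed pairs. For points on the same side k2 \<le> k1, otherwise k1 \<le> k2.\<close>
    define k1 k2 where "k1 = (if dist x y < t then 1 else 0 :: real)" and "k2 = (if dist x (reflect y) < t then 1 else 0 :: real)"
    have Fk: "F w x y = k1 * ((w x - w y)\<^sup>2 + (w (reflect x) - w (reflect y))\<^sup>2) + k2 * ((w x - w (reflect y))\<^sup>2 + (w (reflect x) - w y)\<^sup>2)" for w
      by (simp add: F_def f_def k1_def k2_def dist_reflect_reflect dist_reflect_swap reflect_reflect power2_commute)
    have k: "0 \<le> k1" "0 \<le> k2" by (auto simp: k1_def k2_def)
    have pr: "polarize v (reflect z) = (if side z < 0 then min (v z) (v (reflect z)) else max (v z) (v (reflect z)))"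
        "polarize v z = (if side z < 0 then max (v z) (v (reflect z)) else min (v z) (v (reflect z)))" for z
      using polarize_reflect[of z v] polarize_side_0[of z v] by (auto simp: polarize_def)
    have sum4: "(Mx - My)\<^sup>2 + (mx - my)\<^sup>2 + ((Mx - my)\<^sup>2 + (mx - My)\<^sup>2) = (a - b)\<^sup>2 + (a' - b')\<^sup>2 + ((a - b')\<^sup>2 + (a' - b)\<^sup>2)"
      if "(Mx, mx) = (a, a') \<or> (Mx, mx) = (a', a)" "(My, my) = (b, b') \<or> (My, my) = (b', b)" for Mx mx My my a a' b b' :: real
      using that by auto
    have mm: "(max p q, min p q) = (p, q) \<or> (max p q, min p q) = (q, p)" "(min p q, max p q) = (p, q) \<or> (min p q, max p q) = (q, p)" for p q :: real
      by (auto simp: max_def min_def)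
    \<comment> \<open>Polarization only permutes values within mirror pairs, so the total of all
      four squared differences is preserved; it suffices that the group with the larger coefficient
      does not grow.\<close>
    have lin: "k1 * A1 + k2 * A2 \<le> k1 * B1 + k2 * B2"
      if "A1 + A2 = B1 + B2" "(k2 \<le> k1 \<and> A1 \<le> B1) \<or> (k1 \<le> k2 \<and> A2 \<le> B2)" for A1 A2 B1 B2 :: real
    proof -
      have "k1 * B1 + k2 * B2 - (k1 * A1 + k2 * A2) = (k1 - k2) * (B1 - A1)"
      proof -
        have B2: "B2 = A1 + A2 - B1" using that(1) by simp
        show ?thesis unfolding B2 by (simp add: algebra_simps)
      qed
      moreover have "0 \<le> (k1 - k2) * (B1 - A1)"
        using that by (auto intro: mult_nonneg_nonneg mult_nonpos_nonpos)
      ultimately show ?thesis by linarith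
    qed
    have pair: "(polarize v z, polarize v (reflect z)) = (v z, v (reflect z)) \<or> (polarize v z, polarize v (reflect z)) = (v (reflect z), v z)" for z
      using mm[of "v z" "v (reflect z)"] pr[of z] by (cases "side z < 0") auto
    show ?thesis
      unfolding Fk
    proof (rule lin)
      show "(polarize v x - polarize v y)\<^sup>2 + (polarize v (reflect x) - polarize v (reflect y))\<^sup>2 +
          ((polarize v x - polarize v (reflect y))\<^sup>2 + (polarize v (reflect x) - polarize v y)\<^sup>2) =
          (v x - v y)\<^sup>2 + (v (reflect x) - v (reflect y))\<^sup>2 + ((v x - v (reflect y))\<^sup>2 + (v (reflect x) - v y)\<^sup>2)"
        by (rule sum4[OF pair pair])
      show "k2 \<le> k1 \<and> (polarize v x - polarize v y)\<^sup>2 + (polarize v (reflect x) - polarize v (reflect y))\<^sup>2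
              \<le> (v x - v y)\<^sup>2 + (v (reflect x) - v (reflect y))\<^sup>2 \<or>
          k1 \<le> k2 \<and> (polarize v x - polarize v (reflect y))\<^sup>2 + (polarize v (reflect x) - polarize v y)\<^sup>2
              \<le> (v x - v (reflect y))\<^sup>2 + (v (reflect x) - v y)\<^sup>2"
      proof (cases "(side x < 0) = (side y < 0)")
        case True
        then have "0 \<le> side x * side y" by (auto simp: zero_le_mult_iff not_less)
        then have "k2 \<le> k1" using dist_reflect_ge[of x y] by (auto simp: k1_def k2_def)
        then show ?thesis
          using True max_min_rearrangement[of "v x" "v (reflect x)" "v y" "v (reflect y)"] pr[of x] pr[of y]
          by (cases "side x < 0") (simp_all add: add.commute)
      next
        case False
        then have "side x * side y \<le> 0" by (auto simp: mult_le_0_iff not_less)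
        then have "k1 \<le> k2" using dist_reflect_le[of x y] by (auto simp: k1_def k2_def)
        then show ?thesis
          using False max_min_rearrangement[of "v x" "v (reflect x)" "v (reflect y)" "v y"] pr[of x] pr[of y]
          by (cases "side x < 0") (simp_all add: add.commute max.commute min.commute)
      qed
    qed
  qed
  have "4 * energy t (polarize v) \<le> 4 * energy t v"
    unfolding four[OF pv] four[OF v] by (intro nn_integral_mono ennreal_leI point)
  then show ?thesis by (simp add: ennreal_mult_le_mult_iff)
qed

end

subsection \<open>Difference quotients and the Dirichlet integral\<close>

lemma nn_integral_translate:
  fixes f :: "'a::euclidean_space \<Rightarrow> ennreal"
  assumes "f \<in> borel_measurable borel"
  shows "(\<integral>\<^sup>+x. f (x + c) \<partial>lborel) = (\<integral>\<^sup>+x. f x \<partial>lborel)"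
  using nn_integral_distr[of "\<lambda>x. x + c" lborel lborel f] assms by (simp add: distr_translate)

lemma nn_integral_dilation:
  fixes f :: "'a::euclidean_space \<Rightarrow> ennreal"
  assumes c: "0 < c" and f[measurable]: "f \<in> borel_measurable borel"
  shows "(\<integral>\<^sup>+x. f x \<partial>lborel) = ennreal (c ^ DIM('a)) * (\<integral>\<^sup>+x. f (c *\<^sub>R x) \<partial>lborel)"
proof -
  have L: "lborel = density (distr lborel borel (\<lambda>x::'a. c *\<^sub>R x)) (\<lambda>_. ennreal (c ^ DIM('a)))"
    using lborel_affine[of c 0] c by simp
  have "(\<integral>\<^sup>+x. f x \<partial>lborel) = (\<integral>\<^sup>+x. f x \<partial>density (distr lborel borel (\<lambda>x::'a. c *\<^sub>R x)) (\<lambda>_. ennreal (c ^ DIM('a))))"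
    using L by simp
  also have "\<dots> = (\<integral>\<^sup>+x. ennreal (c ^ DIM('a)) * f x \<partial>distr lborel borel (\<lambda>x::'a. c *\<^sub>R x))"
    using f by (intro nn_integral_density) auto
  also have "\<dots> = (\<integral>\<^sup>+x. ennreal (c ^ DIM('a)) * f (c *\<^sub>R x) \<partial>lborel)"
    using f by (intro nn_integral_distr) auto
  also have "\<dots> = ennreal (c ^ DIM('a)) * (\<integral>\<^sup>+x. f (c *\<^sub>R x) \<partial>lborel)"
    using f by (intro nn_integral_cmult) measurable
  finally show ?thesis .
qed

lemma energy_pair:
  assumes [measurable]: "v \<in> borel_measurable borel"
  shows "energy t v = (\<integral>\<^sup>+z. ennreal (if dist (fst z) (snd z) < t then (v (snd z) - v (fst z))\<^sup>2 else 0) \<partial>(lborel \<Otimes>\<^sub>M lborel))"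
proof -
  have "(\<lambda>z. ennreal (if dist (fst z) (snd z) < t then (v (snd z) - v (fst z))\<^sup>2 else 0)) \<in> borel_measurable (lborel \<Otimes>\<^sub>M lborel)"
    by measurable
  from lborel.nn_integral_fst[OF this] show ?thesis unfolding energy_def fst_conv snd_conv .
qed

lemma energy_lower_semicontinuous:
  fixes v :: "nat \<Rightarrow> real^'n::finite \<Rightarrow> real"
  assumes m: "\<And>k. v k \<in> borel_measurable borel" "w \<in> borel_measurable borel"
    and lim: "\<And>x. (\<lambda>k. v k x) \<longlonglongrightarrow> w x" and le: "\<And>k. energy t (v k) \<le> B"
  shows "energy t w \<le> B"
proof -
  note [measurable] = m
  define f where "f = (\<lambda>u z. ennreal (if dist (fst z) (snd z :: real^'n) < t then (u (snd z) - u (fst z) :: real)\<^sup>2 else 0))"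
  have fm: "f (v k) \<in> borel_measurable (lborel \<Otimes>\<^sub>M lborel)" for k unfolding f_def by measurable
  have "(\<lambda>k. f (v k) z) \<longlonglongrightarrow> f w z" for z
    unfolding f_def by (auto intro!: tendsto_ennrealI tendsto_intros lim)
  then have "liminf (\<lambda>k. f (v k) z) = f w z" for z by (intro lim_imp_Liminf) auto
  then have "energy t w = (\<integral>\<^sup>+z. liminf (\<lambda>k. f (v k) z) \<partial>(lborel \<Otimes>\<^sub>M lborel))"
    unfolding energy_pair[OF m(2)] by (simp add: f_def)
  also have "\<dots> \<le> liminf (\<lambda>k. \<integral>\<^sup>+z. f (v k) z \<partial>(lborel \<Otimes>\<^sub>M lborel))"
    by (rule nn_integral_liminf[OF fm])
  also have "\<dots> = liminf (\<lambda>k. energy t (v k))" unfolding energy_pair[OF m(1)] f_def ..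
  also have "\<dots> \<le> B" using le by (intro Liminf_le) auto
  finally show ?thesis .
qed

lemma energy_translate:
  assumes [measurable]: "v \<in> borel_measurable borel"
  shows "energy t v = (\<integral>\<^sup>+x. \<integral>\<^sup>+z. ennreal (if norm z < t then (v (x + z) - v x)\<^sup>2 else 0) \<partial>lborel \<partial>lborel)"
proof -
  have "(\<integral>\<^sup>+y. ennreal (if dist x y < t then (v y - v x)\<^sup>2 else 0) \<partial>lborel)
      = (\<integral>\<^sup>+z. ennreal (if norm z < t then (v (x + z) - v x)\<^sup>2 else 0) \<partial>lborel)" for x
    using nn_integral_translate[of "\<lambda>y. ennreal (if dist x y < t then (v y - v x)\<^sup>2 else 0)" x]
    by (simp add: dist_norm add.commute[of x] cong: if_cong)
  then show ?thesis unfolding energy_def by simp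
qed

lemma energy_slices:
  assumes [measurable]: "v \<in> borel_measurable borel"
  shows "energy t v = (\<integral>\<^sup>+z. (if norm z < t then \<integral>\<^sup>+x. ennreal ((v (x + z) - v x)\<^sup>2) \<partial>lborel else 0) \<partial>lborel)"
proof -
  have "energy t v = (\<integral>\<^sup>+z. \<integral>\<^sup>+x. ennreal (if norm z < t then (v (x + z) - v x)\<^sup>2 else 0) \<partial>lborel \<partial>lborel)"
    unfolding energy_translate[OF assms] by (rule lborel_pair.Fubini'[symmetric]) measurable
  also have "\<dots> = (\<integral>\<^sup>+z. (if norm z < t then \<integral>\<^sup>+x. ennreal ((v (x + z) - v x)\<^sup>2) \<partial>lborel else 0) \<partial>lborel)"
    by (intro nn_integral_cong) simp
  finally show ?thesis .
qed

text \<open>Jensen's inequality for the probability density \<zeta>, obtained from the nonnegative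
  variance of h(x - y) about its mean c.\<close>

lemma conv_square_le:
  fixes h :: "real^'n::finite \<Rightarrow> real"
  assumes \<zeta>: "mollifier \<delta> \<zeta>" and h: "continuous_on UNIV h"
  shows "ennreal ((conv \<zeta> h x)\<^sup>2) \<le> (\<integral>\<^sup>+y. ennreal (\<zeta> y) * ennreal ((h (x - y))\<^sup>2) \<partial>lborel)"
proof -
  have zc: "continuous_on UNIV \<zeta>" "\<And>x. \<delta> \<le> norm x \<Longrightarrow> \<zeta> x = 0" "\<And>x. 0 \<le> \<zeta> x" "(LINT x|lborel. \<zeta> x) = 1"
    using \<zeta> by (auto simp: mollifier_def)
  define c where "c = conv \<zeta> h x"
  have i: "integrable lborel \<zeta>" "integrable lborel (\<lambda>y. \<zeta> y * h (x - y))" "integrable lborel (\<lambda>y. \<zeta> y * (h (x - y))\<^sup>2)"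
    using integrable_continuous_compact_support[OF zc(1,2)] conv_integrable[of \<zeta> \<delta> h x, OF zc(1,2) h]
      conv_integrable[of \<zeta> \<delta> "\<lambda>y. (h y)\<^sup>2" x, OF zc(1,2)] h by (auto intro!: continuous_intros)
  have c: "(LINT y|lborel. \<zeta> y * h (x - y)) = c" by (simp add: c_def conv_def)
  have "0 \<le> (LINT y|lborel. \<zeta> y * (h (x - y) - c)\<^sup>2)" using zc(3) by (intro integral_nonneg_AE) auto
  also have "(\<lambda>y. \<zeta> y * (h (x - y) - c)\<^sup>2) = (\<lambda>y. \<zeta> y * (h (x - y))\<^sup>2 - 2 * c * (\<zeta> y * h (x - y)) + c\<^sup>2 * \<zeta> y)"
    by (auto simp: power2_eq_square algebra_simps)
  also have "(LINT y|lborel. \<zeta> y * (h (x - y))\<^sup>2 - 2 * c * (\<zeta> y * h (x - y)) + c\<^sup>2 * \<zeta> y) =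
      (LINT y|lborel. \<zeta> y * (h (x - y))\<^sup>2) - 2 * c * c + c\<^sup>2"
    using i by (simp add: c zc(4))
  finally have "c\<^sup>2 \<le> (LINT y|lborel. \<zeta> y * (h (x - y))\<^sup>2)" by (simp add: power2_eq_square)
  then have "ennreal (c\<^sup>2) \<le> ennreal (LINT y|lborel. \<zeta> y * (h (x - y))\<^sup>2)" by (rule ennreal_leI)
  also have "\<dots> = (\<integral>\<^sup>+y. ennreal (\<zeta> y * (h (x - y))\<^sup>2) \<partial>lborel)"
    by (rule nn_integral_eq_integral[symmetric, OF i(3)]) (use zc(3) in simp)
  finally show ?thesis by (simp add: c_def ennreal_mult zc(3))
qed

text \<open>Convolution commutes with the difference v(x + z) - v(x). For each fixed z, Jensen,
  Fubini and translation invariance give the bound, and integrating over z compares the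
  energies.\<close>

lemma energy_conv_le:
  fixes v :: "real^'n::finite \<Rightarrow> real"
  assumes \<zeta>: "mollifier \<delta> \<zeta>" and v: "continuous_on UNIV v"
  shows "energy t (conv \<zeta> v) \<le> energy t v"
proof -
  have zc: "continuous_on UNIV \<zeta>" "\<And>x. \<delta> \<le> norm x \<Longrightarrow> \<zeta> x = 0" "\<And>x. 0 \<le> \<zeta> x" "(LINT x|lborel. \<zeta> x) = 1"
    using \<zeta> by (auto simp: mollifier_def)
  have [measurable]: "v \<in> borel_measurable borel" "\<zeta> \<in> borel_measurable borel"
    using v zc(1) by (auto intro: borel_measurable_continuous_onI)
  have cm: "conv \<zeta> v \<in> borel_measurable borel"
    unfolding conv_def[abs_def] by measurable
  have slice: "(\<integral>\<^sup>+x. ennreal ((conv \<zeta> v (x + z) - conv \<zeta> v x)\<^sup>2) \<partial>lborel) \<le> (\<integral>\<^sup>+x. ennreal ((v (x + z) - v x)\<^sup>2) \<partial>lborel)" for z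
  proof -
    define h where "h = (\<lambda>x. v (x + z) - v x)"
    have h: "continuous_on UNIV h"
      unfolding h_def by (intro continuous_intros continuous_on_compose2[OF v]) auto
    then have [measurable]: "h \<in> borel_measurable borel" by (rule borel_measurable_continuous_onI)
    have "conv \<zeta> v (x + z) - conv \<zeta> v x = conv \<zeta> h x" for x
    proof -
      have "integrable lborel (\<lambda>y. \<zeta> y *\<^sub>R v (x + z - y))" "integrable lborel (\<lambda>y. \<zeta> y *\<^sub>R v (x - y))"
        using conv_integrable[OF zc(1,2) v] by blast+
      then show ?thesis by (simp add: conv_def h_def right_diff_distrib add_diff_eq diff_add_eq add.commute)
    qed
    then have "(\<integral>\<^sup>+x. ennreal ((conv \<zeta> v (x + z) - conv \<zeta> v x)\<^sup>2) \<partial>lborel) = (\<integral>\<^sup>+x. ennreal ((conv \<zeta> h x)\<^sup>2) \<partial>lborel)" by simp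
    also have "\<dots> \<le> (\<integral>\<^sup>+x. \<integral>\<^sup>+y. ennreal (\<zeta> y) * ennreal ((h (x - y))\<^sup>2) \<partial>lborel \<partial>lborel)"
      by (intro nn_integral_mono conv_square_le[OF \<zeta> h])
    also have "\<dots> = (\<integral>\<^sup>+y. \<integral>\<^sup>+x. ennreal (\<zeta> y) * ennreal ((h (x - y))\<^sup>2) \<partial>lborel \<partial>lborel)"
      by (rule lborel_pair.Fubini'[symmetric]) measurable
    also have "\<dots> = (\<integral>\<^sup>+y. ennreal (\<zeta> y) * (\<integral>\<^sup>+x. ennreal ((h x)\<^sup>2) \<partial>lborel) \<partial>lborel)"
    proof (rule nn_integral_cong)
      fix y
      have "(\<integral>\<^sup>+x. ennreal ((h (x - y))\<^sup>2) \<partial>lborel) = (\<integral>\<^sup>+x. ennreal ((h x)\<^sup>2) \<partial>lborel)"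
        using nn_integral_translate[of "\<lambda>x. ennreal ((h x)\<^sup>2)" "- y"] by simp
      then show "(\<integral>\<^sup>+x. ennreal (\<zeta> y) * ennreal ((h (x - y))\<^sup>2) \<partial>lborel) = ennreal (\<zeta> y) * (\<integral>\<^sup>+x. ennreal ((h x)\<^sup>2) \<partial>lborel)"
        by (simp add: nn_integral_cmult)
    qed
    also have "\<dots> = (\<integral>\<^sup>+y. ennreal (\<zeta> y) \<partial>lborel) * (\<integral>\<^sup>+x. ennreal ((h x)\<^sup>2) \<partial>lborel)"
      by (rule nn_integral_multc) measurable
    also have "(\<integral>\<^sup>+y. ennreal (\<zeta> y) \<partial>lborel) = 1"
      using nn_integral_eq_integral[OF integrable_continuous_compact_support[OF zc(1,2)]] zc(3,4) by simp
    finally show ?thesis by (simp add: h_def)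
  qed
  show ?thesis
    unfolding energy_slices[OF cm] energy_slices[OF \<open>v \<in> borel_measurable borel\<close>]
    using slice by (intro nn_integral_mono) simp
qed

text \<open>The energy after substituting t z for the displacement and dividing by t^(n + 2); the
  displacement now ranges over the fixed unit ball, as needed for dominated convergence.\<close>

definition quotient_energy :: "real \<Rightarrow> (real^'n::finite \<Rightarrow> real) \<Rightarrow> ennreal" where
  "quotient_energy t v = (\<integral>\<^sup>+z. ennreal (if norm (snd z) < 1 then ((v (fst z + t *\<^sub>R snd z) - v (fst z)) / t)\<^sup>2 else 0) \<partial>(lborel \<Otimes>\<^sub>M lborel))"

lemma energy_eq_quotient_energy:
  fixes v :: "real^'n::finite \<Rightarrow> real"
  assumes [measurable]: "v \<in> borel_measurable borel" and t: "0 < t"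
  shows "energy t v = ennreal (t ^ (CARD('n) + 2)) * quotient_energy t v"
proof -
  have "(\<integral>\<^sup>+z. ennreal (if norm z < t then (v (x + z) - v x)\<^sup>2 else 0) \<partial>lborel)
      = ennreal (t ^ (CARD('n) + 2)) * (\<integral>\<^sup>+z. ennreal (if norm z < 1 then ((v (x + t *\<^sub>R z) - v x) / t)\<^sup>2 else 0) \<partial>lborel)" for x
  proof -
    have "(\<integral>\<^sup>+z. ennreal (if norm z < t then (v (x + z) - v x)\<^sup>2 else 0) \<partial>lborel)
       = ennreal (t ^ CARD('n)) * (\<integral>\<^sup>+z. ennreal (if norm (t *\<^sub>R z) < t then (v (x + t *\<^sub>R z) - v x)\<^sup>2 else 0) \<partial>lborel)"
      using nn_integral_dilation[OF t, of "\<lambda>z. ennreal (if norm z < t then (v (x + z) - v x)\<^sup>2 else 0)"] by simp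
    also have "(\<integral>\<^sup>+z. ennreal (if norm (t *\<^sub>R z) < t then (v (x + t *\<^sub>R z) - v x)\<^sup>2 else 0) \<partial>lborel)
       = (\<integral>\<^sup>+z. ennreal (t\<^sup>2) * ennreal (if norm z < 1 then ((v (x + t *\<^sub>R z) - v x) / t)\<^sup>2 else 0) \<partial>lborel)"
      using t by (intro nn_integral_cong) (auto simp: ennreal_mult[symmetric] power_divide)
    also have "\<dots> = ennreal (t\<^sup>2) * (\<integral>\<^sup>+z. ennreal (if norm z < 1 then ((v (x + t *\<^sub>R z) - v x) / t)\<^sup>2 else 0) \<partial>lborel)"
      by (rule nn_integral_cmult) measurable
    moreover have "ennreal (t ^ (CARD('n) + 2)) = ennreal (t ^ CARD('n)) * ennreal (t\<^sup>2)"
      unfolding power_add by (rule ennreal_mult) (use t in auto)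
    ultimately show ?thesis by (simp only: mult.assoc)
  qed
  then have "energy t v = (\<integral>\<^sup>+x. ennreal (t ^ (CARD('n) + 2)) * (\<integral>\<^sup>+z. ennreal (if norm z < 1 then ((v (x + t *\<^sub>R z) - v x) / t)\<^sup>2 else 0) \<partial>lborel) \<partial>lborel)"
    unfolding energy_translate[OF assms(1)] by simp
  also have "\<dots> = ennreal (t ^ (CARD('n) + 2)) * (\<integral>\<^sup>+x. \<integral>\<^sup>+z. ennreal (if norm z < 1 then ((v (x + t *\<^sub>R z) - v x) / t)\<^sup>2 else 0) \<partial>lborel \<partial>lborel)"
    by (rule nn_integral_cmult) measurable
  also have "(\<integral>\<^sup>+x. \<integral>\<^sup>+z. ennreal (if norm z < 1 then ((v (x + t *\<^sub>R z) - v x) / t)\<^sup>2 else 0) \<partial>lborel \<partial>lborel) = quotient_energy t v"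
  proof -
    have "(\<lambda>z. ennreal (if norm (snd z) < 1 then ((v (fst z + t *\<^sub>R snd z) - v (fst z)) / t)\<^sup>2 else 0)) \<in> borel_measurable (lborel \<Otimes>\<^sub>M lborel)"
      by measurable
    from lborel.nn_integral_fst[OF this] show ?thesis unfolding quotient_energy_def fst_conv snd_conv .
  qed
  finally show ?thesis .
qed

text \<open>The index \<open>undefined\<close> stands for some coordinate; by rotation invariance
  every unit vector gives the same second moment, which is the content of
  \<open>ball_moment_inner\<close>.\<close>

definition ball_moment :: "'n::finite itself \<Rightarrow> real" where
  "ball_moment _ = (LINT z|lborel. indicator (ball 0 1) z * ((z :: real^'n) $ undefined)\<^sup>2)"

lemma ball_moment_pos: "0 < ball_moment TYPE('n::finite)"
  and integrable_ball_moment: "integrable lborel (\<lambda>z. indicator (ball 0 1) z * ((z :: real^'n) $ undefined)\<^sup>2)"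
proof -
  show i: "integrable lborel (\<lambda>z. indicator (ball 0 1) z * ((z :: real^'n) $ undefined)\<^sup>2)"
  proof (rule Bochner_Integration.integrable_bound)
    show "integrable lborel (indicator (ball (0::real^'n) 1) :: _ \<Rightarrow> real)"
      using emeasure_lborel_ball_finite[of "0::real^'n" 1] by simp
    have "(z $ undefined)\<^sup>2 \<le> 1" if "norm (z::real^'n) < 1" for z
      using component_le_norm_cart[of z undefined] that by (simp add: abs_square_le_1)
    then show "AE z in lborel. norm (indicator (ball 0 1) z * ((z :: real^'n) $ undefined)\<^sup>2) \<le> norm (indicator (ball 0 1) z :: real)"
      by (auto simp: indicator_def)
    have [measurable]: "ball (0::real^'n) 1 \<in> sets borel" by simp
    have [measurable]: "(\<lambda>z::real^'n. z $ undefined) \<in> borel_measurable borel"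
      by (intro borel_measurable_continuous_onI continuous_intros)
    show "(\<lambda>z. indicator (ball 0 1) z * ((z :: real^'n) $ undefined)\<^sup>2) \<in> borel_measurable lborel" by measurable
  qed
  let ?z = "(1 / 2) *\<^sub>R axis undefined 1 :: real^'n"
  show "0 < ball_moment TYPE('n)"
    unfolding ball_moment_def
  proof (rule integral_pos_continuous[OF i])
    have nz: "norm ?z < 1" by simp
    have "isCont (\<lambda>z. (z $ undefined)\<^sup>2) ?z" by (intro continuous_intros)
    moreover have "eventually (\<lambda>z. indicator (ball 0 1) z * ((z :: real^'n) $ undefined)\<^sup>2 = (z $ undefined)\<^sup>2) (nhds ?z)"
      by (rule eventually_nhds_in_open[of "ball 0 1" ?z, THEN eventually_mono]) (use nz in auto)
    ultimately show "isCont (\<lambda>z. indicator (ball 0 1) z * ((z :: real^'n) $ undefined)\<^sup>2) ?z"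
      using isCont_cong by fastforce
    show "0 < indicator (ball 0 1) ?z * (?z $ undefined)\<^sup>2" using nz by simp
  qed simp
qed

lemma ball_moment_inner:
  fixes \<xi> :: "real^'n::finite"
  shows "(\<integral>\<^sup>+z. ennreal (if norm z < 1 then (\<xi> \<bullet> z)\<^sup>2 else 0) \<partial>lborel) = ennreal ((norm \<xi>)\<^sup>2) * ennreal (ball_moment TYPE('n))"
proof -
  have "norm (norm \<xi> *\<^sub>R axis undefined 1 :: real^'n) = norm \<xi>" by simp
  then obtain T :: "real^'n \<Rightarrow> real^'n" where T: "orthogonal_transformation T" "T (norm \<xi> *\<^sub>R axis undefined 1) = \<xi>"
    by (rule orthogonal_transformation_exists)
  have [measurable]: "T \<in> borel_measurable borel"
    using orthogonal_transformation_linear[OF T(1)] linear_conv_bounded_linear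
    by (auto intro!: borel_measurable_continuous_onI linear_continuous_on)
  have "(\<integral>\<^sup>+z. ennreal (if norm z < 1 then (\<xi> \<bullet> z)\<^sup>2 else 0) \<partial>lborel) = (\<integral>\<^sup>+z. ennreal (if norm (T z) < 1 then (\<xi> \<bullet> T z)\<^sup>2 else 0) \<partial>lborel)"
    using nn_integral_distr[of T lborel lborel "\<lambda>z. ennreal (if norm z < 1 then (\<xi> \<bullet> z)\<^sup>2 else 0)"]
    by (simp add: distr_orthogonal[OF T(1)])
  also have "\<dots> = (\<integral>\<^sup>+z. ennreal ((norm \<xi>)\<^sup>2) * ennreal (indicator (ball 0 1) z * ((z :: real^'n) $ undefined)\<^sup>2) \<partial>lborel)"
  proof (rule nn_integral_cong)
    fix z :: "real^'n"
    have "\<xi> \<bullet> T z = norm \<xi> * z $ undefined"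
      using T orthogonal_transformation_def[of T] by (metis inner_axis' inner_scaleR_left real_inner_1_left mult_1)
    then show "ennreal (if norm (T z) < 1 then (\<xi> \<bullet> T z)\<^sup>2 else 0) = ennreal ((norm \<xi>)\<^sup>2) * ennreal (indicator (ball 0 1) z * (z $ undefined)\<^sup>2)"
      using orthogonal_transformation_norm[OF T(1)] by (simp add: ennreal_mult[symmetric] power_mult_distrib indicator_def)
  qed
  also have "\<dots> = ennreal ((norm \<xi>)\<^sup>2) * (\<integral>\<^sup>+z. ennreal (indicator (ball 0 1) z * ((z :: real^'n) $ undefined)\<^sup>2) \<partial>lborel)"
    using borel_measurable_integrable[OF integrable_ball_moment[where 'n = 'n]] by (intro nn_integral_cmult) simp
  also have "(\<integral>\<^sup>+z. ennreal (indicator (ball 0 1) z * ((z :: real^'n) $ undefined)\<^sup>2) \<partial>lborel) = ennreal (ball_moment TYPE('n))"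
    unfolding ball_moment_def by (rule nn_integral_eq_integral[OF integrable_ball_moment]) simp
  finally show ?thesis .
qed

text \<open>The difference quotients converge to directional derivatives and are bounded by the
  Lipschitz constant. Integrating the squared directional derivatives over the unit ball leaves the
  squared gradient times \<open>ball_moment\<close>.\<close>

lemma quotient_energy_limit:
  fixes w :: "real^'n::finite \<Rightarrow> real"
  assumes w: "w \<in> C1_ball b"
  shows "(\<lambda>k. quotient_energy (1 / real (Suc k)) w) \<longlonglongrightarrow> ennreal (dirichlet w * ball_moment TYPE('n))"
proof -
  obtain c where c: "0 \<le> c" "\<And>x. c \<le> norm x \<Longrightarrow> w x = 0" using C1_ballD[OF w] by metis
  obtain L where L: "0 \<le> L" "\<And>x y. \<bar>w x - w y\<bar> \<le> L * norm (x - y)" using C1_ball_lipschitz[OF w] by blast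
  have C1: "C1 w" using w by (simp add: C1_ball_def)
  note [measurable] = C1_ball_measurable[OF w]
  let ?t = "\<lambda>k. 1 / real (Suc k)"
  define f where "f = (\<lambda>k (z :: (real^'n) \<times> (real^'n)).
    ennreal (if norm (snd z) < 1 then ((w (fst z + ?t k *\<^sub>R snd z) - w (fst z)) / ?t k)\<^sup>2 else 0))"
  define f0 where "f0 = (\<lambda>z :: (real^'n) \<times> (real^'n). ennreal (if norm (snd z) < 1 then (grad w (fst z) \<bullet> snd z)\<^sup>2 else 0))"
  \<comment> \<open>Displacements have length below 1, so the difference quotients vanish for x
    outside this enlarged ball.\<close>
  let ?B = "ball (0::real^'n) (c + 1)"
  define g where "g = (\<lambda>z :: (real^'n) \<times> (real^'n). ennreal (L\<^sup>2) * (indicator ?B (fst z) * indicator (ball (0::real^'n) 1) (snd z)))"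
  have [measurable]: "?B \<in> sets borel" "ball (0::real^'n) 1 \<in> sets borel" by simp_all
  have "(\<lambda>k. \<integral>\<^sup>+z. f k z \<partial>(lborel \<Otimes>\<^sub>M lborel)) \<longlonglongrightarrow> (\<integral>\<^sup>+z. f0 z \<partial>(lborel \<Otimes>\<^sub>M lborel))"
  proof (rule nn_integral_dominated_convergence)
    show "f k \<in> borel_measurable (lborel \<Otimes>\<^sub>M lborel)" for k unfolding f_def by measurable
    show "f0 \<in> borel_measurable (lborel \<Otimes>\<^sub>M lborel)" "g \<in> borel_measurable (lborel \<Otimes>\<^sub>M lborel)" unfolding f0_def g_def by measurable
    have "(\<integral>\<^sup>+z. g z \<partial>(lborel \<Otimes>\<^sub>M lborel)) = (\<integral>\<^sup>+x. \<integral>\<^sup>+y. ennreal (L\<^sup>2) * (indicator ?B x * indicator (ball (0::real^'n) 1) y) \<partial>lborel \<partial>lborel)"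
    proof -
      have "g \<in> borel_measurable (lborel \<Otimes>\<^sub>M lborel)" unfolding f0_def g_def by measurable
      from lborel.nn_integral_fst[OF this] show ?thesis unfolding f0_def g_def fst_conv snd_conv by simp
    qed
    also have "\<dots> = ennreal (L\<^sup>2) * (emeasure lborel ?B * emeasure lborel (ball (0::real^'n) 1))"
      by (simp add: nn_integral_cmult nn_integral_multc mult.assoc)
    also have "\<dots> < \<infinity>"
      using emeasure_lborel_ball_finite[of "0::real^'n"] by (simp add: ennreal_mult_less_top)
    finally show "(\<integral>\<^sup>+z. g z \<partial>(lborel \<Otimes>\<^sub>M lborel)) < \<infinity>" .
    show "AE z in lborel \<Otimes>\<^sub>M lborel. f k z \<le> g z" for k
    proof (rule AE_I2)
      fix z :: "(real^'n) \<times> (real^'n)"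
      obtain x s where z: "z = (x, s)" by fastforce
      show "f k z \<le> g z"
      proof (cases "norm s < 1 \<and> norm x < c + 1")
        case True
        have t: "0 < ?t k" by simp
        have "\<bar>w (x + ?t k *\<^sub>R s) - w x\<bar> \<le> L * (?t k * norm s)" using L(2)[of "x + ?t k *\<^sub>R s" x] by simp
        also have "\<dots> \<le> L * (?t k * 1)" using True L(1) t by (intro mult_left_mono) auto
        finally have *: "\<bar>w (x + ?t k *\<^sub>R s) - w x\<bar> \<le> L * (?t k * 1)" .
        have "\<bar>q / \<tau>\<bar> \<le> L" if "0 < \<tau>" "\<bar>q\<bar> \<le> L * (\<tau> * 1)" for q \<tau> :: real
          using that by (simp add: abs_divide pos_divide_le_eq)
        from this[OF t *] have "\<bar>(w (x + ?t k *\<^sub>R s) - w x) / ?t k\<bar> \<le> L" .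
        then have "\<bar>(w (x + ?t k *\<^sub>R s) - w x) / ?t k\<bar>\<^sup>2 \<le> L\<^sup>2" by (intro power_mono) auto
        then have "((w (x + ?t k *\<^sub>R s) - w x) / ?t k)\<^sup>2 \<le> L\<^sup>2" by (simp only: power2_abs)
        then show ?thesis using True by (simp add: z f_def g_def ennreal_leI del: of_nat_Suc)
      next
        case False
        have "w (x + ?t k *\<^sub>R s) = 0 \<and> w x = 0" if "norm s < 1"
        proof -
          have x: "c + 1 \<le> norm x" using False that by simp
          have "norm (?t k *\<^sub>R s) \<le> 1 * 1" unfolding norm_scaleR using that by (intro mult_mono) auto
          then have "c \<le> norm (x + ?t k *\<^sub>R s)" using x norm_diff_ineq[of x "?t k *\<^sub>R s"] by linarith
          then show ?thesis using c x by simp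
        qed
        then show ?thesis by (auto simp: z f_def)
      qed
    qed
    show "AE z in lborel \<Otimes>\<^sub>M lborel. (\<lambda>k. f k z) \<longlonglongrightarrow> f0 z"
    proof (rule AE_I2)
      fix z :: "(real^'n) \<times> (real^'n)"
      obtain x s where z: "z = (x, s)" by fastforce
      have "((\<lambda>t. x + t *\<^sub>R s) has_derivative (\<lambda>t. t *\<^sub>R s)) (at 0)" by (auto intro!: derivative_eq_intros)
      moreover have "(w has_derivative (\<lambda>h. grad w x \<bullet> h)) (at (x + 0 *\<^sub>R s))" using C1D(1)[OF C1] by simp
      ultimately have "((\<lambda>t. w (x + t *\<^sub>R s)) has_derivative (\<lambda>t. grad w x \<bullet> (t *\<^sub>R s))) (at 0)"
        by (rule has_derivative_compose)
      then have "((\<lambda>t. w (x + t *\<^sub>R s)) has_real_derivative (grad w x \<bullet> s)) (at 0)"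
      proof -
        have "(\<lambda>t. grad w x \<bullet> (t *\<^sub>R s)) = (*) (grad w x \<bullet> s)" by (simp add: fun_eq_iff)
        then show ?thesis
          using \<open>((\<lambda>t. w (x + t *\<^sub>R s)) has_derivative (\<lambda>t. grad w x \<bullet> (t *\<^sub>R s))) (at 0)\<close>
          unfolding has_field_derivative_def by simp
      qed
      then have "((\<lambda>t. (w (x + t *\<^sub>R s) - w x) / t) \<longlongrightarrow> grad w x \<bullet> s) (at 0)"
        by (simp add: has_field_derivative_iff)
      moreover have "filterlim ?t (at 0) sequentially"
        unfolding filterlim_at using LIMSEQ_inverse_real_of_nat by (auto simp: inverse_eq_divide)
      ultimately have "(\<lambda>k. (w (x + ?t k *\<^sub>R s) - w x) / ?t k) \<longlonglongrightarrow> grad w x \<bullet> s"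
        by (rule filterlim_compose)
      then show "(\<lambda>k. f k z) \<longlonglongrightarrow> f0 z"
        unfolding z f_def f0_def by (cases "norm s < 1") (auto intro!: tendsto_ennrealI tendsto_power simp del: of_nat_Suc)
    qed
  qed
  moreover have "(\<integral>\<^sup>+z. f0 z \<partial>(lborel \<Otimes>\<^sub>M lborel)) = ennreal (dirichlet w * ball_moment TYPE('n))"
  proof -
    have "(\<integral>\<^sup>+z. f0 z \<partial>(lborel \<Otimes>\<^sub>M lborel)) = (\<integral>\<^sup>+x. \<integral>\<^sup>+s. ennreal (if norm s < 1 then (grad w x \<bullet> s)\<^sup>2 else 0) \<partial>lborel \<partial>lborel)"
    proof -
      have "f0 \<in> borel_measurable (lborel \<Otimes>\<^sub>M lborel)" unfolding f0_def g_def by measurable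
      from lborel.nn_integral_fst[OF this] show ?thesis unfolding f0_def g_def fst_conv snd_conv by simp
    qed
    also have "\<dots> = (\<integral>\<^sup>+x. ennreal ((norm (grad w x))\<^sup>2) * ennreal (ball_moment TYPE('n)) \<partial>lborel)"
      by (simp add: ball_moment_inner)
    also have "\<dots> = (\<integral>\<^sup>+x. ennreal ((norm (grad w x))\<^sup>2) \<partial>lborel) * ennreal (ball_moment TYPE('n))"
      by (rule nn_integral_multc) measurable
    also have "(\<integral>\<^sup>+x. ennreal ((norm (grad w x))\<^sup>2) \<partial>lborel) = ennreal (dirichlet w)"
      unfolding dirichlet_def by (rule nn_integral_eq_integral[OF dirichlet_integrable[OF w]]) simp
    finally show ?thesis
      using ball_moment_pos[where 'n = 'n] by (simp add: ennreal_mult' dirichlet_def less_imp_le)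
  qed
  ultimately show ?thesis unfolding quotient_energy_def f_def by simp
qed

lemma dirichlet_le_of_energy_le:
  fixes u w :: "real^'n::finite \<Rightarrow> real"
  assumes u: "u \<in> C1_ball b" and w: "w \<in> C1_ball b'" and le: "\<And>t. 0 < t \<Longrightarrow> energy t w \<le> energy t u"
  shows "dirichlet w \<le> dirichlet u"
proof -
  have q: "quotient_energy t w \<le> quotient_energy t u" if t: "0 < t" for t
  proof -
    have "ennreal (t ^ (CARD('n) + 2)) * quotient_energy t w \<le> ennreal (t ^ (CARD('n) + 2)) * quotient_energy t u"
      using le[OF t] unfolding energy_eq_quotient_energy[OF C1_ball_measurable(1)[OF w] t]
        energy_eq_quotient_energy[OF C1_ball_measurable(1)[OF u] t] .
    then show ?thesis using t by (simp add: ennreal_mult_le_mult_iff)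
  qed
  have "ennreal (dirichlet w * ball_moment TYPE('n)) \<le> ennreal (dirichlet u * ball_moment TYPE('n))"
    by (rule LIMSEQ_le[OF quotient_energy_limit[OF w] quotient_energy_limit[OF u]]) (use q in auto)
  moreover have "0 \<le> dirichlet u" unfolding dirichlet_def by (intro integral_nonneg_AE) auto
  ultimately show ?thesis
    using ball_moment_pos[where 'n = 'n] by (simp add: ennreal_le_iff)
qed

subsection \<open>Radial competitors\<close>

context reflection
begin

text \<open>\<open>D\<close> is the gain summed over a mirror pair: it is nonnegative, and its
  integral is twice the total gain. Keeping it explicit allows a strict inequality to be read off
  from a single point.\<close>

lemma integral_polarize:
  fixes q :: "real^'n \<Rightarrow> real" and \<Psi> :: "real \<Rightarrow> real"
  assumes q: "\<And>x. side x < 0 \<Longrightarrow> q (reflect x) \<le> q x" and \<Psi>: "\<And>s t. 0 \<le> s \<Longrightarrow> s \<le> t \<Longrightarrow> \<Psi> s \<le> \<Psi> t" and v: "\<And>x. 0 \<le> v x"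
    and i: "integrable lborel (\<lambda>x. q x * \<Psi> (v x))" "integrable lborel (\<lambda>x. q x * \<Psi> (polarize v x))"
  defines "D \<equiv> \<lambda>x. (q x * \<Psi> (polarize v x) + q (reflect x) * \<Psi> (polarize v (reflect x))) - (q x * \<Psi> (v x) + q (reflect x) * \<Psi> (v (reflect x)))"
  shows "\<And>x. 0 \<le> D x" "integrable lborel D"
    "(LINT x|lborel. D x) = 2 * (LINT x|lborel. q x * \<Psi> (polarize v x)) - 2 * (LINT x|lborel. q x * \<Psi> (v x))"
proof -
  have p: "(\<lambda>x. q (reflect x) * \<Psi> (v (reflect x))) = (\<lambda>x. (\<lambda>x. q x * \<Psi> (v x)) (reflect x))"
    "(\<lambda>x. q (reflect x) * \<Psi> (polarize v (reflect x))) = (\<lambda>x. (\<lambda>x. q x * \<Psi> (polarize v x)) (reflect x))" by auto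
  have m: "(\<lambda>x. q x * \<Psi> (v x)) \<in> borel_measurable borel" "(\<lambda>x. q x * \<Psi> (polarize v x)) \<in> borel_measurable borel"
    using i borel_measurable_integrable by auto
  note r = integral_reflection[OF m(1)] integral_reflection[OF m(2)]
  have i': "integrable lborel (\<lambda>x. q (reflect x) * \<Psi> (v (reflect x)))" "integrable lborel (\<lambda>x. q (reflect x) * \<Psi> (polarize v (reflect x)))"
    using r i by auto
  show "0 \<le> D x" for x unfolding D_def using polarize_weight_pointwise[of q \<Psi> v x, OF q \<Psi> v] by simp
  show "integrable lborel D" unfolding D_def using i i' by simp
  show "(LINT x|lborel. D x) = 2 * (LINT x|lborel. q x * \<Psi> (polarize v x)) - 2 * (LINT x|lborel. q x * \<Psi> (v x))"
    unfolding D_def using i i' r by simp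
qed

end

section \<open>Competitors and minimisation of the second moment\<close>

lemma lipschitz_continuous:
  fixes v :: "'a::real_normed_vector \<Rightarrow> real"
  assumes "\<And>x y. \<bar>v x - v y\<bar> \<le> L * norm (x - y)" "0 \<le> L"
  shows "continuous_on UNIV v"
proof -
  have "L-lipschitz_on UNIV v" using assms by (intro lipschitz_onI) (auto simp: dist_norm)
  then show ?thesis by (rule lipschitz_on_continuous_on)
qed

definition moment :: "(real^'n::finite \<Rightarrow> real) \<Rightarrow> real" where
  "moment v = (LINT x|lborel. (norm x)\<^sup>2 * v x)"

context hardy_sobolev_exponent
begin

text \<open>Every clause survives polarization and pointwise limits; L provides equicontinuity and c
  a common compact set. The energies are bounded at all scales t because the Dirichlet integral is
  recovered only in the limit of small t.\<close>

definition competitor :: "(real^'n \<Rightarrow> real) \<Rightarrow> real \<Rightarrow> real \<Rightarrow> (real^'n \<Rightarrow> real) \<Rightarrow> bool" where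
  "competitor u L c v \<longleftrightarrow> (\<forall>x. 0 \<le> v x) \<and> (\<forall>x y. \<bar>v x - v y\<bar> \<le> L * norm (x - y)) \<and> (\<forall>x. c \<le> norm x \<longrightarrow> v x = 0)
     \<and> (\<forall>t>0. energy t v \<le> energy t u) \<and> Lp_term p u \<le> Lp_term p v"

lemma competitorD:
  assumes "competitor u L c v"
  shows "0 \<le> v x" "\<bar>v x - v y\<bar> \<le> L * norm (x - y)" "c \<le> norm x \<Longrightarrow> v x = 0" "0 < t \<Longrightarrow> energy t v \<le> energy t u"
    "Lp_term p u \<le> Lp_term p v"
  using assms by (auto simp: competitor_def)

lemma Lp_tendsto_bounded:
  fixes v :: "nat \<Rightarrow> real^'n \<Rightarrow> real"
  assumes c: "0 < c" and m: "\<And>k. v k \<in> borel_measurable borel" "w \<in> borel_measurable borel"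
    and b: "\<And>k x. \<bar>v k x\<bar> \<le> M" and z: "\<And>k x. c \<le> norm x \<Longrightarrow> v k x = 0" and l: "\<And>x. (\<lambda>k. v k x) \<longlonglongrightarrow> w x"
  shows "integrable lborel (\<lambda>x. weight p x * \<bar>w x\<bar> powr p)" "(\<lambda>k. Lp_term p (v k)) \<longlonglongrightarrow> Lp_term p w"
proof -
  note [measurable] = m weight_measurable
  have bd: "\<bar>weight p x * \<bar>v k x\<bar> powr p\<bar> \<le> ((max 1 c)\<^sup>2 * M powr p) / (norm x)\<^sup>2" if "0 < norm x" "norm x < c" for k x
  proof -
    have "\<bar>v k x\<bar> powr p \<le> M powr p" using b p2 by (intro powr_mono2) auto
    then have "\<bar>weight p x\<bar> * \<bar>v k x\<bar> powr p \<le> (max 1 c)\<^sup>2 / (norm x)\<^sup>2 * M powr p"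
      using weight_bound[OF that] by (intro mult_mono) auto
    then show ?thesis by (simp add: abs_mult)
  qed
  have mm: "(\<lambda>x. weight p x * \<bar>v k x\<bar> powr p) \<in> borel_measurable borel" "(\<lambda>x. weight p x * \<bar>w x\<bar> powr p) \<in> borel_measurable borel" for k
    by measurable
  have zz: "weight p x * \<bar>v k x\<bar> powr p = 0" if "c \<le> norm x" for k x using z[OF that] p2 by simp
  have ll: "(\<lambda>k. weight p x * \<bar>v k x\<bar> powr p) \<longlonglongrightarrow> weight p x * \<bar>w x\<bar> powr p" for x
    using p2 by (intro tendsto_mult tendsto_const tendsto_powr' tendsto_rabs l) auto
  show "integrable lborel (\<lambda>x. weight p x * \<bar>w x\<bar> powr p)" "(\<lambda>k. Lp_term p (v k)) \<longlonglongrightarrow> Lp_term p w"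
    unfolding Lp_term_def using inverse_square_dominated(1,3)[OF n3 c mm bd zz ll] by blast+
qed

lemma competitor_integrable:
  fixes v :: "real^'n \<Rightarrow> real"
  assumes v: "continuous_on UNIV v" "\<And>x. c \<le> norm x \<Longrightarrow> v x = 0" and c: "0 < c"
  shows "integrable lborel (\<lambda>x. weight p x * \<bar>v x\<bar> powr p)" "integrable lborel (\<lambda>x. (norm x)\<^sup>2 * v x)"
proof -
  obtain M where "\<And>x. norm (v x) \<le> M" using bounded_compact_support[OF v] by blast
  then show "integrable lborel (\<lambda>x. weight p x * \<bar>v x\<bar> powr p)"
    using Lp_tendsto_bounded(1)[OF c, of "\<lambda>_. v" v M] v borel_measurable_continuous_onI[OF v(1)] by auto
  show "integrable lborel (\<lambda>x. (norm x)\<^sup>2 * v x)"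
    by (rule integrable_continuous_compact_support[where c = c]) (use v in \<open>auto intro!: continuous_intros\<close>)
qed

text \<open>The junk value \<open>0 powr a = 0\<close> makes the weight fail to be decreasing at the origin, so it is changed there.\<close>
lemma competitor_polarize:
  fixes v :: "real^'n \<Rightarrow> real"
  assumes v: "competitor u L c v" and L: "0 \<le> L" and c: "0 < c" and ab: "reflection a b"
  shows "competitor u L c (reflection.polarize a b v)"
    "v a < v b \<Longrightarrow> moment (reflection.polarize a b v) < moment v"
proof -
  interpret reflection a b by (rule ab)
  note vD = competitorD[OF v]
  have vc: "continuous_on UNIV v" by (rule lipschitz_continuous[OF vD(2) L])
  have lp: "\<bar>polarize v x - polarize v y\<bar> \<le> L * norm (x - y)" for x y by (rule polarize_lipschitz[OF vD(2) L])
  have pc: "continuous_on UNIV (polarize v)" by (rule lipschitz_continuous[OF lp L])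
  have pz: "polarize v x = 0" if "c \<le> norm x" for x by (rule polarize_support[OF vD(3,1) that])
  have pn: "0 \<le> polarize v x" for x using vD(1) by (auto simp: polarize_def le_max_iff_disj)
  note iv = competitor_integrable[OF vc vD(3) c]
  note ip = competitor_integrable[OF pc pz c]
  have en: "energy t (polarize v) \<le> energy t u" if "0 < t" for t
    using polarize_energy[OF borel_measurable_continuous_onI[OF vc], of t] vD(4)[OF that] by (rule order_trans)
  have Lp: "Lp_term p v \<le> Lp_term p (polarize v)"
  proof -
    \<comment> \<open>At the origin q takes the value at the mirror image, which turns the required
      monotonicity there into an equality; the integrals are unaffected.\<close>
    define q where "q = (\<lambda>x::real^'n. if x = 0 then weight p (reflect 0) else weight p x)"
    have nz: "reflect 0 \<noteq> 0"
    proof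
      assume "reflect 0 = 0"
      then have "norm (reflect 0) = 0" by simp
      moreover have "side 0 < 0" using m_pos by (simp add: side_def)
      ultimately show False using norm_reflect_le(3)[of 0] by simp
    qed
    have mono: "q (reflect x) \<le> q x" if "side x < 0" for x
    proof (cases "x = 0")
      case True then show ?thesis using nz by (simp add: q_def)
    next
      case False
      have "norm x < norm (reflect x)" using norm_reflect_le(3)[OF that] .
      then have "weight p (reflect x) \<le> weight p x"
        unfolding weight_def using False weight_exponent(2) by (intro powr_mono2') auto
      moreover have "reflect x \<noteq> 0" using \<open>norm x < norm (reflect x)\<close> by auto
      ultimately show ?thesis using False by (simp add: q_def)
    qed
    have q: "AE x in lborel. q x = weight p x"
      using AE_nonzero by eventually_elim (simp add: q_def)
    have qm: "q \<in> borel_measurable borel" unfolding q_def using weight_measurable by measurable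
    have tr: "integrable lborel (\<lambda>x. q x * w x powr p) \<and> (LINT x|lborel. q x * w x powr p) = Lp_term p w"
      if w: "integrable lborel (\<lambda>x. weight p x * \<bar>w x\<bar> powr p)" "\<And>x. 0 \<le> w x" "w \<in> borel_measurable borel" for w
    proof -
      note [measurable] = qm w(3) weight_measurable
      have ae: "AE x in lborel. q x * w x powr p = weight p x * \<bar>w x\<bar> powr p"
        using q by eventually_elim (use w(2) in simp)
      have m: "(\<lambda>x. q x * w x powr p) \<in> borel_measurable lborel" by measurable
      have m': "(\<lambda>x. weight p x * \<bar>w x\<bar> powr p) \<in> borel_measurable lborel" by measurable
      show ?thesis
        unfolding Lp_term_def using integral_cong_AE[OF m m' ae] integrable_cong_AE[OF m m' ae] w(1) by blast
    qed
    have 1: "integrable lborel (\<lambda>x. q x * v x powr p)" "(LINT x|lborel. q x * v x powr p) = Lp_term p v"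
      using tr[OF iv(1) vD(1) borel_measurable_continuous_onI[OF vc]] by auto
    have 2: "integrable lborel (\<lambda>x. q x * polarize v x powr p)" "(LINT x|lborel. q x * polarize v x powr p) = Lp_term p (polarize v)"
      using tr[OF ip(1) pn borel_measurable_continuous_onI[OF pc]] by auto
    have pm: "s powr p \<le> t powr p" if "0 \<le> s" "s \<le> t" for s t using that p2 by (intro powr_mono2) auto
    note P = integral_polarize[of q "\<lambda>s. s powr p" v, OF mono pm vD(1) 1(1) 2(1)]
    have "0 \<le> (LINT x|lborel. (q x * polarize v x powr p + q (reflect x) * polarize v (reflect x) powr p)
        - (q x * v x powr p + q (reflect x) * v (reflect x) powr p))"
      by (intro integral_nonneg_AE AE_I2) (rule P(1))
    then show ?thesis using P(3) 1(2) 2(2) by simp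
  qed
  show "competitor u L c (polarize v)"
    unfolding competitor_def using pn lp pz en Lp vD(5) by auto
  assume less: "v a < v b"
  \<comment> \<open>With this decreasing weight and \<Psi> the identity, the rearrangement
    inequality says that the second moment does not increase; at the point a the gain is
    strict.\<close>
  define q where "q = (\<lambda>x::real^'n. - (norm x)\<^sup>2)"
  have mono: "q (reflect x) \<le> q x" if "side x < 0" for x
    using norm_reflect_le(1)[of x] that by (simp add: q_def power_mono)
  have i: "integrable lborel (\<lambda>x. q x * v x)" "integrable lborel (\<lambda>x. q x * polarize v x)"
    using iv(2) ip(2) by (auto simp: q_def)
  note P = integral_polarize[of q "\<lambda>s. s" v, OF mono _ vD(1) i]
  define D where "D = (\<lambda>x. (q x * polarize v x + q (reflect x) * polarize v (reflect x)) - (q x * v x + q (reflect x) * v (reflect x)))"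
  have "0 < (LINT x|lborel. D x)"
  proof (rule integral_pos_continuous[where ?x0.0 = a])
    show "integrable lborel D" "\<And>x. 0 \<le> D x" unfolding D_def using P(1,2) by auto
    have rc: "continuous_on UNIV (\<lambda>x. w (reflect x))" if "continuous_on UNIV w" for w :: "real^'n \<Rightarrow> real"
      by (rule continuous_on_compose2[OF that reflect_continuous]) auto
    have "continuous_on UNIV D"
      unfolding D_def q_def by (intro continuous_intros rc pc vc reflect_continuous)
    then show "isCont D a" by (simp add: continuous_on_eq_continuous_at)
    have sa: "side a < 0"
    proof (rule ccontr)
      assume "\<not> side a < 0"
      then have "norm b \<le> norm a" using norm_reflect_le(2)[of a] by (simp add: reflect_a)
      then show False using norm_less by simp
    qed
    then have "polarize v a = v b" "polarize v b = v a"
      using polarize_reflect[of a v] less by (auto simp: polarize_def reflect_a)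
    then have "D a = ((norm b)\<^sup>2 - (norm a)\<^sup>2) * (v b - v a)"
      by (simp add: D_def q_def reflect_a algebra_simps)
    moreover have "(norm a)\<^sup>2 < (norm b)\<^sup>2" using norm_less by (intro power_strict_mono) auto
    ultimately show "0 < D a" using less by simp
  qed
  then have "2 * (LINT x|lborel. q x * v x) < 2 * (LINT x|lborel. q x * polarize v x)"
    using P(3) unfolding D_def by simp
  then show "moment (polarize v) < moment v" by (simp add: moment_def q_def)
qed

text \<open>Inside the ball of radius c, comparison with a point of norm c, at distance at most 2 c,
  where v vanishes.\<close>

lemma competitor_bound:
  fixes v :: "real^'n \<Rightarrow> real"
  assumes v: "competitor u L c v" and "0 \<le> L" "0 < c"
  shows "\<bar>v x\<bar> \<le> L * (2 * c)"
proof (cases "c \<le> norm x")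
  case False
  let ?y = "c *\<^sub>R axis undefined 1 :: real^'n"
  have n: "norm ?y = c" using assms(3) by simp
  then have "v ?y = 0" using competitorD(3)[OF v] by simp
  then have "\<bar>v x\<bar> \<le> L * norm (x - ?y)" using competitorD(2)[OF v, of x ?y] by simp
  also have "\<dots> \<le> L * (2 * c)"
    using False n norm_triangle_ineq4[of x ?y] assms(2) by (intro mult_left_mono) auto
  finally show ?thesis .
qed (use competitorD(3)[OF v] assms in simp)

text \<open>The direct method. Sign, Lipschitz bound and support pass to pointwise limits, the
  energies by Fatou, the weighted norm and the moment by dominated convergence.\<close>

lemma minimal_competitor:
  fixes u :: "real^'n \<Rightarrow> real"
  assumes ex: "competitor u L c v0" and L: "0 \<le> L" and c: "0 < c"
  obtains v where "competitor u L c v" "\<And>w. competitor u L c w \<Longrightarrow> moment v \<le> moment w"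
proof -
  define I where "I = Inf (moment ` Collect (competitor u L c))"
  have nn: "0 \<le> moment w" if "competitor u L c w" for w
    unfolding moment_def using competitorD(1)[OF that] by (intro integral_nonneg_AE) auto
  have bdd: "bdd_below (moment ` Collect (competitor u L c))" using nn by (intro bdd_belowI[of _ 0]) auto
  have "\<exists>w. competitor u L c w \<and> moment w < I + 1 / real (Suc k)" for k
  proof -
    have "I < I + 1 / real (Suc k)" by simp
    then obtain y where "y \<in> moment ` Collect (competitor u L c)" "y < I + 1 / real (Suc k)"
      using cInf_lessD[of "moment ` Collect (competitor u L c)" "I + 1 / real (Suc k)"] ex
      unfolding I_def by (metis (no_types, lifting) empty_iff imageI mem_Collect_eq)
    then show ?thesis by auto
  qed
  then obtain V where V: "\<And>k. competitor u L c (V k)" "\<And>k. moment (V k) < I + 1 / real (Suc k)" by metis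
  obtain g r where g: "strict_mono (r :: nat \<Rightarrow> nat)" "\<And>e. 0 < e \<Longrightarrow> \<exists>N. \<forall>n x. n \<ge> N \<and> x \<in> cball 0 c \<longrightarrow> norm (V (r n) x - g x) < e"
  proof (rule Arzela_Ascoli[of "cball 0 c" V "L * (2 * c)"])
    show "\<exists>d>0. \<forall>n y. y \<in> cball 0 c \<and> norm (x - y) < d \<longrightarrow> norm (V n x - V n y) < e" if "0 < e" for x e
    proof (intro exI[of _ "e / (L + 1)"] conjI allI impI)
      show "0 < e / (L + 1)" using \<open>0 < e\<close> L by simp
      fix n y assume "y \<in> cball 0 c \<and> norm (x - y) < e / (L + 1)"
      then have "norm (x - y) * (L + 1) < e" using L by (simp add: pos_less_divide_eq)
      moreover have "L * norm (x - y) \<le> norm (x - y) * (L + 1)" by (simp add: algebra_simps)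
      ultimately show "norm (V n x - V n y) < e" using competitorD(2)[OF V(1), of n x y] by simp
    qed
    show "norm (V n x) \<le> L * (2 * c)" for n x using competitor_bound[OF V(1) L c] by simp
  qed auto
  \<comment> \<open>The limit g is controlled on the closed ball only; the competitors vanish
    outside it, so extension by zero is the limit everywhere.\<close>
  define v where "v = (\<lambda>x. if norm x \<le> c then g x else 0)"
  define W where "W = (\<lambda>n. V (r n))"
  have W: "competitor u L c (W n)" for n using V(1)[of "r n"] by (simp add: W_def)
  have lim: "(\<lambda>n. W n x) \<longlonglongrightarrow> v x" for x
  proof (cases "norm x \<le> c")
    case True
    show ?thesis
    proof (rule LIMSEQ_I)
      fix e :: real assume "0 < e"
      then obtain M where "\<forall>n x. n \<ge> M \<and> x \<in> cball 0 c \<longrightarrow> norm (V (r n) x - g x) < e" using g(2) by blast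
      then show "\<exists>no. \<forall>n\<ge>no. norm (W n x - v x) < e"
        using True by (intro exI[of _ M]) (simp add: W_def v_def)
    qed
  next
    case False
    then show ?thesis using competitorD(3)[OF W, of x] by (simp add: v_def)
  qed
  have v1: "0 \<le> v x" for x by (rule LIMSEQ_le_const[OF lim]) (use competitorD(1)[OF W] in auto)
  have v2: "\<bar>v x - v y\<bar> \<le> L * norm (x - y)" for x y
    by (rule LIMSEQ_le_const2[OF tendsto_rabs[OF tendsto_diff[OF lim lim]]]) (use competitorD(2)[OF W] in auto)
  have v3: "v x = 0" if "c \<le> norm x" for x
    using LIMSEQ_unique[OF lim, of x 0] competitorD(3)[OF W that] by simp
  have vc: "continuous_on UNIV v" by (rule lipschitz_continuous[OF v2 L])
  have Wc: "continuous_on UNIV (W n)" for n by (rule lipschitz_continuous[OF competitorD(2)[OF W] L])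
  note m = borel_measurable_continuous_onI[OF Wc] borel_measurable_continuous_onI[OF vc]
  have v4: "energy t v \<le> energy t u" if "0 < t" for t
    by (rule energy_lower_semicontinuous[OF m lim competitorD(4)[OF W that]])
  have "(\<lambda>n. Lp_term p (W n)) \<longlonglongrightarrow> Lp_term p v"
    by (rule Lp_tendsto_bounded(2)[OF c m competitor_bound[OF W L c] competitorD(3)[OF W] lim])
  then have v5: "Lp_term p u \<le> Lp_term p v"
    by (rule LIMSEQ_le_const) (use competitorD(5)[OF W] in auto)
  have cv: "competitor u L c v" unfolding competitor_def using v1 v2 v3 v4 v5 by auto
  have "(\<lambda>n. moment (W n)) \<longlonglongrightarrow> moment v"
    unfolding moment_def
  proof (rule integral_dominated_convergence)
    show "integrable lborel (\<lambda>x::real^'n. (c\<^sup>2 * (L * (2 * c))) * indicator (ball 0 c) x)"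
      using emeasure_lborel_ball_finite[of "0::real^'n" c] by (intro integrable_mult_right) simp
    show "AE x in lborel. norm ((norm x)\<^sup>2 * W n x) \<le> c\<^sup>2 * (L * (2 * c)) * indicator (ball 0 c) x" for n
    proof (rule AE_I2)
      fix x :: "real^'n"
      show "norm ((norm x)\<^sup>2 * W n x) \<le> c\<^sup>2 * (L * (2 * c)) * indicator (ball 0 c) x"
      proof (cases "norm x < c")
        case True
        have "(norm x)\<^sup>2 * \<bar>W n x\<bar> \<le> c\<^sup>2 * (L * (2 * c))"
          using True competitor_bound[OF W L c, of n x] by (intro mult_mono power_mono) auto
        then show ?thesis using True by (simp add: abs_mult)
      qed (use competitorD(3)[OF W] in simp)
    qed
    show "AE x in lborel. (\<lambda>n. (norm x)\<^sup>2 * W n x) \<longlonglongrightarrow> (norm x)\<^sup>2 * v x"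
      by (intro AE_I2 tendsto_mult tendsto_const lim)
  qed (use m in measurable)
  moreover have "moment (W n) \<le> I + 1 / real (Suc n)" for n
  proof -
    have "n \<le> r n" using g(1) strict_mono_imp_increasing by blast
    then have "1 / real (Suc (r n)) \<le> 1 / real (Suc n)" by (simp add: frac_le)
    then show ?thesis using V(2)[of "r n"] by (simp add: W_def)
  qed
  moreover have "(\<lambda>n. I + 1 / real (Suc n)) \<longlonglongrightarrow> I + 0"
    using LIMSEQ_inverse_real_of_nat by (intro tendsto_add tendsto_const) (simp add: inverse_eq_divide)
  ultimately have "moment v \<le> I + 0" by (intro LIMSEQ_le[of "\<lambda>n. moment (W n)"]) auto
  moreover have "I \<le> moment w" if "competitor u L c w" for w
    unfolding I_def using that bdd by (intro cInf_lower) auto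
  ultimately show ?thesis using that[OF cv] by fastforce
qed

text \<open>If some b farther from the origin than a had v a < v b, polarization in their bisector
  would lower the minimal moment.\<close>

lemma radial_competitor:
  fixes u :: "real^'n \<Rightarrow> real"
  assumes ex: "competitor u L c v0" and L: "0 \<le> L" and c: "0 < c"
  obtains v where "competitor u L c v" "radial v"
proof -
  obtain v where v: "competitor u L c v" "\<And>w. competitor u L c w \<Longrightarrow> moment v \<le> moment w"
    using minimal_competitor[OF ex L c] by blast
  have mono: "v b \<le> v a" if "norm a < norm b" for a b
  proof (rule ccontr)
    assume "\<not> v b \<le> v a"
    moreover have ab: "reflection a b" using that by unfold_locales
    ultimately show False
      using competitor_polarize[OF v(1) L c ab] v(2)[of "reflection.polarize a b v"] by simp
  qed
  have vc: "continuous_on UNIV v" by (rule lipschitz_continuous[OF competitorD(2)[OF v(1)] L])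
  \<comment> \<open>Polarization compares points of different norm only. Points of equal norm are
    reached by moving y slightly outward and using continuity, which requires y to be
    nonzero.\<close>
  have le: "v y \<le> v x" if "norm x = norm y" "x \<noteq> 0" for x y
  proof (rule LIMSEQ_le_const2)
    have "isCont v y" using vc by (simp add: continuous_on_eq_continuous_at)
    moreover have "(\<lambda>n. (1 + inverse (real (Suc n))) *\<^sub>R y) \<longlonglongrightarrow> (1 + 0) *\<^sub>R y"
      by (intro tendsto_intros LIMSEQ_inverse_real_of_nat)
    ultimately show "(\<lambda>n. v ((1 + inverse (real (Suc n))) *\<^sub>R y)) \<longlonglongrightarrow> v y"
      by (intro isCont_tendsto_compose[of y v]) auto
    have "norm x < norm ((1 + inverse (real (Suc n))) *\<^sub>R y)" for n
    proof -
      have "0 < inverse (real (Suc n)) * norm y" using that by (metis inverse_positive_iff_positive mult_pos_pos of_nat_0_less_iff zero_less_Suc zero_less_norm_iff)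
      then show ?thesis using that(1) by (simp add: distrib_right abs_of_nonneg add_nonneg_nonneg)
    qed
    then show "\<exists>N. \<forall>n\<ge>N. v ((1 + inverse (real (Suc n))) *\<^sub>R y) \<le> v x" using mono by blast
  qed
  have "radial v"
    unfolding radial_def
  proof (intro allI impI)
    fix x y :: "real^'n" assume xy: "norm x = norm y"
    show "v x = v y"
    proof (cases "x = 0")
      case True then show ?thesis using xy by simp
    next
      case False
      then have "y \<noteq> 0" using xy by auto
      then show ?thesis using le[of x y] le[of y x] xy False by simp
    qed
  qed
  then show ?thesis using that v(1) by blast
qed

end

text \<open>The smooth product kernel is not rotation invariant; \<open>rad_bump\<close> is, at the
  price of C1 regularity.\<close>

lemma radial_mollifier_exists:
  assumes "0 < \<delta>"
  obtains \<zeta> :: "real^'n::finite \<Rightarrow> real" where "mollifier \<delta> \<zeta>" "radial \<zeta>"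
    "\<And>v c. continuous_on UNIV v \<Longrightarrow> (\<And>x. c \<le> norm x \<Longrightarrow> v x = 0) \<Longrightarrow> C1 (conv \<zeta> v)"
proof -
  let ?r = "rad_bump \<delta> :: real^'n \<Rightarrow> real"
  have r: "?r \<in> C1_ball (2 * \<delta>)" using assms by (intro rad_bump_C1_ball) auto
  have rc: "continuous_on UNIV ?r" using r C1_continuous by (auto simp: C1_ball_def)
  have z: "?r x = 0" if "\<delta> \<le> norm x" for x using rad_bump_zero[of \<delta> x] assms that by simp
  have i: "integrable lborel ?r" by (rule integrable_continuous_compact_support[OF rc z])
  define I where "I = (LINT x|lborel. ?r x)"
  have I: "0 < I"
    unfolding I_def
  proof (rule integral_pos_continuous[OF i])
    show "0 \<le> ?r x" for x by (simp add: rad_bump_def)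
    show "isCont ?r 0" using rc by (simp add: continuous_on_eq_continuous_at)
    show "0 < ?r 0" using assms by (simp add: rad_bump_def)
  qed
  define \<zeta> where "\<zeta> = (\<lambda>x. ?r x / I)"
  have m: "mollifier \<delta> \<zeta>"
  proof -
    have "0 \<le> ?r x" for x by (simp add: rad_bump_def)
    then show ?thesis
      unfolding mollifier_def \<zeta>_def using rc I z i by (auto simp: I_def[symmetric] intro!: continuous_intros)
  qed
  moreover have "radial \<zeta>" using radial_rad_bump[of \<delta>] unfolding radial_def \<zeta>_def by metis
  moreover have "C1 (conv \<zeta> v)" if v: "continuous_on UNIV v" "\<And>x. c \<le> norm x \<Longrightarrow> v x = 0" for v c
  proof -
    have "C1 (conv (\<lambda>y. v y / I) ?r)"
      by (rule conv_C1(1)[OF _ _ r, of _ c]) (use v I in \<open>auto intro!: continuous_intros\<close>)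
    moreover have "conv (\<lambda>y. v y / I) ?r = conv v \<zeta>" by (simp add: conv_def \<zeta>_def fun_eq_iff)
    moreover have "conv v \<zeta> = conv \<zeta> v"
      using conv_commute[OF v(1)] m by (auto simp: mollifier_def)
    ultimately show ?thesis by simp
  qed
  ultimately show ?thesis using that by blast
qed

lemma radial_conv:
  fixes v \<zeta> :: "real^'n::finite \<Rightarrow> real"
  assumes "radial v" "radial \<zeta>" "continuous_on UNIV v" "continuous_on UNIV \<zeta>"
  shows "radial (conv \<zeta> v)"
  unfolding radial_def
proof (intro allI impI)
  fix x y :: "real^'n" assume "norm x = norm y"
  then obtain T :: "real^'n \<Rightarrow> real^'n" where T: "orthogonal_transformation T" "T x = y"
    by (rule orthogonal_transformation_exists)
  have [measurable]: "T \<in> borel_measurable borel"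
    using orthogonal_transformation_linear[OF T(1)] linear_conv_bounded_linear
    by (auto intro!: borel_measurable_continuous_onI linear_continuous_on)
  have m: "(\<lambda>z. \<zeta> z * v (y - z)) \<in> borel_measurable borel"
    by (intro borel_measurable_continuous_onI continuous_intros assms continuous_on_compose2[OF assms(3)]) auto
  have "conv \<zeta> v y = (LINT z|lborel. \<zeta> (T z) * v (y - T z))"
    using integral_distr[of T lborel lborel "\<lambda>z. \<zeta> z * v (y - z)"] m by (simp add: conv_def distr_orthogonal[OF T(1)])
  also have "\<dots> = conv \<zeta> v x"
  proof -
    have "\<zeta> (T z) = \<zeta> z" "v (y - T z) = v (x - z)" for z
    proof -
      show "\<zeta> (T z) = \<zeta> z" using assms(2) orthogonal_transformation_norm[OF T(1)] unfolding radial_def by blast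
      have "y - T z = T (x - z)"
        using T(2) linear_diff[OF orthogonal_transformation_linear[OF T(1)]] by simp
      then show "v (y - T z) = v (x - z)" using assms(1) orthogonal_transformation_norm[OF T(1)] unfolding radial_def by metis
    qed
    then show ?thesis by (simp add: conv_def)
  qed
  finally show "conv \<zeta> v x = conv \<zeta> v y" by simp
qed

context hardy_sobolev_exponent
begin

text \<open>|u| is a competitor, hence a radial one v exists. It is only Lipschitz, so the
  hypothesis is applied to its radial mollifications, whose energies at every scale, and therefore
  whose Dirichlet integrals, are bounded by those of u. Their weighted norms converge to that of v,
  which is at least that of u.\<close>

lemma radial_reduction:
  fixes u :: "real^'n \<Rightarrow> real"
  assumes S: "0 \<le> S" "\<And>(w :: real^'n \<Rightarrow> real) b. w \<in> C1_ball b \<Longrightarrow> radial w \<Longrightarrow> 0 < b \<Longrightarrow> S * Lp_term p w powr (2 / p) \<le> dirichlet w"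
    and u: "u \<in> C1_ball b"
  shows "S * Lp_term p u powr (2 / p) \<le> dirichlet u"
proof -
  obtain c0 where c0: "0 \<le> c0" "\<And>x. c0 \<le> norm x \<Longrightarrow> u x = 0" using C1_ballD[OF u] by metis
  obtain L where L: "0 \<le> L" "\<And>x y. \<bar>u x - u y\<bar> \<le> L * norm (x - y)" using C1_ball_lipschitz[OF u] by blast
  define c where "c = c0 + 1"
  have c: "0 < c" "\<And>x. c \<le> norm x \<Longrightarrow> u x = 0" using c0 by (auto simp: c_def)
  have "competitor u L c (\<lambda>x. \<bar>u x\<bar>)"
    unfolding competitor_def
  proof (intro conjI allI impI)
    show "\<bar>\<bar>u x\<bar> - \<bar>u y\<bar>\<bar> \<le> L * norm (x - y)" for x y using L(2)[of x y] by linarith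
    show "energy t (\<lambda>x. \<bar>u x\<bar>) \<le> energy t u" for t
      unfolding energy_def
    proof (intro nn_integral_mono ennreal_leI)
      fix x y
      have "(\<bar>u y\<bar> - \<bar>u x\<bar>)\<^sup>2 \<le> (u y - u x)\<^sup>2"
        by (simp add: abs_le_square_iff[symmetric] abs_triangle_ineq3)
      then show "(if dist x y < t then (\<bar>u y\<bar> - \<bar>u x\<bar>)\<^sup>2 else 0) \<le> (if dist x y < t then (u y - u x)\<^sup>2 else 0)" by simp
    qed
  qed (use c in \<open>auto simp: Lp_term_def\<close>)
  then obtain v where v: "competitor u L c v" "radial v" using radial_competitor L(1) c(1) by blast
  note vD = competitorD[OF v(1)]
  have vc: "continuous_on UNIV v" by (rule lipschitz_continuous[OF vD(2) L(1)])
  define \<delta> where "\<delta> = (\<lambda>k. inverse (real (Suc k)))"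
  have \<delta>: "0 < \<delta> k" "\<delta> k \<le> 1" for k by (auto simp: \<delta>_def inverse_eq_divide)
  have "\<exists>\<zeta> :: real^'n \<Rightarrow> real. mollifier (\<delta> k) \<zeta> \<and> radial \<zeta> \<and> C1 (conv \<zeta> v)" for k
    using radial_mollifier_exists[OF \<delta>(1)[of k]] vc vD(3) by metis
  then obtain \<zeta> :: "nat \<Rightarrow> real^'n \<Rightarrow> real" where \<zeta>: "\<And>k. mollifier (\<delta> k) (\<zeta> k)" "\<And>k. radial (\<zeta> k)" "\<And>k. C1 (conv (\<zeta> k) v)"
    by metis
  define w where "w = (\<lambda>k. conv (\<zeta> k) v)"
  have wz: "w k x = 0" if "c + 1 \<le> norm x" for k x
    unfolding w_def by (rule conv_mollifier_support[OF \<zeta>(1) vc vD(3)]) (use that \<delta>(2)[of k] in auto)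
  have wb: "w k \<in> C1_ball (c + 2)" for k
    unfolding C1_ball_def using \<zeta>(3) wz c(1) by (auto simp: w_def intro!: exI[of _ "c + 1"])
  have wr: "radial (w k)" for k
    unfolding w_def using \<zeta>(1)[of k] by (intro radial_conv v(2) \<zeta>(2) vc) (simp add: mollifier_def)
  have "energy t (w k) \<le> energy t u" if "0 < t" for t k
    unfolding w_def using energy_conv_le[OF \<zeta>(1) vc] vD(4)[OF that] by (rule order_trans)
  then have wd: "dirichlet (w k) \<le> dirichlet u" for k by (rule dirichlet_le_of_energy_le[OF u wb])
  have "\<delta> \<longlonglongrightarrow> 0" unfolding \<delta>_def by (rule LIMSEQ_inverse_real_of_nat)
  then have wl: "(\<lambda>k. w k x) \<longlonglongrightarrow> v x" for x
    unfolding w_def by (rule conv_mollifier_tendsto[OF \<zeta>(1) vc])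
  have wM: "\<bar>w k x\<bar> \<le> L * (2 * c)" for k x
    using conv_mollifier_bound[OF \<zeta>(1) vc, of "L * (2 * c)" k x] competitor_bound[OF v(1) L(1) c(1)] by (simp add: w_def)
  have Lp: "(\<lambda>k. Lp_term p (w k)) \<longlonglongrightarrow> Lp_term p v"
    using c(1) by (intro Lp_tendsto_bounded(2)[OF _ C1_ball_measurable(1)[OF wb] borel_measurable_continuous_onI[OF vc] wM wz wl]) auto
  have "S * Lp_term p (w k) powr (2 / p) \<le> dirichlet u" for k
    using S(2)[OF wb wr] c(1) wd[of k] by (meson add_pos_pos order_trans zero_less_numeral)
  then have "S * Lp_term p v powr (2 / p) \<le> dirichlet u"
    by (rule inequality_limit[OF _ tendsto_const Lp]) (use p2 Lp_term_nonneg in auto)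
  moreover have "S * Lp_term p u powr (2 / p) \<le> S * Lp_term p v powr (2 / p)"
    using S(1) vD(5) Lp_term_nonneg p2 by (intro mult_left_mono powr_mono2) auto
  ultimately show ?thesis by linarith
qed

end

context hardy_setting
begin

text \<open>Any constant valid for the Hardy deficit gives, on radial functions and then by radial
  reduction on all test functions, an admissible Sobolev constant, which \<open>S_const\<close>
  dominates.\<close>

lemma hardy_sobolev_constant_le:
  assumes \<alpha>: "0 < \<alpha>" "\<alpha> \<le> 1" and C: "0 \<le> C"
    and hyp: "\<And>u :: real^'n \<Rightarrow> real. u \<in> test_functions (ball 0 1) \<Longrightarrow> C * weighted_term p \<alpha> u \<le> hardy_deficit \<theta> R u"
  shows "C * N powr ((p + 2) / p) \<le> S_const TYPE('n) p"
proof (rule sobolev_bound_le_S_const)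
  show "sobolev_bound (C * N powr ((p + 2) / p))"
    unfolding sobolev_bound_def
  proof
    fix u :: "real^'n \<Rightarrow> real" assume "u \<in> test_functions UNIV"
    then obtain b where b: "0 < b" "u \<in> test_functions (ball 0 b)" by (rule test_functions_UNIV)
    show "C * N powr ((p + 2) / p) * Lp_term p u powr (2 / p) \<le> dirichlet u"
    proof (rule radial_reduction[OF _ _ test_functions_C1_ball[OF b(2,1)]])
      show "0 \<le> C * N powr ((p + 2) / p)" using C by simp
      show "C * N powr ((p + 2) / p) * Lp_term p w powr (2 / p) \<le> dirichlet w"
        if "w \<in> C1_ball b" "radial w" "0 < b" for w :: "real^'n \<Rightarrow> real" and b
        by (rule sharp_radial_ball[OF \<alpha> C hyp that])
    qed
  qed
qed

end

theorem theorem7: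
  fixes p \<theta> R \<alpha>\<^sub>0 K :: real
  assumes "CARD('n::finite) \<ge> 3"
    and "2 < p" and "p \<le> 2 * real CARD('n) / (real CARD('n) - 2)"
    and "0 < \<theta>" and "\<theta> < 2"
    and "R > 1" and "R powr \<theta> = 1 + 1 / sqrt (real CARD('n) - 2)"
    and "0 < \<alpha>\<^sub>0" and "\<alpha>\<^sub>0 < 1"
    and "- ln \<alpha>\<^sub>0 = R powr (2 * \<theta>) - 1 +
           (LINT s:{0<..<1}|lborel.
              s powr (\<theta> - 1) * (2 * R powr \<theta> - s powr \<theta>) / (R powr \<theta> - s powr \<theta>)\<^sup>2)"
  defines "K \<equiv> (real CARD('n) - 2) powr (- (p + 2) / p) * S_const TYPE('n) p"
  shows "\<forall>\<alpha>. 0 < \<alpha> \<and> \<alpha> \<le> \<alpha>\<^sub>0 \<longrightarrow>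
           (\<forall>u \<in> test_functions (ball (0 :: real^'n) 1).
              hardy_deficit \<theta> R u \<ge> K * weighted_term p \<alpha> u) \<and>
           (\<forall>C > K. \<not> (\<forall>u \<in> test_functions (ball (0 :: real^'n) 1).
              hardy_deficit \<theta> R u \<ge> C * weighted_term p \<alpha> u))"
proof (intro allI impI conjI)
  define N where "N = real CARD('n) - 2"
  define A where "A = R powr \<theta>"
  interpret hardy_setting p N \<theta> A "TYPE('n)" R
    using assms(1-7) by unfold_locales (auto simp: N_def A_def)
  have "R powr (2 * \<theta>) = A\<^sup>2"
    unfolding A_def by (simp add: power2_eq_square flip: powr_add)
  moreover have "(LINT s:{0<..<1}|lborel. s powr (\<theta> - 1) * (2 * R powr \<theta> - s powr \<theta>) / (R powr \<theta> - s powr \<theta>)\<^sup>2) = Q 1 - Q 0"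
  proof -
    have "Q' = (\<lambda>s. s powr (\<theta> - 1) * (2 * R powr \<theta> - s powr \<theta>) / (R powr \<theta> - s powr \<theta>)\<^sup>2)"
      unfolding A_def[symmetric] by (simp add: Q'_def fun_eq_iff)
    then show ?thesis using integral_Q' by simp
  qed
  \<comment> \<open>With the integral evaluated, the defining equation of
    \<open>\<alpha>\<^sub>0\<close> becomes the threshold in \<open>X_upper\<close>.\<close>
  ultimately have ln\<alpha>: "ln \<alpha>\<^sub>0 = 1 - A\<^sup>2 - Q 1 + Q 0" using assms(10) by simp
  fix \<alpha> assume "0 < \<alpha> \<and> \<alpha> \<le> \<alpha>\<^sub>0"
  then have \<alpha>: "0 < \<alpha>" "\<alpha> \<le> 1" "ln \<alpha> \<le> 1 - A\<^sup>2 - Q 1 + Q 0"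
    using assms(8,9) by (auto simp flip: ln\<alpha>)
  have K: "K = N powr (- (p + 2) / p) * S_const TYPE('n) p" by (simp add: K_def N_def)
  show "\<forall>u \<in> test_functions (ball (0 :: real^'n) 1). K * weighted_term p \<alpha> u \<le> hardy_deficit \<theta> R u"
    unfolding K using hardy_sobolev_inequality[OF \<alpha>] by blast
  fix C assume C: "C > K"
  \<comment> \<open>Together with C > K this yields the nonnegativity of C that
    \<open>hardy_sobolev_constant_le\<close> requires.\<close>
  have K0: "0 \<le> K" using S_const_nonneg by (simp add: K)
  show "\<not> (\<forall>u \<in> test_functions (ball (0 :: real^'n) 1). C * weighted_term p \<alpha> u \<le> hardy_deficit \<theta> R u)"
  proof
    assume "\<forall>u \<in> test_functions (ball (0 :: real^'n) 1). C * weighted_term p \<alpha> u \<le> hardy_deficit \<theta> R u"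
    then have "C * N powr ((p + 2) / p) \<le> S_const TYPE('n) p"
      using C K0 by (intro hardy_sobolev_constant_le[OF \<alpha>(1,2)]) auto
    moreover have "K * N powr ((p + 2) / p) = S_const TYPE('n) p"
    proof -
      have "N powr (- (p + 2) / p) * N powr ((p + 2) / p) = N powr 0"
        unfolding powr_add[symmetric] by (simp add: add_divide_distrib[symmetric])
      also have "\<dots> = 1" using N by simp
      finally show ?thesis unfolding K by (metis mult.assoc mult.commute mult_1)
    qed
    moreover have "K * N powr ((p + 2) / p) < C * N powr ((p + 2) / p)"
      using C N by (intro mult_strict_right_mono) auto
    ultimately show False by linarith
  qed
qed

end
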